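(* Let $(R,\mathfrak m)$ be a commutative Artinian local ring satisfying $\nu(\mathfrak m)\ge \lambda(\mathfrak m^2)-\ell\ell(R)+4$, and let $M$, $N$ be finitely generated $R$-modules. (1) If $\mathfrak m^2M=0$ and $\operatorname{Tor}_i^R(M,N)=0$ for all integers $i\in[1,c(N)]$, then either $M$ or $N$ is free. (2) If $\mathfrak m^3=0$ and $\operatorname{Tor}_i^R(M,N)=0$ for three consecutive values of $i\ge 2$, then either $M$ or $N$ is free.
   Context: $\nu(-)$ denotes the minimal number of generators and $\lambda(-)$ denotes length. The Loewy length $\ell\ell(R)$ is, by the convention used here, the largest integer $h$ for which $\mathfrak m^h\neq 0$. For a finitely generated $R$-module $N$, $b_i(N)$ is the $i$-th Betti number of $N$ (the rank of the $i$-th free module in a minimal free resolution of $N$), and $c(N)=\max\{4,\ \log_2(b_1(N))+2\}$, where $\log_2 0=-\infty$. *)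

theory Defs
  imports "HOL-Algebra.Algebra" "HOL-Library.Extended_Nat" Complex_Main
begin

section \<open>Artinian local rings\<close>

locale artinian_cring = cring +
  assumes descending_chain:
    "\<lbrakk>\<And>n. ideal (I n) R; \<And>n::nat. I (Suc n) \<subseteq> I n\<rbrakk> \<Longrightarrow> \<exists>n. \<forall>k\<ge>n. I k = I n"

locale local_cring = cring +
  fixes \<mm>
  assumes maximal: "maximalideal \<mm> R"
    and unique_maximal: "maximalideal J R \<Longrightarrow> J = \<mm>"

locale artinian_local_ring = artinian_cring R + local_cring R \<mm> for R (structure) and \<mm>

text \<open>Powers are taken in the monoid of ideals, so that \<^term>\<open>ideal_power R I 0\<close> is the unit ideal.\<close>

abbreviation ideal_power :: "('a, 'r) ring_scheme \<Rightarrow> 'a set \<Rightarrow> nat \<Rightarrow> 'a set" where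
  "ideal_power R I n \<equiv> I [^]\<^bsub>ideals_set R\<^esub> n"

definition loewy_length :: "('a, 'r) ring_scheme \<Rightarrow> 'a set \<Rightarrow> nat" where
  "loewy_length R \<mm> = (GREATEST h. ideal_power R \<mm> h \<noteq> {\<zero>\<^bsub>R\<^esub>})"


section \<open>Modules\<close>

text \<open>
  A module record extends the ring record; its fields \<open>mult\<close> and \<open>one\<close> play no role
  for modules and are left \<open>undefined\<close> in the constructions below.
\<close>

definition ideal_module :: "('a, 'r) ring_scheme \<Rightarrow> 'a set \<Rightarrow> ('a, 'a) module" where
  "ideal_module R I =
     \<lparr>carrier = I, monoid.mult = undefined, one = undefined, ring.zero = \<zero>\<^bsub>R\<^esub>,
      add = (\<oplus>\<^bsub>R\<^esub>), smult = (\<otimes>\<^bsub>R\<^esub>)\<rparr>"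

definition span_module :: "('a, 'r) ring_scheme \<Rightarrow> ('a, 'm) module \<Rightarrow> 'm set \<Rightarrow> 'm set" where
  "span_module R M S = \<Inter> {H. submodule H R M \<and> S \<subseteq> H}"

definition generates_module :: "('a, 'r) ring_scheme \<Rightarrow> ('a, 'm) module \<Rightarrow> 'm set \<Rightarrow> bool" where
  "generates_module R M S \<longleftrightarrow> S \<subseteq> carrier M \<and> span_module R M S = carrier M"

definition finitely_generated :: "('a, 'r) ring_scheme \<Rightarrow> ('a, 'm) module \<Rightarrow> bool" where
  "finitely_generated R M \<longleftrightarrow> (\<exists>S. finite S \<and> generates_module R M S)"

definition min_gens :: "('a, 'r) ring_scheme \<Rightarrow> ('a, 'm) module \<Rightarrow> enat" where
  "min_gens R M = (INF S \<in> {S. finite S \<and> generates_module R M S}. enat (card S))"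

definition module_length :: "('a, 'r) ring_scheme \<Rightarrow> ('a, 'm) module \<Rightarrow> enat" where
  "module_length R M =
     (SUP n \<in> {n. \<exists>C :: nat \<Rightarrow> 'm set.
                (\<forall>i\<le>n. submodule (C i) R M) \<and> (\<forall>i<n. C i \<subset> C (Suc i))}. enat n)"

definition ideal_smult :: "('a, 'r) ring_scheme \<Rightarrow> 'a set \<Rightarrow> ('a, 'm) module \<Rightarrow> 'm set" where
  "ideal_smult R I M = span_module R M {a \<odot>\<^bsub>M\<^esub> x | a x. a \<in> I \<and> x \<in> carrier M}"

definition lin_indep :: "('a, 'r) ring_scheme \<Rightarrow> ('a, 'm) module \<Rightarrow> 'm set \<Rightarrow> bool" where
  "lin_indep R M B \<longleftrightarrow>
     (\<forall>A a. finite A \<and> A \<subseteq> B \<and> a \<in> A \<rightarrow> carrier R \<and> (\<Oplus>\<^bsub>M\<^esub>x\<in>A. a x \<odot>\<^bsub>M\<^esub> x) = \<zero>\<^bsub>M\<^esub>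
        \<longrightarrow> (\<forall>x\<in>A. a x = \<zero>\<^bsub>R\<^esub>))"

definition free_module :: "('a, 'r) ring_scheme \<Rightarrow> ('a, 'm) module \<Rightarrow> bool" where
  "free_module R M \<longleftrightarrow> (\<exists>B. generates_module R M B \<and> lin_indep R M B)"

definition module_hom ::
  "('a, 'r) ring_scheme \<Rightarrow> ('a, 'm) module \<Rightarrow> ('a, 'n) module \<Rightarrow> ('m \<Rightarrow> 'n) set" where
  "module_hom R M N =
     {h \<in> carrier M \<rightarrow> carrier N.
        (\<forall>x\<in>carrier M. \<forall>y\<in>carrier M. h (x \<oplus>\<^bsub>M\<^esub> y) = h x \<oplus>\<^bsub>N\<^esub> h y) \<and>
        (\<forall>a\<in>carrier R. \<forall>x\<in>carrier M. h (a \<odot>\<^bsub>M\<^esub> x) = a \<odot>\<^bsub>N\<^esub> h x)}"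

definition module_kernel :: "('a, 'm) module \<Rightarrow> ('a, 'n) module \<Rightarrow> ('m \<Rightarrow> 'n) \<Rightarrow> 'm set" where
  "module_kernel M N h = {x \<in> carrier M. h x = \<zero>\<^bsub>N\<^esub>}"

text \<open>
  On cosets the scalar multiplication is \<open>r (H + x) = H + r x\<close>; the union below is over
  all representatives of the coset, for which the right-hand side is the same set.
\<close>

definition quotient_module :: "('a, 'm) module \<Rightarrow> 'm set \<Rightarrow> ('a, 'm set) module" where
  "quotient_module M H =
     \<lparr>carrier = a_rcosets\<^bsub>M\<^esub> H, monoid.mult = undefined, one = undefined, ring.zero = H,
      add = (<+>\<^bsub>M\<^esub>), smult = (\<lambda>r A. \<Union>x\<in>A. H +>\<^bsub>M\<^esub> (r \<odot>\<^bsub>M\<^esub> x))\<rparr>"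

definition zero_module :: "('a, 'm) module \<Rightarrow> bool" where
  "zero_module M \<longleftrightarrow> carrier M = {\<zero>\<^bsub>M\<^esub>}"


section \<open>Free resolutions and Betti numbers\<close>

text \<open>The free module $R^n$, realised on functions supported on \<open>{..<n}\<close>.\<close>

definition free_power :: "('a, 'r) ring_scheme \<Rightarrow> nat \<Rightarrow> ('a, nat \<Rightarrow> 'a) module" where
  "free_power R n =
     \<lparr>carrier = {..<n} \<rightarrow>\<^sub>E carrier R, monoid.mult = undefined, one = undefined,
      ring.zero = (\<lambda>i\<in>{..<n}. \<zero>\<^bsub>R\<^esub>),
      add = (\<lambda>f g. \<lambda>i\<in>{..<n}. f i \<oplus>\<^bsub>R\<^esub> g i),
      smult = (\<lambda>r f. \<lambda>i\<in>{..<n}. r \<otimes>\<^bsub>R\<^esub> f i)\<rparr>"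

text \<open>
  A resolution $\cdots \to R^{b_2} \to R^{b_1} \to R^{b_0} \to N \to 0$ by free modules of
  finite rank, with \<open>d i\<close> the differential from degree \<open>i + 1\<close> to degree \<open>i\<close> and
  \<open>\<epsilon>\<close> the augmentation. Finite ranks suffice for finitely generated modules over
  Noetherian (in particular Artinian) rings.
\<close>

definition free_resolution ::
  "('a, 'r) ring_scheme \<Rightarrow> ('a, 'n) module \<Rightarrow> (nat \<Rightarrow> nat) \<Rightarrow>
   (nat \<Rightarrow> (nat \<Rightarrow> 'a) \<Rightarrow> (nat \<Rightarrow> 'a)) \<Rightarrow> ((nat \<Rightarrow> 'a) \<Rightarrow> 'n) \<Rightarrow> bool" where
  "free_resolution R N b d \<epsilon> \<longleftrightarrow>
     (let F = (\<lambda>i. free_power R (b i)) in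
       \<epsilon> \<in> module_hom R (F 0) N \<and>
       (\<forall>i. d i \<in> module_hom R (F (Suc i)) (F i)) \<and>
       \<epsilon> ` carrier (F 0) = carrier N \<and>
       d 0 ` carrier (F 1) = module_kernel (F 0) N \<epsilon> \<and>
       (\<forall>i. d (Suc i) ` carrier (F (Suc (Suc i))) = module_kernel (F (Suc i)) (F i) (d i)))"

definition minimal_free_resolution ::
  "('a, 'r) ring_scheme \<Rightarrow> 'a set \<Rightarrow> ('a, 'n) module \<Rightarrow> (nat \<Rightarrow> nat) \<Rightarrow>
   (nat \<Rightarrow> (nat \<Rightarrow> 'a) \<Rightarrow> (nat \<Rightarrow> 'a)) \<Rightarrow> ((nat \<Rightarrow> 'a) \<Rightarrow> 'n) \<Rightarrow> bool" where
  "minimal_free_resolution R \<mm> N b d \<epsilon> \<longleftrightarrow>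
     free_resolution R N b d \<epsilon> \<and>
     (\<forall>i. d i ` carrier (free_power R (b (Suc i))) \<subseteq> ideal_smult R \<mm> (free_power R (b i)))"

definition betti :: "('a, 'r) ring_scheme \<Rightarrow> 'a set \<Rightarrow> ('a, 'n) module \<Rightarrow> nat \<Rightarrow> nat" where
  "betti R \<mm> N = (SOME b. \<exists>d \<epsilon>. minimal_free_resolution R \<mm> N b d \<epsilon>)"

text \<open>The case distinction implements $\log_2 0 = -\infty$.\<close>

definition tor_bound :: "('a, 'r) ring_scheme \<Rightarrow> 'a set \<Rightarrow> ('a, 'n) module \<Rightarrow> real" where
  "tor_bound R \<mm> N =
     (if betti R \<mm> N 1 = 0 then 4 else max 4 (log 2 (real (betti R \<mm> N 1)) + 2))"


section \<open>Tensor products\<close>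

text \<open>
  $M \otimes_R N$ is the quotient of the free abelian group on \<open>carrier M \<times> carrier N\<close>
  by the subgroup generated by the bilinearity and balancing relations; the class of
  \<open>frag_of (x, y)\<close> is $x \otimes y$.
\<close>

abbreviation tensor_pre ::
  "('a, 'm) module \<Rightarrow> ('a, 'n) module \<Rightarrow> ('m \<times> 'n \<Rightarrow>\<^sub>0 int) monoid" where
  "tensor_pre M N \<equiv> free_Abelian_group (carrier M \<times> carrier N)"

definition tensor_rels ::
  "('a, 'r) ring_scheme \<Rightarrow> ('a, 'm) module \<Rightarrow> ('a, 'n) module \<Rightarrow> ('m \<times> 'n \<Rightarrow>\<^sub>0 int) set" where
  "tensor_rels R M N =
     {frag_of (x \<oplus>\<^bsub>M\<^esub> x', y) - frag_of (x, y) - frag_of (x', y) | x x' y.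
        x \<in> carrier M \<and> x' \<in> carrier M \<and> y \<in> carrier N} \<union>
     {frag_of (x, y \<oplus>\<^bsub>N\<^esub> y') - frag_of (x, y) - frag_of (x, y') | x y y'.
        x \<in> carrier M \<and> y \<in> carrier N \<and> y' \<in> carrier N} \<union>
     {frag_of (r \<odot>\<^bsub>M\<^esub> x, y) - frag_of (x, r \<odot>\<^bsub>N\<^esub> y) | r x y.
        r \<in> carrier R \<and> x \<in> carrier M \<and> y \<in> carrier N}"

definition tensor_null ::
  "('a, 'r) ring_scheme \<Rightarrow> ('a, 'm) module \<Rightarrow> ('a, 'n) module \<Rightarrow> ('m \<times> 'n \<Rightarrow>\<^sub>0 int) set" where
  "tensor_null R M N = generate (tensor_pre M N) (tensor_rels R M N)"

definition tensor_module ::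
  "('a, 'r) ring_scheme \<Rightarrow> ('a, 'm) module \<Rightarrow> ('a, 'n) module \<Rightarrow>
   ('a, ('m \<times> 'n \<Rightarrow>\<^sub>0 int) set) module" where
  "tensor_module R M N =
     \<lparr>carrier = rcosets\<^bsub>tensor_pre M N\<^esub> (tensor_null R M N),
      monoid.mult = undefined, one = undefined,
      ring.zero = tensor_null R M N,
      add = (<#>\<^bsub>tensor_pre M N\<^esub>),
      smult = (\<lambda>r A. \<Union>u\<in>A. tensor_null R M N #>\<^bsub>tensor_pre M N\<^esub>
                 frag_extend (\<lambda>(x, y). frag_of (r \<odot>\<^bsub>M\<^esub> x, y)) u)\<rparr>"

text \<open>The map $\mathrm{id}_M \otimes g$ from $M \otimes N$ to $M \otimes N'$ for \<open>g\<close> from $N$ to $N'$.\<close>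

definition tensor_map ::
  "('a, 'r) ring_scheme \<Rightarrow> ('a, 'm) module \<Rightarrow> ('a, 'n2) module \<Rightarrow> ('n1 \<Rightarrow> 'n2) \<Rightarrow>
   ('m \<times> 'n1 \<Rightarrow>\<^sub>0 int) set \<Rightarrow> ('m \<times> 'n2 \<Rightarrow>\<^sub>0 int) set" where
  "tensor_map R M N' g A =
     (\<Union>u\<in>A. tensor_null R M N' #>\<^bsub>tensor_pre M N'\<^esub>
        frag_extend (\<lambda>(x, y). frag_of (x, g y)) u)"


section \<open>Tor\<close>

text \<open>
  $\mathrm{Tor}_i^R(M, N) = H_i(M \otimes_R F)$ for a free resolution $F \to N$, i.e. the left
  derived functors of $M \otimes_R -$ evaluated at $N$. The resolution is an arbitrary one.
\<close>

definition chosen_resolution ::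
  "('a, 'r) ring_scheme \<Rightarrow> ('a, 'n) module \<Rightarrow>
   (nat \<Rightarrow> nat) \<times> (nat \<Rightarrow> (nat \<Rightarrow> 'a) \<Rightarrow> (nat \<Rightarrow> 'a))" where
  "chosen_resolution R N = (SOME (b, d). \<exists>\<epsilon>. free_resolution R N b d \<epsilon>)"

definition tor_complex ::
  "('a, 'r) ring_scheme \<Rightarrow> ('a, 'm) module \<Rightarrow> ('a, 'n) module \<Rightarrow> nat \<Rightarrow>
   ('a, ('m \<times> (nat \<Rightarrow> 'a) \<Rightarrow>\<^sub>0 int) set) module" where
  "tor_complex R M N i = tensor_module R M (free_power R (fst (chosen_resolution R N) i))"

definition tor_diff ::
  "('a, 'r) ring_scheme \<Rightarrow> ('a, 'm) module \<Rightarrow> ('a, 'n) module \<Rightarrow> nat \<Rightarrow>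
   ('m \<times> (nat \<Rightarrow> 'a) \<Rightarrow>\<^sub>0 int) set \<Rightarrow> ('m \<times> (nat \<Rightarrow> 'a) \<Rightarrow>\<^sub>0 int) set" where
  "tor_diff R M N i =
     tensor_map R M (free_power R (fst (chosen_resolution R N) i)) (snd (chosen_resolution R N) i)"

definition tor_cycles ::
  "('a, 'r) ring_scheme \<Rightarrow> ('a, 'm) module \<Rightarrow> ('a, 'n) module \<Rightarrow> nat \<Rightarrow>
   ('m \<times> (nat \<Rightarrow> 'a) \<Rightarrow>\<^sub>0 int) set set" where
  "tor_cycles R M N i =
     (case i of 0 \<Rightarrow> carrier (tor_complex R M N 0)
      | Suc j \<Rightarrow> module_kernel (tor_complex R M N (Suc j)) (tor_complex R M N j) (tor_diff R M N j))"

definition tor_boundaries ::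
  "('a, 'r) ring_scheme \<Rightarrow> ('a, 'm) module \<Rightarrow> ('a, 'n) module \<Rightarrow> nat \<Rightarrow>
   ('m \<times> (nat \<Rightarrow> 'a) \<Rightarrow>\<^sub>0 int) set set" where
  "tor_boundaries R M N i = tor_diff R M N i ` carrier (tor_complex R M N (Suc i))"

definition Tor ::
  "('a, 'r) ring_scheme \<Rightarrow> nat \<Rightarrow> ('a, 'm) module \<Rightarrow> ('a, 'n) module \<Rightarrow>
   ('a, ('m \<times> (nat \<Rightarrow> 'a) \<Rightarrow>\<^sub>0 int) set set) module" where
  "Tor R i M N =
     quotient_module ((tor_complex R M N i)\<lparr>carrier := tor_cycles R M N i\<rparr>) (tor_boundaries R M N i)"

end

(*
  Over a local ring with residue field k, let F be the minimal free resolution of N, with ranks b_i, and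
  let V be a module with m^2 V = 0. The differentials of F have entries in m, so as soon as Tor_i(V,N)
  vanishes, cycles and boundaries of V \<otimes> F in degree i both coincide with m V \<otimes> F_i. Counting lengths
  in two consecutive degrees gives b_{i+1} = \<alpha> b_i with \<alpha> = length(m V) / \<nu>(V), and the vanishing also
  gives N_{i+1} \<inter> m^2 F_i = m N_{i+1} for the syzygies N_{i+1} of N, whence \<nu>(m N_i) = e b_i - b_{i+1}
  with e = \<nu>(m). On the other hand m N_i lies in m^2 F_{i-1}, and the hypothesis on R bounds the number
  of generators of any submodule of m^2 F_{i-1} by (e - 2) b_{i-1}; thus \<alpha> (e - \<alpha>) \<le> e - 2. If \<alpha> is a
  positive integer this forces \<alpha> = e, so m N_i = 0, k is a direct summand of N_i, and V is free.

  In (1), V = M, and \<alpha> is an integer because the d-th power of its denominator divides b_1 when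
  b_1, ..., b_{d+1} are in proportion \<alpha>. In (2), V is the first syzygy of M; since m^3 = 0 one finds
  m N_i = m^2 F_{i-1}, so \<alpha> is a root of x^2 - e x + length(m^2) and hence an integer; the free
  module V, being contained in m G for a free module G, is annihilated by m^h, h the Loewy length, and
  therefore zero.

  The Tor of the statement is computed from an arbitrary free resolution, so its vanishing is first
  transported to F by a comparison of resolutions.
*)

theory Submission
  imports Defs
begin

section \<open>Submodules and homomorphisms\<close>

text \<open>The number e - 2 comes from Nakayama alone. For an ideal I inside \<mm>^2 the ideals I +
  \<mm>^k drop strictly in length until some \<mm>^(2+j) lies in I, so the length of I is at most
  length(\<mm>^2) - j, while \<mm> I contains \<mm>^(3+j) and has length at least h - 2 - j. The
  difference is at most length(\<mm>^2) - h + 2, and the hypothesis on R makes this at most e - 2.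
  Against it stands \<alpha> (e - \<alpha>) \<ge> e - 1 for every integer \<alpha> with 1 \<le>
  \<alpha> \<le> e - 1; a fractional \<alpha> could slip through, which is why integrality has to be
  secured in both cases. The logarithm in c(N) serves that end: a denominator of at least 2 would
  force 2^d \<le> b_1. Lengths are taken of intervals between submodules, and V \<otimes> R^n is
  replaced by V^n, so that neither quotient modules nor cosets occur once the vanishing of Tor has
  been turned into \<open>exact_at\<close>.\<close>

text \<open>The distribution's locale \<^locale>\<open>module\<close> is over the extensible record type, which the
  constants of the statement do not accept.\<close>

locale plain_module = module R M
  for R :: "('a, 'r) ring_scheme" (structure) and M :: "('a, 'm) module" (structure)

text \<open>Closure under negation comes from scaling by \<open>\<ominus> \<one>\<close>, and zero
  is x minus x; every later submodule check goes through this shorter list.\<close>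

lemma (in plain_module) submodule_iff:
  "submodule H R M \<longleftrightarrow> H \<subseteq> carrier M \<and> \<zero>\<^bsub>M\<^esub> \<in> H \<and> (\<forall>x\<in>H. \<forall>y\<in>H. x \<oplus>\<^bsub>M\<^esub> y \<in> H) \<and>
     (\<forall>a\<in>carrier R. \<forall>x\<in>H. a \<odot>\<^bsub>M\<^esub> x \<in> H)" (is "_ \<longleftrightarrow> ?r")
proof
  assume s: "submodule H R M"
  note E = submoduleE[OF s]
  obtain x where "x \<in> H" using E(2) by blast
  then have "\<zero>\<^bsub>M\<^esub> \<in> H" using E(4)[of \<zero> x] E(1) by (auto simp: subset_iff)
  then show ?r using E by blast
next
  assume r: ?r
  show "submodule H R M"
  proof (rule submoduleI)
    fix a assume a: "a \<in> H"
    then have "(\<ominus> \<one>) \<odot>\<^bsub>M\<^esub> a \<in> H" using r by blast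
    moreover have "a \<in> carrier M" using a r by blast
    ultimately show "\<ominus>\<^bsub>M\<^esub> a \<in> H" by (simp add: smult_l_minus)
  qed (use r in blast)+
qed

lemma (in plain_module) submodule_minus:
  "submodule H R M \<Longrightarrow> x \<in> H \<Longrightarrow> y \<in> H \<Longrightarrow> x \<ominus>\<^bsub>M\<^esub> y \<in> H"
  by (simp add: a_minus_def submoduleE)

lemma (in plain_module) add_minus_cancel [simp]:
  "x \<in> carrier M \<Longrightarrow> y \<in> carrier M \<Longrightarrow> x \<oplus>\<^bsub>M\<^esub> y \<ominus>\<^bsub>M\<^esub> x = y"
  by (simp add: M.minus_eq M.a_comm[of x y] M.a_assoc M.r_neg)

lemma (in plain_module) minus_add_cancel [simp]:
  "x \<in> carrier M \<Longrightarrow> y \<in> carrier M \<Longrightarrow> (x \<ominus>\<^bsub>M\<^esub> y) \<oplus>\<^bsub>M\<^esub> y = x"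
  by (simp add: M.minus_eq M.a_assoc M.l_neg)

lemma (in plain_module) submodule_zero: "submodule {\<zero>\<^bsub>M\<^esub>} R M"
  by (simp add: submodule_iff)

lemma (in plain_module) submodule_Int:
  "submodule H R M \<Longrightarrow> submodule K R M \<Longrightarrow> submodule (H \<inter> K) R M"
  by (auto simp: submodule_iff)

lemma (in plain_module) set_add_mem: "x \<in> A <+>\<^bsub>M\<^esub> B \<longleftrightarrow> (\<exists>a\<in>A. \<exists>b\<in>B. x = a \<oplus>\<^bsub>M\<^esub> b)"
  by (auto simp: set_add_def')

lemma (in plain_module) submodule_sum:
  assumes H: "submodule H R M" and K: "submodule K R M"
  shows "submodule (H <+>\<^bsub>M\<^esub> K) R M"
  unfolding submodule_iff
proof (intro conjI ballI)
  note h = H[unfolded submodule_iff] note k = K[unfolded submodule_iff]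
  show "H <+>\<^bsub>M\<^esub> K \<subseteq> carrier M" using h k by (auto simp: set_add_mem subset_iff)
  show "\<zero>\<^bsub>M\<^esub> \<in> H <+>\<^bsub>M\<^esub> K" unfolding set_add_mem using h k by (metis M.l_zero M.zero_closed)
next
  note h = H[unfolded submodule_iff] note k = K[unfolded submodule_iff]
  fix x y assume "x \<in> H <+>\<^bsub>M\<^esub> K" "y \<in> H <+>\<^bsub>M\<^esub> K"
  then obtain a b c d where e: "a \<in> H" "b \<in> K" "c \<in> H" "d \<in> K" "x = a \<oplus>\<^bsub>M\<^esub> b" "y = c \<oplus>\<^bsub>M\<^esub> d"
    unfolding set_add_mem by blast
  then have c: "a \<in> carrier M" "b \<in> carrier M" "c \<in> carrier M" "d \<in> carrier M" using h k by auto
  have "x \<oplus>\<^bsub>M\<^esub> y = (a \<oplus>\<^bsub>M\<^esub> c) \<oplus>\<^bsub>M\<^esub> (b \<oplus>\<^bsub>M\<^esub> d)"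
    using c e by (simp add: M.a_ac)
  then show "x \<oplus>\<^bsub>M\<^esub> y \<in> H <+>\<^bsub>M\<^esub> K" unfolding set_add_mem using e h k by blast
next
  note h = H[unfolded submodule_iff] note k = K[unfolded submodule_iff]
  fix r x assume r: "r \<in> carrier R" and "x \<in> H <+>\<^bsub>M\<^esub> K"
  then obtain a b where e: "a \<in> H" "b \<in> K" "x = a \<oplus>\<^bsub>M\<^esub> b"
    unfolding set_add_mem by blast
  then have c: "a \<in> carrier M" "b \<in> carrier M" using h k by auto
  then have "r \<odot>\<^bsub>M\<^esub> x = r \<odot>\<^bsub>M\<^esub> a \<oplus>\<^bsub>M\<^esub> r \<odot>\<^bsub>M\<^esub> b" using e r by (simp add: smult_r_distr)
  then show "r \<odot>\<^bsub>M\<^esub> x \<in> H <+>\<^bsub>M\<^esub> K" unfolding set_add_mem using e h k r by blast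
qed

lemma (in plain_module) subset_sum:
  assumes H: "submodule H R M" and K: "submodule K R M"
  shows "H \<subseteq> H <+>\<^bsub>M\<^esub> K" "K \<subseteq> H <+>\<^bsub>M\<^esub> K"
proof -
  note h = H[unfolded submodule_iff] note k = K[unfolded submodule_iff]
  show "H \<subseteq> H <+>\<^bsub>M\<^esub> K"
  proof
    fix x assume x: "x \<in> H"
    then have "x = x \<oplus>\<^bsub>M\<^esub> \<zero>\<^bsub>M\<^esub>" using h by auto
    then show "x \<in> H <+>\<^bsub>M\<^esub> K" unfolding set_add_mem using x k by blast
  qed
  show "K \<subseteq> H <+>\<^bsub>M\<^esub> K"
  proof
    fix x assume x: "x \<in> K"
    then have "x = \<zero>\<^bsub>M\<^esub> \<oplus>\<^bsub>M\<^esub> x" using k by auto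
    then show "x \<in> H <+>\<^bsub>M\<^esub> K" unfolding set_add_mem using x h by blast
  qed
qed

lemma (in plain_module) sum_least:
  "submodule L R M \<Longrightarrow> H \<subseteq> L \<Longrightarrow> K \<subseteq> L \<Longrightarrow> H <+>\<^bsub>M\<^esub> K \<subseteq> L"
  by (auto simp: set_add_mem submodule_iff subset_iff)

lemma (in plain_module) sum_mono: "H \<subseteq> H' \<Longrightarrow> K \<subseteq> K' \<Longrightarrow> H <+>\<^bsub>M\<^esub> K \<subseteq> H' <+>\<^bsub>M\<^esub> K'"
  by (auto simp: set_add_mem; blast)

lemma (in plain_module) span_submodule:
  assumes "S \<subseteq> carrier M" shows "submodule (span_module R M S) R M"
proof -
  have "carrier M \<in> {H. submodule H R M \<and> S \<subseteq> H}" using assms carrier_is_submodule by blast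
  then show ?thesis unfolding submodule_iff span_module_def by (auto simp: submodule_iff)
qed

lemma span_subset: "S \<subseteq> span_module R M S"
  by (auto simp: span_module_def)

lemma span_least: "submodule H R M \<Longrightarrow> S \<subseteq> H \<Longrightarrow> span_module R M S \<subseteq> H"
  by (auto simp: span_module_def)

locale module_homomorphism = M: plain_module R M + N: plain_module R N
  for R :: "('a, 'r) ring_scheme" (structure) and M :: "('a, 'm) module" and N :: "('a, 'n) module" +
  fixes h assumes hom: "h \<in> module_hom R M N"
begin

lemma closed [simp]: "x \<in> carrier M \<Longrightarrow> h x \<in> carrier N"
  using hom by (auto simp: module_hom_def)

lemma add [simp]: "x \<in> carrier M \<Longrightarrow> y \<in> carrier M \<Longrightarrow> h (x \<oplus>\<^bsub>M\<^esub> y) = h x \<oplus>\<^bsub>N\<^esub> h y"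
  using hom by (auto simp: module_hom_def)

lemma smult [simp]: "a \<in> carrier R \<Longrightarrow> x \<in> carrier M \<Longrightarrow> h (a \<odot>\<^bsub>M\<^esub> x) = a \<odot>\<^bsub>N\<^esub> h x"
  using hom by (auto simp: module_hom_def)

lemma zero [simp]: "h \<zero>\<^bsub>M\<^esub> = \<zero>\<^bsub>N\<^esub>"
proof -
  have "h \<zero>\<^bsub>M\<^esub> = h (\<zero> \<odot>\<^bsub>M\<^esub> \<zero>\<^bsub>M\<^esub>)" by (metis M.M.zero_closed M.R.zero_closed M.smult_l_null)
  then show ?thesis by (metis M.M.zero_closed M.R.zero_closed N.smult_l_null closed smult)
qed

lemma uminus [simp]: "x \<in> carrier M \<Longrightarrow> h (\<ominus>\<^bsub>M\<^esub> x) = \<ominus>\<^bsub>N\<^esub> h x"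
proof -
  assume x: "x \<in> carrier M"
  have "h (\<ominus>\<^bsub>M\<^esub> x) = h ((\<ominus> \<one>) \<odot>\<^bsub>M\<^esub> x)" using x by (simp add: M.smult_l_minus del: smult)
  also have "\<dots> = \<ominus>\<^bsub>N\<^esub> h x" using x by (simp add: N.smult_l_minus)
  finally show ?thesis .
qed

lemma minus [simp]: "x \<in> carrier M \<Longrightarrow> y \<in> carrier M \<Longrightarrow> h (x \<ominus>\<^bsub>M\<^esub> y) = h x \<ominus>\<^bsub>N\<^esub> h y"
  by (simp add: a_minus_def)

lemma image_submodule:
  assumes "submodule A R M" shows "submodule (h ` A) R N"
proof -
  note a = assms[unfolded M.submodule_iff]
  have z: "\<zero>\<^bsub>N\<^esub> \<in> h ` A" using a zero by (metis imageI)
  have p: "h x \<oplus>\<^bsub>N\<^esub> h y \<in> h ` A" if "x \<in> A" "y \<in> A" for x y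
    using that a add[of x y] by (metis imageI subsetD)
  have s: "r \<odot>\<^bsub>N\<^esub> h x \<in> h ` A" if "x \<in> A" "r \<in> carrier R" for x r
    using that a smult[of r x] by (metis imageI subsetD)
  show ?thesis unfolding N.submodule_iff using z p s a by auto
qed

lemma vimage_submodule:
  assumes "submodule B R N" shows "submodule {x \<in> carrier M. h x \<in> B} R M"
  using assms unfolding M.submodule_iff N.submodule_iff by auto

lemma kernel_submodule: "submodule (module_kernel M N h) R M"
  using vimage_submodule[OF N.submodule_zero] by (simp add: module_kernel_def)

end

lemma module_homI:
  "module R M \<Longrightarrow> module R N \<Longrightarrow> h \<in> module_hom R M N \<Longrightarrow> module_homomorphism R M N h"
  by (simp add: module_homomorphism_def module_homomorphism_axioms_def plain_module_def)

lemma module_hom_comp: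
  "f \<in> module_hom R M N \<Longrightarrow> g \<in> module_hom R N P \<Longrightarrow> (\<lambda>x. g (f x)) \<in> module_hom R M P"
  by (auto simp: module_hom_def Pi_iff)

section \<open>Products of ideals and submodules\<close>

text \<open>Over \<open>ring_module R\<close> this is also the product of ideals, so powers of \<mm>
  and the radicals of modules fall under the same lemmas.\<close>

definition smult_span :: "('a, 'r) ring_scheme \<Rightarrow> ('a, 'm) module \<Rightarrow> 'a set \<Rightarrow> 'm set \<Rightarrow> 'm set" where
  "smult_span R V I A = span_module R V {a \<odot>\<^bsub>V\<^esub> x | a x. a \<in> I \<and> x \<in> A}"

lemma ideal_smult_eq: "ideal_smult R I V = smult_span R V I (carrier V)"
  by (simp add: ideal_smult_def smult_span_def)

lemma (in plain_module) smult_span_submodule: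
  "I \<subseteq> carrier R \<Longrightarrow> A \<subseteq> carrier M \<Longrightarrow> submodule (smult_span R M I A) R M"
  unfolding smult_span_def by (rule span_submodule) auto

lemma smult_spanI: "a \<in> I \<Longrightarrow> x \<in> A \<Longrightarrow> a \<odot>\<^bsub>V\<^esub> x \<in> smult_span R V I A"
  unfolding smult_span_def by (rule subsetD[OF span_subset]) auto

lemma smult_span_least:
  "submodule H R V \<Longrightarrow> (\<And>a x. a \<in> I \<Longrightarrow> x \<in> A \<Longrightarrow> a \<odot>\<^bsub>V\<^esub> x \<in> H) \<Longrightarrow> smult_span R V I A \<subseteq> H"
  unfolding smult_span_def by (rule span_least) auto

lemma (in plain_module) smult_span_subset:
  "I \<subseteq> carrier R \<Longrightarrow> submodule A R M \<Longrightarrow> smult_span R M I A \<subseteq> A"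
  by (rule smult_span_least) (auto simp: submodule_iff)

lemma (in plain_module) smult_span_mono:
  "I \<subseteq> carrier R \<Longrightarrow> B \<subseteq> carrier M \<Longrightarrow> A \<subseteq> B \<Longrightarrow> smult_span R M I A \<subseteq> smult_span R M I B"
  by (rule smult_span_least[OF smult_span_submodule]) (auto intro: smult_spanI)

text \<open>Each inclusion needs only that preimages and images of submodules are submodules. It is
  what identifies the radical of a syzygy with the image of \<mm> F.\<close>

lemma (in module_homomorphism) image_smult_span:
  assumes I: "I \<subseteq> carrier R" and A: "A \<subseteq> carrier M"
  shows "h ` smult_span R M I A = smult_span R N I (h ` A)"
proof
  have hA: "h ` A \<subseteq> carrier N" using A by auto
  have "smult_span R M I A \<subseteq> {x \<in> carrier M. h x \<in> smult_span R N I (h ` A)}"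
  proof (rule smult_span_least)
    show "submodule {x \<in> carrier M. h x \<in> smult_span R N I (h ` A)} R M"
      by (rule vimage_submodule[OF N.smult_span_submodule[OF I hA]])
    fix a x assume "a \<in> I" "x \<in> A"
    moreover have "a \<in> carrier R" "x \<in> carrier M" using \<open>a \<in> I\<close> \<open>x \<in> A\<close> I A by auto
    ultimately show "a \<odot>\<^bsub>M\<^esub> x \<in> {x \<in> carrier M. h x \<in> smult_span R N I (h ` A)}"
      by (simp add: smult_spanI)
  qed
  then show "h ` smult_span R M I A \<subseteq> smult_span R N I (h ` A)" by auto
  show "smult_span R N I (h ` A) \<subseteq> h ` smult_span R M I A"
  proof (rule smult_span_least)
    show "submodule (h ` smult_span R M I A) R N"
      by (rule image_submodule[OF M.smult_span_submodule[OF I A]])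
    fix a x assume "a \<in> I" "x \<in> h ` A"
    then obtain y where y: "y \<in> A" "x = h y" by auto
    then have "a \<odot>\<^bsub>N\<^esub> x = h (a \<odot>\<^bsub>M\<^esub> y)" using I A \<open>a \<in> I\<close> by (simp add: subset_iff)
    then show "a \<odot>\<^bsub>N\<^esub> x \<in> h ` smult_span R M I A" using y \<open>a \<in> I\<close> smult_spanI by (metis imageI)
  qed
qed

section \<open>Length of intervals of submodules\<close>

definition is_chain :: "('a, 'r) ring_scheme \<Rightarrow> ('a, 'm) module \<Rightarrow> 'm set \<Rightarrow> 'm set \<Rightarrow> nat \<Rightarrow> (nat \<Rightarrow> 'm set) \<Rightarrow> bool" where
  "is_chain R V B A n C \<longleftrightarrow> (\<forall>i\<le>n. submodule (C i) R V \<and> B \<subseteq> C i \<and> C i \<subseteq> A) \<and>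
     (\<forall>i<n. C i \<subset> C (Suc i))"

definition chain_in :: "('a, 'r) ring_scheme \<Rightarrow> ('a, 'm) module \<Rightarrow> 'm set \<Rightarrow> 'm set \<Rightarrow> nat \<Rightarrow> bool" where
  "chain_in R V B A n \<longleftrightarrow> (\<exists>C. is_chain R V B A n C)"

lemma is_chainD:
  assumes "is_chain R V B A n C"
  shows "i \<le> n \<Longrightarrow> submodule (C i) R V \<and> B \<subseteq> C i \<and> C i \<subseteq> A" and "i < n \<Longrightarrow> C i \<subset> C (Suc i)"
  using assms by (auto simp: is_chain_def)

lemma chain_inI:
  assumes "\<And>i. i \<le> n \<Longrightarrow> submodule (C i) R V \<and> B \<subseteq> C i \<and> C i \<subseteq> A"
    and "\<And>i. i < n \<Longrightarrow> C i \<subset> C (Suc i)"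
  shows "chain_in R V B A n"
  unfolding chain_in_def is_chain_def using assms by (intro exI[of _ C]) auto

definition finite_ilen :: "('a, 'r) ring_scheme \<Rightarrow> ('a, 'm) module \<Rightarrow> 'm set \<Rightarrow> 'm set \<Rightarrow> bool" where
  "finite_ilen R V B A \<longleftrightarrow> (\<exists>N. \<forall>n. chain_in R V B A n \<longrightarrow> n \<le> N)"

text \<open>The length of A/B, read off from chains between B and A so that no quotient is formed.
  The \<open>GREATEST\<close> is meaningful only under \<open>finite_ilen\<close>.\<close>

definition ilen :: "('a, 'r) ring_scheme \<Rightarrow> ('a, 'm) module \<Rightarrow> 'm set \<Rightarrow> 'm set \<Rightarrow> nat" where
  "ilen R V B A = (GREATEST n. chain_in R V B A n)"

lemma chain_in_0: "submodule A R V \<Longrightarrow> B \<subseteq> A \<Longrightarrow> chain_in R V B A 0"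
  by (rule chain_inI[of _ "\<lambda>_. A"]) auto

lemma ilen_ge: "finite_ilen R V B A \<Longrightarrow> chain_in R V B A n \<Longrightarrow> n \<le> ilen R V B A"
  unfolding ilen_def finite_ilen_def by (metis Greatest_le_nat)

lemma ilen_chain:
  "finite_ilen R V B A \<Longrightarrow> submodule A R V \<Longrightarrow> B \<subseteq> A \<Longrightarrow> chain_in R V B A (ilen R V B A)"
  unfolding ilen_def finite_ilen_def by (metis GreatestI_nat chain_in_0)

lemma ilen_leI:
  "finite_ilen R V B A \<Longrightarrow> submodule A R V \<Longrightarrow> B \<subseteq> A \<Longrightarrow> (\<And>n. chain_in R V B A n \<Longrightarrow> n \<le> N) \<Longrightarrow>
   ilen R V B A \<le> N"
  by (simp add: ilen_chain)

text \<open>Dropping repetitions from a weakly increasing chain leaves a strict one with as many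
  steps as there were strict inclusions.\<close>

lemma weak_chain:
  assumes "\<And>i. i \<le> n \<Longrightarrow> submodule (E i) R V \<and> B \<subseteq> E i \<and> E i \<subseteq> A"
    and "\<And>i. i < n \<Longrightarrow> E i \<subseteq> E (Suc i)"
  shows "chain_in R V B A (card {i. i < n \<and> E i \<noteq> E (Suc i)})"
proof -
  \<comment> \<open>The end point \<open>C p = E n\<close> is carried along so that the next member
    can be appended to the thinned chain.\<close>
  have "\<exists>C. is_chain R V B A p C \<and> C p = E n"
    if p: "p = card {i. i < n \<and> E i \<noteq> E (Suc i)}" for p
    using p assms
  proof (induction n arbitrary: p)
    case 0
    then show ?case by (intro exI[of _ "\<lambda>_. E 0"]) (auto simp: is_chain_def)
  next
    case (Suc n)
    let ?q = "card {i. i < n \<and> E i \<noteq> E (Suc i)}"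
    have "\<exists>C. is_chain R V B A ?q C \<and> C ?q = E n"
      by (rule Suc.IH[OF refl]) (use Suc.prems(2,3) in \<open>auto simp: le_Suc_eq\<close>)
    then obtain C where C0: "is_chain R V B A ?q C" and C3: "C ?q = E n" by blast
    note C = is_chainD[OF C0] C3
    show ?case
    proof (cases "E n = E (Suc n)")
      case True
      then have "{i. i < Suc n \<and> E i \<noteq> E (Suc i)} = {i. i < n \<and> E i \<noteq> E (Suc i)}"
        by (auto simp: less_Suc_eq)
      then have "p = ?q" using Suc.prems(1) by simp
      then show ?thesis using C0 C3 True by (intro exI[of _ C]) auto
    next
      case False
      then have "{i. i < Suc n \<and> E i \<noteq> E (Suc i)} = insert n {i. i < n \<and> E i \<noteq> E (Suc i)}"
        by (auto simp: less_Suc_eq)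
      then have p: "p = Suc ?q" using Suc.prems(1) by simp
      have sub: "E n \<subset> E (Suc n)" using False Suc.prems(3)[of n] by auto
      show ?thesis
        unfolding p
        by (rule exI[of _ "\<lambda>i. if i = Suc ?q then E (Suc n) else C i"])
           (use C sub Suc.prems(2)[of "Suc n", OF order_refl] in \<open>auto simp: is_chain_def le_Suc_eq less_Suc_eq split: if_splits\<close>)
    qed
  qed
  from this[OF refl] show ?thesis unfolding chain_in_def by blast
qed

text \<open>The first member of the upper chain takes the place of the last member of the lower one;
  strictness survives since \<open>C p \<subseteq> D \<subseteq> C' 0\<close>.\<close>

lemma chain_in_append:
  assumes "chain_in R V B D p" "chain_in R V D A q" "B \<subseteq> D" "D \<subseteq> A"
  shows "chain_in R V B A (p + q)"
proof -
  obtain C where C0: "is_chain R V B D p C" using assms(1) unfolding chain_in_def by blast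
  obtain C' where C0': "is_chain R V D A q C'" using assms(2) unfolding chain_in_def by blast
  note C = is_chainD[OF C0] and C' = is_chainD[OF C0']
  have "(if i < p then C i else C' (i - p)) \<subset> (if Suc i < p then C (Suc i) else C' (Suc i - p))"
    if "i < p + q" for i
  proof -
    consider "Suc i < p" | "Suc i = p" | "i \<ge> p" by linarith
    then show ?thesis
    proof cases
      case 2
      then have "C i \<subset> C p" "C p \<subseteq> D" "D \<subseteq> C' 0" using C(1)[of p] C(2)[of i] C'(1)[of 0] by auto
      then show ?thesis using 2 by auto
    qed (use C C' that in \<open>auto simp: Suc_diff_le\<close>)
  qed
  moreover have "submodule (if i < p then C i else C' (i - p)) R V \<and> B \<subseteq> (if i < p then C i else C' (i - p)) \<and>
      (if i < p then C i else C' (i - p)) \<subseteq> A" if "i \<le> p + q" for i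
  proof (cases "i < p")
    case True
    then show ?thesis using C(1)[of i] assms(4) by auto
  next
    case False
    moreover have "i - p \<le> q" using that by simp
    ultimately show ?thesis using C'(1)[of "i - p"] assms(3) by auto
  qed
  ultimately show ?thesis by (rule chain_inI[where C = "\<lambda>i. if i < p then C i else C' (i - p)", rotated])
qed

text \<open>The chain is both intersected with D and enlarged by D. By the modular law a step that
  becomes an equality in both derived chains was an equality before, so each strict step is counted
  at least once.\<close>

lemma (in plain_module) chain_in_split:
  assumes n: "chain_in R M B A n" and D: "submodule D R M" "B \<subseteq> D" "D \<subseteq> A" and A: "submodule A R M"
  obtains p q where "chain_in R M B D p" "chain_in R M D A q" "n \<le> p + q"
proof -
  from n obtain C where C0: "is_chain R M B A n C" unfolding chain_in_def by blast
  note C = is_chainD[OF C0]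
  let ?P = "\<lambda>i. C i \<inter> D" and ?Q = "\<lambda>i. C i <+>\<^bsub>M\<^esub> D"
  let ?p = "{i. i < n \<and> ?P i \<noteq> ?P (Suc i)}" and ?q = "{i. i < n \<and> ?Q i \<noteq> ?Q (Suc i)}"
  have "chain_in R M B D (card ?p)"
  proof (rule weak_chain)
    fix i assume "i \<le> n"
    then show "submodule (?P i) R M \<and> B \<subseteq> ?P i \<and> ?P i \<subseteq> D"
      using C(1)[of i] D by (auto intro: submodule_Int)
  next
    fix i assume "i < n"
    then show "?P i \<subseteq> ?P (Suc i)" using C(2)[of i] by auto
  qed
  moreover have "chain_in R M D A (card ?q)"
  proof (rule weak_chain)
    fix i assume "i \<le> n"
    then show "submodule (?Q i) R M \<and> D \<subseteq> ?Q i \<and> ?Q i \<subseteq> A"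
      using C(1)[of i] D by (meson A submodule_sum subset_sum(2) sum_least)
  next
    fix i assume "i < n"
    then show "?Q i \<subseteq> ?Q (Suc i)" using C(2)[of i] by (intro sum_mono) auto
  qed
  moreover have "n \<le> card ?p + card ?q"
  proof -
    have "i \<in> ?p \<union> ?q" if i: "i < n" for i
    proof (rule ccontr)
      assume "i \<notin> ?p \<union> ?q"
      then have e: "?P i = ?P (Suc i)" "?Q i = ?Q (Suc i)" using i by auto
      have s: "submodule (C i) R M" "submodule (C (Suc i)) R M" "C i \<subset> C (Suc i)"
        using C(1)[of i] C(1)[of "Suc i"] C(2) i by auto
      have "C (Suc i) \<subseteq> C i"
      proof
        fix x assume x: "x \<in> C (Suc i)"
        then have "x \<in> ?Q i" using e(2) subset_sum(1)[OF s(2) D(1)] by auto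
        then obtain c d where cd: "c \<in> C i" "d \<in> D" "x = c \<oplus>\<^bsub>M\<^esub> d" unfolding set_add_mem by blast
        then have car: "c \<in> carrier M" "d \<in> carrier M" using submoduleE(1)[OF s(1)] submoduleE(1)[OF D(1)] by auto
        have "x \<ominus>\<^bsub>M\<^esub> c \<in> C (Suc i)" using x cd s submodule_minus by auto
        moreover have "x \<ominus>\<^bsub>M\<^esub> c = d" using cd car by simp
        ultimately have "d \<in> C i" using cd e(1) by auto
        then show "x \<in> C i" using cd s(1) by (simp add: submodule_iff)
      qed
      then show False using s by auto
    qed
    then have "{..<n} \<subseteq> ?p \<union> ?q" by auto
    then have "card {..<n} \<le> card (?p \<union> ?q)" by (intro card_mono) auto
    also have "\<dots> \<le> card ?p + card ?q" by (rule card_Un_le)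
    finally show ?thesis by simp
  qed
  ultimately show thesis by (rule that)
qed

lemma (in plain_module) finite_ilen_trans:
  assumes "finite_ilen R M B D" "finite_ilen R M D A" "submodule D R M" "B \<subseteq> D" "D \<subseteq> A" "submodule A R M"
  shows "finite_ilen R M B A"
  unfolding finite_ilen_def
proof (intro exI allI impI)
  fix n assume "chain_in R M B A n"
  from chain_in_split[OF this assms(3-6)] obtain p q where
    pq: "chain_in R M B D p" "chain_in R M D A q" "n \<le> p + q" .
  show "n \<le> ilen R M B D + ilen R M D A"
    using ilen_ge[OF assms(1) pq(1)] ilen_ge[OF assms(2) pq(2)] pq(3) by linarith
qed

lemma chain_in_mono: "chain_in R V B A n \<Longrightarrow> B' \<subseteq> B \<Longrightarrow> A \<subseteq> A' \<Longrightarrow> chain_in R V B' A' n"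
  unfolding chain_in_def is_chain_def by (meson order_trans)

lemma finite_ilen_sub: "finite_ilen R V B' A' \<Longrightarrow> B' \<subseteq> B \<Longrightarrow> A \<subseteq> A' \<Longrightarrow> finite_ilen R V B A"
  unfolding finite_ilen_def by (meson chain_in_mono)

lemma (in plain_module) ilen_add:
  assumes fin: "finite_ilen R M B A" and D: "submodule D R M" "B \<subseteq> D" "D \<subseteq> A" and A: "submodule A R M"
  shows "ilen R M B A = ilen R M B D + ilen R M D A"
proof (rule antisym)
  have f: "finite_ilen R M B D" "finite_ilen R M D A" using finite_ilen_sub[OF fin] D by auto
  have "chain_in R M B A (ilen R M B A)" by (rule ilen_chain[OF fin A]) (use D in auto)
  from chain_in_split[OF this D A] obtain p q where
    pq: "chain_in R M B D p" "chain_in R M D A q" "ilen R M B A \<le> p + q" .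
  show "ilen R M B A \<le> ilen R M B D + ilen R M D A"
    using ilen_ge[OF f(1) pq(1)] ilen_ge[OF f(2) pq(2)] pq(3) by linarith
  show "ilen R M B D + ilen R M D A \<le> ilen R M B A"
    by (rule ilen_ge[OF fin chain_in_append[OF ilen_chain[OF f(1)] ilen_chain[OF f(2)]]]) (use D A in auto)
qed

lemma (in plain_module) ilen_pos:
  assumes fin: "finite_ilen R M B A" and "submodule B R M" "submodule A R M" "B \<subset> A"
  shows "ilen R M B A > 0"
proof -
  have "chain_in R M B A 1"
    by (rule chain_inI[of _ "\<lambda>i. if i = 0 then B else A"]) (use assms in auto)
  then show ?thesis using ilen_ge[OF fin] by fastforce
qed

lemma ilen_self:
  assumes "submodule A R V" shows "ilen R V A A = 0"
proof -
  have n0: "n = 0" if "chain_in R V A A n" for n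
  proof (rule ccontr)
    assume n: "n \<noteq> 0"
    from that obtain C where C0: "is_chain R V A A n C" unfolding chain_in_def by blast
    note C = is_chainD[OF C0]
    have "C 0 \<subset> C 1" "C 0 = A" "C 1 = A" using C(1)[of 0] C(1)[of 1] C(2)[of 0] n by auto
    then show False by auto
  qed
  then have "finite_ilen R V A A" by (auto simp: finite_ilen_def)
  then have "chain_in R V A A (ilen R V A A)" using assms by (intro ilen_chain) auto
  then show ?thesis by (rule n0)
qed

context module_homomorphism
begin

text \<open>This stands in for the isomorphism of A/B with h(A)/h(B): chains travel forward by
  images and back by preimages cut down to A. Images stay distinct because two elements of A with
  equal image differ by an element of B.\<close>

lemma chain_in_image_iff:
  assumes B: "submodule B R M" and A: "submodule A R M" and BA: "B \<subseteq> A"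
    and ker: "A \<inter> module_kernel M N h \<subseteq> B"
  shows "chain_in R N (h ` B) (h ` A) n \<longleftrightarrow> chain_in R M B A n"
proof
  assume "chain_in R M B A n"
  then obtain C where C0: "is_chain R M B A n C" unfolding chain_in_def by blast
  note C = is_chainD[OF C0]
  have "h ` C i \<subset> h ` C (Suc i)" if i: "i < n" for i
  proof -
    have s: "submodule (C i) R M" "submodule (C (Suc i)) R M" "C i \<subset> C (Suc i)" "B \<subseteq> C i" "C (Suc i) \<subseteq> A"
      using C(1)[of i] C(1)[of "Suc i"] C(2) i by auto
    have "x \<in> C i" if x: "x \<in> C (Suc i)" "h x \<in> h ` C i" for x
    proof -
      obtain c where c: "c \<in> C i" "h x = h c" using x by auto
      have car: "x \<in> carrier M" "c \<in> carrier M" using x c s M.submoduleE(1) by blast+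
      have "x \<ominus>\<^bsub>M\<^esub> c \<in> C (Suc i)" using x c s M.submodule_minus by auto
      moreover have "h (x \<ominus>\<^bsub>M\<^esub> c) = \<zero>\<^bsub>N\<^esub>" using car c by (simp add: N.M.minus_eq N.M.r_neg)
      ultimately have "x \<ominus>\<^bsub>M\<^esub> c \<in> B" using ker s car by (auto simp: module_kernel_def)
      then have "(x \<ominus>\<^bsub>M\<^esub> c) \<oplus>\<^bsub>M\<^esub> c \<in> C i" using s c by (auto simp: M.submodule_iff)
      then show ?thesis using car by simp
    qed
    then show ?thesis using s(3) by blast
  qed
  moreover have "submodule (h ` C i) R N \<and> h ` B \<subseteq> h ` C i \<and> h ` C i \<subseteq> h ` A" if "i \<le> n" for i
    using C(1)[OF that] image_submodule image_mono by blast
  ultimately show "chain_in R N (h ` B) (h ` A) n" by (rule chain_inI[rotated])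
next
  assume "chain_in R N (h ` B) (h ` A) n"
  then obtain C where C0: "is_chain R N (h ` B) (h ` A) n C" unfolding chain_in_def by blast
  note C = is_chainD[OF C0]
  let ?D = "\<lambda>i. A \<inter> {x \<in> carrier M. h x \<in> C i}"
  have "?D i \<subset> ?D (Suc i)" if i: "i < n" for i
  proof -
    have s: "C i \<subset> C (Suc i)" "C (Suc i) \<subseteq> h ` A" using C(1)[of "Suc i"] C(2) i by auto
    then obtain x where "x \<in> A" "h x \<in> C (Suc i)" "h x \<notin> C i" by blast
    moreover have "x \<in> carrier M" using \<open>x \<in> A\<close> A M.submoduleE(1) by blast
    ultimately show ?thesis using s by blast
  qed
  moreover have "submodule (?D i) R M \<and> B \<subseteq> ?D i \<and> ?D i \<subseteq> A" if "i \<le> n" for i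
    using C(1)[OF that] A B BA M.submodule_Int vimage_submodule[of "C i"] M.submoduleE(1)[OF B] by auto
  ultimately show "chain_in R M B A n" by (rule chain_inI[rotated])
qed

lemma ilen_image:
  assumes "submodule B R M" "submodule A R M" "B \<subseteq> A" "A \<inter> module_kernel M N h \<subseteq> B"
  shows "ilen R N (h ` B) (h ` A) = ilen R M B A"
    and "finite_ilen R N (h ` B) (h ` A) \<longleftrightarrow> finite_ilen R M B A"
  using chain_in_image_iff[OF assms] by (simp_all add: ilen_def finite_ilen_def)

end

abbreviation len :: "('a, 'r) ring_scheme \<Rightarrow> ('a, 'm) module \<Rightarrow> 'm set \<Rightarrow> nat" where
  "len R V A \<equiv> ilen R V {\<zero>\<^bsub>V\<^esub>} A"

locale finite_length_module = plain_module +
  assumes finite_len: "finite_ilen R M {\<zero>\<^bsub>M\<^esub>} (carrier M)"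
begin

lemma fin: "submodule A R M \<Longrightarrow> submodule B R M \<Longrightarrow> finite_ilen R M B A"
  by (rule finite_ilen_sub[OF finite_len]) (auto simp: submodule_iff)

lemma len_add:
  assumes A: "submodule A R M" and B: "submodule B R M" and BA: "B \<subseteq> A"
  shows "len R M A = len R M B + ilen R M B A"
  by (rule ilen_add[OF fin[OF A submodule_zero] B _ BA A]) (use B in \<open>simp add: submodule_iff\<close>)

lemma len_mono: "submodule A R M \<Longrightarrow> submodule B R M \<Longrightarrow> B \<subseteq> A \<Longrightarrow> len R M B \<le> len R M A"
  using len_add[of A B] by linarith

text \<open>Equalities of submodules are regularly obtained by counting: one inclusion is shown
  directly, the other is a comparison of lengths.\<close>

lemma len_eqD:
  assumes A: "submodule A R M" and B: "submodule B R M" and BA: "B \<subseteq> A" and le: "len R M A \<le> len R M B"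
  shows "A = B"
proof (rule ccontr)
  assume "A \<noteq> B"
  then have "ilen R M B A > 0" using ilen_pos[OF fin[OF A B] B A] BA by blast
  then show False using len_add[OF A B BA] le by linarith
qed

lemma len_zero [simp]: "len R M {\<zero>\<^bsub>M\<^esub>} = 0"
  by (rule ilen_self[OF submodule_zero])

lemma len_eq_0D: "submodule A R M \<Longrightarrow> len R M A = 0 \<Longrightarrow> A = {\<zero>\<^bsub>M\<^esub>}"
  by (rule len_eqD[OF _ submodule_zero]) (simp_all add: submodule_iff)

end

context module_homomorphism
begin

lemma finite_len_iff:
  assumes A: "submodule A R M"
  shows "finite_ilen R M {\<zero>\<^bsub>M\<^esub>} A \<longleftrightarrow> finite_ilen R M {\<zero>\<^bsub>M\<^esub>} (A \<inter> module_kernel M N h) \<and>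
    finite_ilen R N {\<zero>\<^bsub>N\<^esub>} (h ` A)"
proof -
  let ?K = "A \<inter> module_kernel M N h"
  have K: "submodule ?K R M" using A kernel_submodule M.submodule_Int by blast
  have hK: "h ` ?K = {\<zero>\<^bsub>N\<^esub>}" using K by (force simp: module_kernel_def M.submodule_iff)
  have z: "{\<zero>\<^bsub>M\<^esub>} \<subseteq> ?K" using K by (simp add: M.submodule_iff)
  have "finite_ilen R N {\<zero>\<^bsub>N\<^esub>} (h ` A) \<longleftrightarrow> finite_ilen R M ?K A"
    using ilen_image(2)[OF K A] hK by simp
  moreover have "finite_ilen R M {\<zero>\<^bsub>M\<^esub>} ?K" "finite_ilen R M ?K A" if "finite_ilen R M {\<zero>\<^bsub>M\<^esub>} A"
    using finite_ilen_sub[OF that] z by auto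
  ultimately show ?thesis using M.finite_ilen_trans[OF _ _ K z _ A] by blast
qed

text \<open>Rank and nullity for lengths: h sends the interval from A \<inter> ker h to A onto the
  interval from zero to h(A). All the counting of generators and Betti numbers rests on it.\<close>

lemma len_image:
  assumes A: "submodule A R M" and fin: "finite_ilen R M {\<zero>\<^bsub>M\<^esub>} A"
  shows "len R M A = len R M (A \<inter> module_kernel M N h) + len R N (h ` A)"
proof -
  let ?K = "A \<inter> module_kernel M N h"
  have K: "submodule ?K R M" using A kernel_submodule M.submodule_Int by blast
  have hK: "h ` ?K = {\<zero>\<^bsub>N\<^esub>}" using K by (force simp: module_kernel_def M.submodule_iff)
  have z: "{\<zero>\<^bsub>M\<^esub>} \<subseteq> ?K" using K by (simp add: M.submodule_iff)
  have "len R M A = len R M ?K + ilen R M ?K A" by (rule M.ilen_add[OF fin K z _ A]) simp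
  then show ?thesis using ilen_image(1)[OF K A] hK by simp
qed

end

section \<open>Powers of a module and maps induced by homomorphisms of free modules\<close>

text \<open>The encoding copies that of \<open>free_power\<close>, so that
  \<open>free_power R n\<close> is literally the n-th power of \<open>ring_module R\<close> and
  inherits every lemma about powers.\<close>

definition power_module :: "('a, 'm) module \<Rightarrow> nat \<Rightarrow> ('a, nat \<Rightarrow> 'm) module" where
  "power_module V n =
     \<lparr>carrier = {..<n} \<rightarrow>\<^sub>E carrier V, monoid.mult = undefined, one = undefined,
      ring.zero = (\<lambda>i\<in>{..<n}. \<zero>\<^bsub>V\<^esub>),
      add = (\<lambda>f g. \<lambda>i\<in>{..<n}. f i \<oplus>\<^bsub>V\<^esub> g i),
      smult = (\<lambda>r f. \<lambda>i\<in>{..<n}. r \<odot>\<^bsub>V\<^esub> f i)\<rparr>"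

abbreviation ring_module :: "('a, 'r) ring_scheme \<Rightarrow> ('a, 'a) module" where
  "ring_module R \<equiv> ideal_module R (carrier R)"

lemma free_power_eq: "free_power R n = power_module (ring_module R) n"
  by (simp add: free_power_def power_module_def ideal_module_def)

lemma ring_module_simps [simp]:
  "carrier (ring_module R) = carrier R" "\<zero>\<^bsub>ring_module R\<^esub> = \<zero>\<^bsub>R\<^esub>"
  "add (ring_module R) = add R" "smult (ring_module R) = monoid.mult R"
  by (simp_all add: ideal_module_def)

lemma power_module_simps [simp]:
  "carrier (power_module V n) = {..<n} \<rightarrow>\<^sub>E carrier V"
  "\<zero>\<^bsub>power_module V n\<^esub> = (\<lambda>i\<in>{..<n}. \<zero>\<^bsub>V\<^esub>)"
  "f \<oplus>\<^bsub>power_module V n\<^esub> g = (\<lambda>i\<in>{..<n}. f i \<oplus>\<^bsub>V\<^esub> g i)"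
  "r \<odot>\<^bsub>power_module V n\<^esub> f = (\<lambda>i\<in>{..<n}. r \<odot>\<^bsub>V\<^esub> f i)"
  by (simp_all add: power_module_def)

lemma power_ext:
  assumes "f \<in> {..<n} \<rightarrow>\<^sub>E A" "g \<in> {..<n} \<rightarrow>\<^sub>E B" "\<And>i. i < n \<Longrightarrow> f i = g i"
  shows "f = g"
  by (rule PiE_ext[where k = "{..<n}" and s = "\<lambda>_. A \<union> B"]) (use assms in \<open>auto simp: PiE_iff\<close>)

lemma (in cring) ring_module_module: "module R (ring_module R)"
proof (rule moduleI)
  show "abelian_group (ring_module R)"
  proof (rule abelian_groupI)
    fix x assume "x \<in> carrier (ring_module R)"
    then show "\<exists>y\<in>carrier (ring_module R). y \<oplus>\<^bsub>ring_module R\<^esub> x = \<zero>\<^bsub>ring_module R\<^esub>"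
      by (auto intro: bexI[of _ "\<ominus> x"] l_neg)
  qed (auto simp: a_ac)
qed (auto simp: cring_axioms l_distr r_distr m_assoc)

context plain_module
begin

lemma power_module_module: "module R (power_module M n)"
proof (rule moduleI)
  show "cring R" by (rule R.cring_axioms)
  show "abelian_group (power_module M n)"
  proof (rule abelian_groupI)
    fix x assume x: "x \<in> carrier (power_module M n)"
    show "\<exists>y\<in>carrier (power_module M n). y \<oplus>\<^bsub>power_module M n\<^esub> x = \<zero>\<^bsub>power_module M n\<^esub>"
      by (rule bexI[of _ "\<lambda>i\<in>{..<n}. \<ominus>\<^bsub>M\<^esub> x i"]) (use x in \<open>auto simp: fun_eq_iff M.l_neg PiE_iff\<close>)
  next
    fix x y z
    assume "x \<in> carrier (power_module M n)" "y \<in> carrier (power_module M n)" "z \<in> carrier (power_module M n)"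
    then show "(x \<oplus>\<^bsub>power_module M n\<^esub> y) \<oplus>\<^bsub>power_module M n\<^esub> z = x \<oplus>\<^bsub>power_module M n\<^esub> (y \<oplus>\<^bsub>power_module M n\<^esub> z)"
      by (auto simp: fun_eq_iff M.a_assoc PiE_iff)
  next
    fix x y
    assume "x \<in> carrier (power_module M n)" "y \<in> carrier (power_module M n)"
    then show "x \<oplus>\<^bsub>power_module M n\<^esub> y = y \<oplus>\<^bsub>power_module M n\<^esub> x"
      by (auto simp: fun_eq_iff PiE_iff intro: M.a_comm)
  qed (auto simp: PiE_iff fun_eq_iff extensional_def)
qed (auto simp: PiE_iff fun_eq_iff extensional_def smult_l_distr smult_r_distr smult_assoc1)

lemma power_plain_module: "plain_module R (power_module M n)"
  by (simp add: plain_module_def power_module_module)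

lemma power_submodule:
  assumes A: "submodule A R M" shows "submodule ({..<n} \<rightarrow>\<^sub>E A) R (power_module M n)"
  using A unfolding plain_module.submodule_iff[OF power_plain_module] submodule_iff
  by (auto simp: PiE_iff subset_iff)

definition emb :: "nat \<Rightarrow> nat \<Rightarrow> 'm \<Rightarrow> nat \<Rightarrow> 'm" where
  "emb n j x = (\<lambda>i\<in>{..<n}. if i = j then x else \<zero>\<^bsub>M\<^esub>)"

lemma emb_closed [simp]: "x \<in> carrier M \<Longrightarrow> emb n j x \<in> {..<n} \<rightarrow>\<^sub>E carrier M"
  by (auto simp: emb_def)

lemma emb_mem: "submodule A R M \<Longrightarrow> x \<in> A \<Longrightarrow> emb n j x \<in> {..<n} \<rightarrow>\<^sub>E A"
  by (auto simp: emb_def submodule_iff)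

lemma emb_apply: "i < n \<Longrightarrow> emb n j x i = (if i = j then x else \<zero>\<^bsub>M\<^esub>)"
  by (simp add: emb_def)

lemma emb_hom: "emb n j \<in> module_hom R M (power_module M n)"
  by (auto simp: module_hom_def emb_def fun_eq_iff)

lemma proj_hom: "i < n \<Longrightarrow> (\<lambda>v. v i) \<in> module_hom R (power_module M n) M"
  by (auto simp: module_hom_def PiE_iff)

lemma power_induct [consumes 2, case_names zero emb add]:
  assumes v: "v \<in> {..<n} \<rightarrow>\<^sub>E A" and A: "submodule A R M"
    and zero: "P \<zero>\<^bsub>power_module M n\<^esub>"
    and emb: "\<And>j x. j < n \<Longrightarrow> x \<in> A \<Longrightarrow> P (emb n j x)"
    and add: "\<And>v w. v \<in> {..<n} \<rightarrow>\<^sub>E A \<Longrightarrow> w \<in> {..<n} \<rightarrow>\<^sub>E A \<Longrightarrow> P v \<Longrightarrow> P w \<Longrightarrow>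
      P (v \<oplus>\<^bsub>power_module M n\<^esub> w)"
  shows "P v"
proof -
  \<comment> \<open>Truncations of v: coordinates are filled in one at a time, the rest being
    zero.\<close>
  let ?v = "\<lambda>k. \<lambda>i\<in>{..<n}. if i < k then v i else \<zero>\<^bsub>M\<^esub>"
  have Ac: "A \<subseteq> carrier M" and A0: "\<zero>\<^bsub>M\<^esub> \<in> A" using A by (simp_all add: submodule_iff)
  have c: "?v k \<in> {..<n} \<rightarrow>\<^sub>E A" for k using v A0 by (auto simp: PiE_iff)
  have "P (?v k)" if "k \<le> n" for k
    using that
  proof (induction k)
    case 0
    have e: "?v 0 = \<zero>\<^bsub>power_module M n\<^esub>" by (simp add: fun_eq_iff)
    show ?case unfolding e by (rule zero)
  next
    case (Suc k)
    have vk: "v k \<in> A" using v Suc.prems by (auto simp: PiE_iff)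
    have car: "i < n \<Longrightarrow> v i \<in> carrier M" for i using v Ac by (auto simp: PiE_iff)
    have e: "?v (Suc k) = ?v k \<oplus>\<^bsub>power_module M n\<^esub> emb n k (v k)"
      using Suc.prems car by (auto simp: fun_eq_iff emb_def less_Suc_eq)
    have m: "emb n k (v k) \<in> {..<n} \<rightarrow>\<^sub>E A" by (rule emb_mem[OF A vk])
    have Pk: "P (?v k)" by (rule Suc.IH) (use Suc.prems in simp)
    have Pe: "P (emb n k (v k))" by (rule emb[OF _ vk]) (use Suc.prems in simp)
    show ?case unfolding e by (rule add[OF c m Pk Pe])
  qed
  moreover have "?v n = v" by (rule power_ext[OF c v]) simp
  ultimately show ?thesis by (metis order_refl)
qed

text \<open>From right to left, a vector with coordinates in I A is a finite sum of embedded
  elements of I A, and each embedding, being a homomorphism, carries I A into I times the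
  power.\<close>

lemma power_smult_span:
  assumes I: "I \<subseteq> carrier R" and A: "submodule A R M"
  shows "smult_span R (power_module M n) I ({..<n} \<rightarrow>\<^sub>E A) = {..<n} \<rightarrow>\<^sub>E smult_span R M I A"
proof
  interpret P: plain_module R "power_module M n" by (rule power_plain_module)
  have Ac: "A \<subseteq> carrier M" and A0: "\<zero>\<^bsub>M\<^esub> \<in> A" using A by (simp_all add: submodule_iff)
  have Pc: "({..<n} \<rightarrow>\<^sub>E A) \<subseteq> carrier (power_module M n)" using Ac by (auto simp: PiE_iff)
  have sA: "submodule (smult_span R M I A) R M" by (rule smult_span_submodule[OF I Ac])
  show "smult_span R (power_module M n) I ({..<n} \<rightarrow>\<^sub>E A) \<subseteq> {..<n} \<rightarrow>\<^sub>E smult_span R M I A"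
    by (rule smult_span_least[OF power_submodule[OF sA]]) (auto simp: PiE_iff smult_spanI)
  let ?S = "smult_span R (power_module M n) I ({..<n} \<rightarrow>\<^sub>E A)"
  have S: "submodule ?S R (power_module M n)" by (rule P.smult_span_submodule[OF I Pc])
  show "{..<n} \<rightarrow>\<^sub>E smult_span R M I A \<subseteq> ?S"
  proof
    fix v assume "v \<in> {..<n} \<rightarrow>\<^sub>E smult_span R M I A"
    then show "v \<in> ?S" using sA
    proof (induction rule: power_induct)
      case zero
      then show ?case using S[unfolded P.submodule_iff] by blast
    next
      case (emb j x)
      interpret h: module_homomorphism R M "power_module M n" "emb n j"
        by (intro module_homI module_axioms power_module_module emb_hom)
      have "emb n j x \<in> smult_span R (power_module M n) I (emb n j ` A)"
        using h.image_smult_span[OF I Ac] emb by blast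
      moreover have "emb n j ` A \<subseteq> {..<n} \<rightarrow>\<^sub>E A" using emb_mem[OF A] by blast
      ultimately show ?case using P.smult_span_mono[OF I Pc] by blast
    next
      case (add v w)
      then show ?case using S[unfolded P.submodule_iff] by blast
    qed
  qed
qed

primrec lsum :: "(nat \<Rightarrow> 'm) \<Rightarrow> nat \<Rightarrow> 'm" where
  "lsum f 0 = \<zero>\<^bsub>M\<^esub>"
| "lsum f (Suc n) = lsum f n \<oplus>\<^bsub>M\<^esub> f n"

lemma lsum_closed [simp]: "(\<And>j. j < n \<Longrightarrow> f j \<in> carrier M) \<Longrightarrow> lsum f n \<in> carrier M"
  by (induction n) auto

lemma lsum_cong: "(\<And>j. j < n \<Longrightarrow> f j = g j) \<Longrightarrow> lsum f n = lsum g n"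
  by (induction n) auto

lemma lsum_zero: "(\<And>j. j < n \<Longrightarrow> f j = \<zero>\<^bsub>M\<^esub>) \<Longrightarrow> lsum f n = \<zero>\<^bsub>M\<^esub>"
  by (induction n) auto

lemma lsum_add:
  "(\<And>j. j < n \<Longrightarrow> f j \<in> carrier M) \<Longrightarrow> (\<And>j. j < n \<Longrightarrow> g j \<in> carrier M) \<Longrightarrow>
   lsum (\<lambda>j. f j \<oplus>\<^bsub>M\<^esub> g j) n = lsum f n \<oplus>\<^bsub>M\<^esub> lsum g n"
  by (induction n) (auto simp: M.a_ac)

lemma lsum_smult:
  "a \<in> carrier R \<Longrightarrow> (\<And>j. j < n \<Longrightarrow> f j \<in> carrier M) \<Longrightarrow>
   lsum (\<lambda>j. a \<odot>\<^bsub>M\<^esub> f j) n = a \<odot>\<^bsub>M\<^esub> lsum f n"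
  by (induction n) (auto simp: smult_r_distr)

lemma lsum_single:
  assumes "k < n" "f k \<in> carrier M" "\<And>j. j < n \<Longrightarrow> j \<noteq> k \<Longrightarrow> f j = \<zero>\<^bsub>M\<^esub>"
  shows "lsum f n = f k"
  using assms
proof (induction n)
  case (Suc n)
  show ?case
  proof (cases "k = n")
    case True
    then have "lsum f n = \<zero>\<^bsub>M\<^esub>" using Suc.prems by (intro lsum_zero) auto
    then show ?thesis using True Suc.prems by simp
  next
    case False
    then show ?thesis using Suc by auto
  qed
qed simp

lemma lsum_mem: "submodule A R M \<Longrightarrow> (\<And>j. j < n \<Longrightarrow> f j \<in> A) \<Longrightarrow> lsum f n \<in> A"
  by (induction n) (auto simp: submodule_iff)

end

lemma (in module_homomorphism) lsum_image:
  "(\<And>j. j < n \<Longrightarrow> f j \<in> carrier M) \<Longrightarrow> h (M.lsum f n) = N.lsum (\<lambda>j. h (f j)) n"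
  by (induction n) auto

text \<open>The tensor \<open>x \<otimes> y\<close> under the identification $M \otimes R^n \cong M^n$.\<close>

definition pure :: "('a, 'm) module \<Rightarrow> nat \<Rightarrow> 'm \<Rightarrow> (nat \<Rightarrow> 'a) \<Rightarrow> nat \<Rightarrow> 'm" where
  "pure V n x y = (\<lambda>i\<in>{..<n}. y i \<odot>\<^bsub>V\<^esub> x)"

definition unit_vec :: "('a, 'r) ring_scheme \<Rightarrow> nat \<Rightarrow> nat \<Rightarrow> nat \<Rightarrow> 'a" where
  "unit_vec R n j = (\<lambda>i\<in>{..<n}. if i = j then \<one>\<^bsub>R\<^esub> else \<zero>\<^bsub>R\<^esub>)"

text \<open>This is id \<otimes> \<phi> on V^n: the coordinate
  \<open>\<phi> (unit_vec R n j) i\<close> is the (i, j) entry of the matrix of \<phi>.\<close>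

definition induced_map ::
  "('a, 'r) ring_scheme \<Rightarrow> ('a, 'm) module \<Rightarrow> nat \<Rightarrow> nat \<Rightarrow> ((nat \<Rightarrow> 'a) \<Rightarrow> (nat \<Rightarrow> 'a)) \<Rightarrow>
   (nat \<Rightarrow> 'm) \<Rightarrow> (nat \<Rightarrow> 'm)" where
  "induced_map R V n m \<phi> v = (\<lambda>i\<in>{..<m}. plain_module.lsum V (\<lambda>j. \<phi> (unit_vec R n j) i \<odot>\<^bsub>V\<^esub> v j) n)"

text \<open>As a function of y, the homomorphism from R^n that takes the unit vectors to the
  prescribed elements \<open>xs\<close>.\<close>

definition comb :: "('a, 'm) module \<Rightarrow> nat \<Rightarrow> (nat \<Rightarrow> 'm) \<Rightarrow> (nat \<Rightarrow> 'a) \<Rightarrow> 'm" where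
  "comb V n xs y = plain_module.lsum V (\<lambda>j. y j \<odot>\<^bsub>V\<^esub> xs j) n"

context plain_module
begin

lemma ring_plain_module: "plain_module R (ring_module R)"
  by (simp add: plain_module_def R.ring_module_module)

lemma free_module_module: "module R (free_power R n)"
  unfolding free_power_eq by (rule plain_module.power_module_module[OF ring_plain_module])

lemma free_carrier: "carrier (free_power R n) = {..<n} \<rightarrow>\<^sub>E carrier R"
  by (simp add: free_power_eq)

lemma unit_vec_emb: "unit_vec R n j = plain_module.emb (ring_module R) n j \<one>"
  by (simp add: fun_eq_iff unit_vec_def plain_module.emb_def[OF ring_plain_module])

lemma unit_vec_closed [simp]: "unit_vec R n j \<in> {..<n} \<rightarrow>\<^sub>E carrier R"
  by (auto simp: unit_vec_def)

lemma free_induct [consumes 1, case_names zero emb add]: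
  assumes v: "v \<in> {..<n} \<rightarrow>\<^sub>E carrier R"
    and zero: "P (\<lambda>i\<in>{..<n}. \<zero>)"
    and emb: "\<And>j a. j < n \<Longrightarrow> a \<in> carrier R \<Longrightarrow> P (a \<odot>\<^bsub>free_power R n\<^esub> unit_vec R n j)"
    and add: "\<And>v w. v \<in> {..<n} \<rightarrow>\<^sub>E carrier R \<Longrightarrow> w \<in> {..<n} \<rightarrow>\<^sub>E carrier R \<Longrightarrow> P v \<Longrightarrow> P w \<Longrightarrow>
      P (v \<oplus>\<^bsub>free_power R n\<^esub> w)"
  shows "P v"
proof -
  interpret L: plain_module R "ring_module R" by (rule ring_plain_module)
  have e: "L.emb n j a = a \<odot>\<^bsub>free_power R n\<^esub> unit_vec R n j" if "a \<in> carrier R" for j a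
    using that by (auto simp: L.emb_def free_power_eq unit_vec_def fun_eq_iff)
  from v L.carrier_is_submodule[simplified] show ?thesis
  proof (induction rule: L.power_induct)
    case zero
    have "\<zero>\<^bsub>power_module (ring_module R) n\<^esub> = (\<lambda>i\<in>{..<n}. \<zero>)" by (simp add: fun_eq_iff)
    then show ?case using assms(2) by metis
  next
    case (emb j x) then show ?case using assms(3)[of j x] e by simp
  next
    case (add v w)
    then have "P (v \<oplus>\<^bsub>free_power R n\<^esub> w)" by (intro assms(4)) auto
    then show ?case unfolding free_power_eq .
  qed
qed

lemma pure_closed [simp]:
  "x \<in> carrier M \<Longrightarrow> y \<in> {..<n} \<rightarrow>\<^sub>E carrier R \<Longrightarrow> pure M n x y \<in> {..<n} \<rightarrow>\<^sub>E carrier M"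
  by (auto simp: pure_def)

lemma pure_unit_vec: "x \<in> carrier M \<Longrightarrow> pure M n x (unit_vec R n j) = emb n j x"
  by (auto simp: pure_def unit_vec_def emb_def fun_eq_iff)

lemma pure_hom: "x \<in> carrier M \<Longrightarrow> pure M n x \<in> module_hom R (free_power R n) (power_module M n)"
  by (auto simp: module_hom_def free_power_eq pure_def fun_eq_iff PiE_iff smult_l_distr smult_assoc1)

lemma comb_hom:
  assumes "\<And>j. j < n \<Longrightarrow> xs j \<in> carrier M"
  shows "comb M n xs \<in> module_hom R (free_power R n) M"
proof -
  have "comb M n xs y \<in> carrier M" if "y \<in> {..<n} \<rightarrow>\<^sub>E carrier R" for y
    unfolding comb_def using that assms by (intro lsum_closed) (auto simp: PiE_iff)
  moreover have "comb M n xs (\<lambda>i\<in>{..<n}. y i \<oplus> z i) = comb M n xs y \<oplus>\<^bsub>M\<^esub> comb M n xs z"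
    if "y \<in> {..<n} \<rightarrow>\<^sub>E carrier R" "z \<in> {..<n} \<rightarrow>\<^sub>E carrier R" for y z
    unfolding comb_def using that assms
    by (subst lsum_add[symmetric]) (auto simp: PiE_iff smult_l_distr intro!: lsum_cong)
  moreover have "comb M n xs (\<lambda>i\<in>{..<n}. a \<otimes> y i) = a \<odot>\<^bsub>M\<^esub> comb M n xs y"
    if "y \<in> {..<n} \<rightarrow>\<^sub>E carrier R" "a \<in> carrier R" for y a
    unfolding comb_def using that assms
    by (subst lsum_smult[symmetric]) (auto simp: PiE_iff smult_assoc1 intro!: lsum_cong)
  ultimately show ?thesis by (auto simp: module_hom_def free_power_eq)
qed

lemma comb_unit_vec:
  assumes "\<And>j. j < n \<Longrightarrow> xs j \<in> carrier M" "k < n"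
  shows "comb M n xs (unit_vec R n k) = xs k"
  unfolding comb_def using assms by (subst lsum_single[of k]) (auto simp: unit_vec_def)

lemma free_hom_eq:
  assumes f: "f \<in> module_hom R (free_power R n) M" and g: "g \<in> module_hom R (free_power R n) M"
    and eq: "\<And>j. j < n \<Longrightarrow> f (unit_vec R n j) = g (unit_vec R n j)"
    and y: "y \<in> {..<n} \<rightarrow>\<^sub>E carrier R"
  shows "f y = g y"
proof -
  interpret f: module_homomorphism R "free_power R n" M f
    by (intro module_homI module_axioms free_module_module f)
  interpret g: module_homomorphism R "free_power R n" M g
    by (intro module_homI module_axioms free_module_module g)
  have z: "(\<lambda>i\<in>{..<n}. \<zero>) = \<zero>\<^bsub>free_power R n\<^esub>" by (simp add: free_power_eq)
  from y show ?thesis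
    by (induction rule: free_induct) (simp_all add: z eq free_carrier)
qed

text \<open>Projectivity of free modules: preimages are chosen only for the unit vectors, and
  linearity determines the rest.\<close>

lemma free_lift:
  assumes f: "f \<in> module_hom R (free_power R n) M" and g: "g \<in> module_hom R (free_power R m) M"
    and im: "f ` carrier (free_power R n) \<subseteq> g ` carrier (free_power R m)"
  obtains h where "h \<in> module_hom R (free_power R n) (free_power R m)"
    "\<And>y. y \<in> carrier (free_power R n) \<Longrightarrow> g (h y) = f y"
proof -
  have "\<exists>z. z \<in> carrier (free_power R m) \<and> g z = f (unit_vec R n j)" for j
  proof -
    have "f (unit_vec R n j) \<in> g ` carrier (free_power R m)"
      by (rule subsetD[OF im]) (simp add: free_carrier)
    then show ?thesis by auto
  qed
  then have "\<exists>z. \<forall>j. z j \<in> carrier (free_power R m) \<and> g (z j) = f (unit_vec R n j)" by (intro choice) blast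
  then obtain z where z: "\<And>j. z j \<in> carrier (free_power R m)" "\<And>j. g (z j) = f (unit_vec R n j)" by blast
  interpret F: plain_module R "free_power R m" by (simp add: plain_module_def free_module_module)
  have h: "comb (free_power R m) n z \<in> module_hom R (free_power R n) (free_power R m)"
    by (rule F.comb_hom) (rule z)
  have "g (comb (free_power R m) n z y) = f y" if "y \<in> carrier (free_power R n)" for y
    by (rule free_hom_eq[OF module_hom_comp[OF h g] f]) (use that z in \<open>auto simp: free_carrier F.comb_unit_vec\<close>)
  with h show thesis by (rule that)
qed

lemma induced_map_hom:
  assumes \<phi>: "\<phi> \<in> module_hom R (free_power R n) (free_power R m)"
  shows "induced_map R M n m \<phi> \<in> module_hom R (power_module M n) (power_module M m)"
proof -
  have c: "\<phi> (unit_vec R n j) i \<in> carrier R" if "i < m" for i j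
    using \<phi> that unit_vec_closed[of n j] by (auto simp: module_hom_def free_carrier PiE_iff Pi_iff)
  have "induced_map R M n m \<phi> v \<in> {..<m} \<rightarrow>\<^sub>E carrier M" if "v \<in> {..<n} \<rightarrow>\<^sub>E carrier M" for v
    unfolding induced_map_def using that c by (auto intro!: lsum_closed simp: PiE_iff)
  moreover have "induced_map R M n m \<phi> (\<lambda>i\<in>{..<n}. v i \<oplus>\<^bsub>M\<^esub> w i) =
      (\<lambda>i\<in>{..<m}. induced_map R M n m \<phi> v i \<oplus>\<^bsub>M\<^esub> induced_map R M n m \<phi> w i)"
    if "v \<in> {..<n} \<rightarrow>\<^sub>E carrier M" "w \<in> {..<n} \<rightarrow>\<^sub>E carrier M" for v w
  proof (rule ext)
    fix i
    show "induced_map R M n m \<phi> (\<lambda>i\<in>{..<n}. v i \<oplus>\<^bsub>M\<^esub> w i) i =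
      (\<lambda>i\<in>{..<m}. induced_map R M n m \<phi> v i \<oplus>\<^bsub>M\<^esub> induced_map R M n m \<phi> w i) i"
    proof (cases "i < m")
      case True
      then show ?thesis unfolding induced_map_def using that c
        by (simp, subst lsum_add[symmetric]) (auto simp: PiE_iff smult_r_distr intro!: lsum_cong)
    qed (simp add: induced_map_def)
  qed
  moreover have "induced_map R M n m \<phi> (\<lambda>i\<in>{..<n}. a \<odot>\<^bsub>M\<^esub> v i) =
      (\<lambda>i\<in>{..<m}. a \<odot>\<^bsub>M\<^esub> induced_map R M n m \<phi> v i)"
    if "v \<in> {..<n} \<rightarrow>\<^sub>E carrier M" "a \<in> carrier R" for v a
  proof (rule ext)
    fix i
    show "induced_map R M n m \<phi> (\<lambda>i\<in>{..<n}. a \<odot>\<^bsub>M\<^esub> v i) i =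
      (\<lambda>i\<in>{..<m}. a \<odot>\<^bsub>M\<^esub> induced_map R M n m \<phi> v i) i"
    proof (cases "i < m")
      case True
      then show ?thesis unfolding induced_map_def using that c
        by (simp, subst lsum_smult[symmetric])
          (auto simp: PiE_iff smult_assoc1[symmetric] R.m_comm intro!: lsum_cong)
    qed (simp add: induced_map_def)
  qed
  ultimately show ?thesis by (auto simp: module_hom_def)
qed

lemma induced_map_emb:
  assumes \<phi>: "\<phi> \<in> module_hom R (free_power R n) (free_power R m)" and j: "j < n" and x: "x \<in> carrier M"
  shows "induced_map R M n m \<phi> (emb n j x) = pure M m x (\<phi> (unit_vec R n j))"
proof (rule ext)
  fix i
  show "induced_map R M n m \<phi> (emb n j x) i = pure M m x (\<phi> (unit_vec R n j)) i"
  proof (cases "i < m")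
    case True
    have c: "\<phi> (unit_vec R n k) i \<in> carrier R" for k
      using \<phi> True unit_vec_closed[of n k] by (auto simp: module_hom_def free_carrier PiE_iff Pi_iff)
    have "lsum (\<lambda>k. \<phi> (unit_vec R n k) i \<odot>\<^bsub>M\<^esub> emb n j x k) n = \<phi> (unit_vec R n j) i \<odot>\<^bsub>M\<^esub> emb n j x j"
      by (rule lsum_single) (use j x c in \<open>auto simp: emb_def\<close>)
    then show ?thesis using True j by (simp add: induced_map_def pure_def emb_def)
  qed (simp add: induced_map_def pure_def)
qed

text \<open>The rule (id \<otimes> \<phi>)(x \<otimes> y) = x \<otimes> \<phi>(y). Both sides are
  linear in y, so unit vectors suffice.\<close>

lemma induced_map_pure:
  assumes \<phi>: "\<phi> \<in> module_hom R (free_power R n) (free_power R m)" and x: "x \<in> carrier M"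
    and y: "y \<in> {..<n} \<rightarrow>\<^sub>E carrier R"
  shows "induced_map R M n m \<phi> (pure M n x y) = pure M m x (\<phi> y)"
proof -
  interpret P: plain_module R "power_module M m" by (rule power_plain_module)
  show ?thesis
    by (rule P.free_hom_eq[OF module_hom_comp[OF pure_hom[OF x] induced_map_hom[OF \<phi>]]
          module_hom_comp[OF \<phi> pure_hom[OF x]] _ y])
       (simp add: pure_unit_vec x induced_map_emb[OF \<phi>])
qed

lemma power_hom_eq:
  assumes N: "module R N"
    and f: "f \<in> module_hom R (power_module M n) N" and g: "g \<in> module_hom R (power_module M n) N"
    and eq: "\<And>j x. j < n \<Longrightarrow> x \<in> carrier M \<Longrightarrow> f (emb n j x) = g (emb n j x)"
    and v: "v \<in> {..<n} \<rightarrow>\<^sub>E carrier M"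
  shows "f v = g v"
proof -
  interpret f: module_homomorphism R "power_module M n" N f
    by (intro module_homI N power_module_module f)
  interpret g: module_homomorphism R "power_module M n" N g
    by (intro module_homI N power_module_module g)
  have a: "f (v \<oplus>\<^bsub>power_module M n\<^esub> w) = g (v \<oplus>\<^bsub>power_module M n\<^esub> w)"
    if "f v = g v" "f w = g w" "v \<in> {..<n} \<rightarrow>\<^sub>E carrier M" "w \<in> {..<n} \<rightarrow>\<^sub>E carrier M" for v w
    using f.add[of v w] g.add[of v w] that by simp
  from v carrier_is_submodule show ?thesis
  proof (induction rule: power_induct)
    case zero then show ?case using f.zero g.zero by metis
  next
    case (emb j x) then show ?case using eq by blast
  next
    case (add v w) then show ?case using a by blast
  qed
qed

lemma induced_map_comp:
  assumes \<phi>: "\<phi> \<in> module_hom R (free_power R n) (free_power R m)"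
    and \<psi>: "\<psi> \<in> module_hom R (free_power R m) (free_power R k)" and v: "v \<in> {..<n} \<rightarrow>\<^sub>E carrier M"
  shows "induced_map R M m k \<psi> (induced_map R M n m \<phi> v) = induced_map R M n k (\<lambda>y. \<psi> (\<phi> y)) v"
proof (rule power_hom_eq[OF power_module_module module_hom_comp[OF induced_map_hom[OF \<phi>] induced_map_hom[OF \<psi>]]
      induced_map_hom[OF module_hom_comp[OF \<phi> \<psi>]] _ v])
  fix j x assume "j < n" "x \<in> carrier M"
  moreover have "\<phi> (unit_vec R n j) \<in> {..<m} \<rightarrow>\<^sub>E carrier R"
    using \<phi> unit_vec_closed unfolding module_hom_def free_carrier by blast
  ultimately show "induced_map R M m k \<psi> (induced_map R M n m \<phi> (emb n j x)) =
      induced_map R M n k (\<lambda>y. \<psi> (\<phi> y)) (emb n j x)"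
    by (simp add: induced_map_emb[OF \<phi>] induced_map_emb[OF module_hom_comp[OF \<phi> \<psi>]] induced_map_pure[OF \<psi>])
qed

lemma induced_map_cong:
  "(\<And>y. y \<in> {..<n} \<rightarrow>\<^sub>E carrier R \<Longrightarrow> \<phi> y = \<psi> y) \<Longrightarrow> induced_map R M n m \<phi> v = induced_map R M n m \<psi> v"
  by (simp add: induced_map_def)

lemma induced_map_id: "v \<in> {..<n} \<rightarrow>\<^sub>E carrier M \<Longrightarrow> induced_map R M n n (\<lambda>y. y) v = v"
proof -
  assume v: "v \<in> {..<n} \<rightarrow>\<^sub>E carrier M"
  have i: "(\<lambda>y. y) \<in> module_hom R V V" for V :: "('a, 'x) module" by (simp add: module_hom_def)
  show ?thesis
    by (rule power_hom_eq[OF power_module_module induced_map_hom[OF i] i _ v])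
       (simp add: induced_map_emb[OF i] pure_unit_vec)
qed

lemma induced_map_zero:
  assumes v: "v \<in> {..<n} \<rightarrow>\<^sub>E carrier M"
    and z: "\<And>y. y \<in> {..<n} \<rightarrow>\<^sub>E carrier R \<Longrightarrow> \<phi> y = \<zero>\<^bsub>free_power R m\<^esub>"
  shows "induced_map R M n m \<phi> v = \<zero>\<^bsub>power_module M m\<^esub>"
  unfolding induced_map_def power_module_simps
proof (rule restrict_ext)
  fix i assume i: "i \<in> {..<m}"
  have "\<phi> (unit_vec R n j) i = \<zero>" for j using i z[OF unit_vec_closed[of n j]] by (simp add: free_power_eq)
  then show "lsum (\<lambda>j. \<phi> (unit_vec R n j) i \<odot>\<^bsub>M\<^esub> v j) n = \<zero>\<^bsub>M\<^esub>"
    using v by (intro lsum_zero) (auto simp: PiE_iff)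
qed

lemma free_hom_add:
  assumes \<phi>: "\<phi> \<in> module_hom R (free_power R n) M" and \<psi>: "\<psi> \<in> module_hom R (free_power R n) M"
  shows "(\<lambda>y. \<phi> y \<oplus>\<^bsub>M\<^esub> \<psi> y) \<in> module_hom R (free_power R n) M"
  using assms by (auto simp: module_hom_def Pi_iff smult_r_distr M.a_ac)

lemma free_hom_minus:
  assumes \<phi>: "\<phi> \<in> module_hom R (free_power R n) M" and \<psi>: "\<psi> \<in> module_hom R (free_power R n) M"
  shows "(\<lambda>y. \<phi> y \<ominus>\<^bsub>M\<^esub> \<psi> y) \<in> module_hom R (free_power R n) M"
  using assms by (auto simp: module_hom_def Pi_iff smult_r_distr smult_r_minus M.minus_eq M.minus_add M.a_ac)

lemma induced_map_add:
  assumes \<phi>: "\<phi> \<in> module_hom R (free_power R n) (free_power R m)"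
    and \<psi>: "\<psi> \<in> module_hom R (free_power R n) (free_power R m)" and v: "v \<in> {..<n} \<rightarrow>\<^sub>E carrier M"
  shows "induced_map R M n m (\<lambda>y. \<phi> y \<oplus>\<^bsub>free_power R m\<^esub> \<psi> y) v =
    induced_map R M n m \<phi> v \<oplus>\<^bsub>power_module M m\<^esub> induced_map R M n m \<psi> v"
proof (rule ext)
  fix i
  show "induced_map R M n m (\<lambda>y. \<phi> y \<oplus>\<^bsub>free_power R m\<^esub> \<psi> y) v i =
    (induced_map R M n m \<phi> v \<oplus>\<^bsub>power_module M m\<^esub> induced_map R M n m \<psi> v) i"
  proof (cases "i < m")
    case True
    have c: "\<phi> (unit_vec R n k) i \<in> carrier R" "\<psi> (unit_vec R n k) i \<in> carrier R" for k
      using \<phi> \<psi> True unit_vec_closed[of n k] by (auto simp: module_hom_def free_carrier PiE_iff Pi_iff)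
    then show ?thesis using True v
      by (simp add: induced_map_def free_power_eq, subst lsum_add[symmetric])
        (auto simp: PiE_iff smult_l_distr intro!: lsum_cong)
  qed (simp add: induced_map_def)
qed

text \<open>The identification of R \<otimes> R^n with R^n. It allows exactness with coefficients in
  a free module to be tested one coordinate at a time.\<close>

lemma induced_map_ring:
  assumes \<phi>: "\<phi> \<in> module_hom R (free_power R n) (free_power R m)" and y: "y \<in> {..<n} \<rightarrow>\<^sub>E carrier R"
  shows "induced_map R (ring_module R) n m \<phi> y = \<phi> y"
proof -
  interpret L: plain_module R "ring_module R" by (rule ring_plain_module)
  interpret F: plain_module R "free_power R m" by (simp add: plain_module_def free_module_module)
  have p: "pure (ring_module R) m \<one> z = z" if "z \<in> {..<m} \<rightarrow>\<^sub>E carrier R" for z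
    by (rule power_ext[OF _ that, where A = "carrier R"]) (use that in \<open>auto simp: pure_def PiE_iff\<close>)
  show ?thesis
  proof (rule F.free_hom_eq[OF _ \<phi> _ y])
    show "induced_map R (ring_module R) n m \<phi> \<in> module_hom R (free_power R n) (free_power R m)"
      using L.induced_map_hom[OF \<phi>] by (simp add: free_power_eq)
    fix j assume "j < n"
    moreover have "\<phi> (unit_vec R n j) \<in> {..<m} \<rightarrow>\<^sub>E carrier R"
      using \<phi> unit_vec_closed unfolding module_hom_def free_carrier by blast
    ultimately show "induced_map R (ring_module R) n m \<phi> (unit_vec R n j) = \<phi> (unit_vec R n j)"
      using L.induced_map_emb[OF \<phi>, of j \<one>] p unit_vec_emb by simp
  qed
qed

end

context module_homomorphism
begin

lemma power_map_hom: "(\<lambda>v. \<lambda>i\<in>{..<n}. h (v i)) \<in> module_hom R (power_module M n) (power_module N n)"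
  by (auto simp: module_hom_def fun_eq_iff PiE_iff)

text \<open>Naturality of id \<otimes> \<phi> in the coefficient module. It is applied to the
  coordinate projections of a free module, to the inclusion of a kernel and to a surjection of
  coefficients.\<close>

lemma induced_map_natural:
  assumes \<phi>: "\<phi> \<in> module_hom R (free_power R n) (free_power R m)" and v: "v \<in> {..<n} \<rightarrow>\<^sub>E carrier M"
  shows "induced_map R N n m \<phi> (\<lambda>i\<in>{..<n}. h (v i)) = (\<lambda>i\<in>{..<m}. h (induced_map R M n m \<phi> v i))"
proof (rule ext)
  fix i
  show "induced_map R N n m \<phi> (\<lambda>i\<in>{..<n}. h (v i)) i = (\<lambda>i\<in>{..<m}. h (induced_map R M n m \<phi> v i)) i"
  proof (cases "i < m")
    case True
    have c: "\<phi> (unit_vec R n k) i \<in> carrier R" for k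
      using \<phi> True M.unit_vec_closed[of n k] by (auto simp: module_hom_def M.free_carrier PiE_iff Pi_iff)
    have "h (M.lsum (\<lambda>j. \<phi> (unit_vec R n j) i \<odot>\<^bsub>M\<^esub> v j) n) =
        N.lsum (\<lambda>j. h (\<phi> (unit_vec R n j) i \<odot>\<^bsub>M\<^esub> v j)) n"
      by (rule lsum_image) (use c v in \<open>auto simp: PiE_iff\<close>)
    also have "\<dots> = N.lsum (\<lambda>j. \<phi> (unit_vec R n j) i \<odot>\<^bsub>N\<^esub> (\<lambda>i\<in>{..<n}. h (v i)) j) n"
      by (rule N.lsum_cong) (use c v in \<open>auto simp: PiE_iff\<close>)
    finally show ?thesis using True by (simp add: induced_map_def)
  qed (simp add: induced_map_def)
qed

end

section \<open>Tensor products with free modules\<close>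

text \<open>Formal sums of pairs are lifted to the concrete model $M^n$ of $M \otimes R^n$; what is
  needed of the isomorphism is that a formal sum evaluating to \<open>0\<close> is a sum of relations.\<close>

lemma rcoset_free_Abelian: "H #>\<^bsub>free_Abelian_group S\<^esub> u = (\<lambda>z. z + u) ` H"
  by (auto simp: r_coset_def)

lemmas formal_sum_induct = free_Abelian_group_induct [consumes 1, case_names zero diff frag_of]

lemma tensor_rels_subset:
  assumes "module R M" "module R N"
  shows "tensor_rels R M N \<subseteq> carrier (tensor_pre M N)"
proof -
  interpret M: plain_module R M by (simp add: plain_module_def assms)
  interpret N: plain_module R N by (simp add: plain_module_def assms)
  have d: "a - b \<in> carrier (tensor_pre M N)" if "a \<in> carrier (tensor_pre M N)" "b \<in> carrier (tensor_pre M N)" for a b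
    using that keys_diff[of a b] by auto
  show ?thesis unfolding tensor_rels_def by (safe; intro d) auto
qed

text \<open>Closure under differences covers both remaining clauses of \<open>generate\<close>: an
  inverse is 0 - h, and a sum is h1 - (0 - h2).\<close>

lemma tensor_null_least:
  assumes MN: "module R M" "module R N" and z: "z \<in> tensor_null R M N"
    and H: "0 \<in> H" "\<And>a b. a \<in> H \<Longrightarrow> b \<in> H \<Longrightarrow> a - b \<in> H" "tensor_rels R M N \<subseteq> H"
  shows "z \<in> H"
  using z unfolding tensor_null_def
proof (induction rule: generate.induct)
  case one then show ?case using H by simp
next
  case (incl h) then show ?case using H by auto
next
  case (inv h)
  then have "inv\<^bsub>tensor_pre M N\<^esub> h = - h"
    using subsetD[OF tensor_rels_subset[OF MN]] by (intro inv_free_Abelian_group) (metis carrier_free_Abelian_group_iff)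
  moreover have "0 - h \<in> H" using H inv by blast
  ultimately show ?case by simp
next
  case (eng h1 h2)
  then have "h1 - (0 - h2) \<in> H" using H by blast
  then show ?case by simp
qed

lemma tensor_null_subgroup:
  assumes MN: "module R M" "module R N"
  shows "subgroup (tensor_null R M N) (tensor_pre M N)"
  unfolding tensor_null_def
  by (rule group.generate_is_subgroup[OF group_free_Abelian_group tensor_rels_subset[OF MN]])

lemma tensor_null_carrier:
  "module R M \<Longrightarrow> module R N \<Longrightarrow> z \<in> tensor_null R M N \<Longrightarrow> Poly_Mapping.keys z \<subseteq> carrier M \<times> carrier N"
  using subsetD[OF subgroup.subset[OF tensor_null_subgroup[of R M N]], of z] by simp

lemma tensor_null_zero: "0 \<in> tensor_null R M N"
  unfolding tensor_null_def using generate.one[of "tensor_pre M N"] by simp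

lemma tensor_null_add: "a \<in> tensor_null R M N \<Longrightarrow> b \<in> tensor_null R M N \<Longrightarrow> a + b \<in> tensor_null R M N"
  unfolding tensor_null_def using generate.eng[of a "tensor_pre M N" "tensor_rels R M N" b] by simp

lemma tensor_null_diff:
  assumes MN: "module R M" "module R N" and "a \<in> tensor_null R M N" "b \<in> tensor_null R M N"
  shows "a - b \<in> tensor_null R M N"
proof -
  have "inv\<^bsub>tensor_pre M N\<^esub> b = - b"
    using tensor_null_carrier[OF MN assms(4)] by (rule inv_free_Abelian_group)
  then have "- b \<in> tensor_null R M N" using subgroup.m_inv_closed[OF tensor_null_subgroup[OF MN] assms(4)] by simp
  then show ?thesis using tensor_null_add[OF assms(3), of "- b"] by simp
qed

lemma tensor_rels_null: "z \<in> tensor_rels R M N \<Longrightarrow> z \<in> tensor_null R M N"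
  unfolding tensor_null_def by (rule generate.incl)

text \<open>The map \<theta> sends a formal sum of pairs to its value in M^n. It is a parameter, so
  that its existence, by the universal property of the free abelian group, stays apart from its use;
  additivity is stated for differences to match the induction rule for formal sums.\<close>

locale tensor_eval = plain_module R M
  for R :: "('a, 'r) ring_scheme" (structure) and M :: "('a, 'm) module" (structure) +
  fixes n :: nat and \<theta> :: "('m \<times> (nat \<Rightarrow> 'a) \<Rightarrow>\<^sub>0 int) \<Rightarrow> nat \<Rightarrow> 'm"
  assumes eval_closed: "Poly_Mapping.keys u \<subseteq> carrier M \<times> ({..<n} \<rightarrow>\<^sub>E carrier R) \<Longrightarrow> \<theta> u \<in> {..<n} \<rightarrow>\<^sub>E carrier M"
    and eval_diff: "Poly_Mapping.keys u \<subseteq> carrier M \<times> ({..<n} \<rightarrow>\<^sub>E carrier R) \<Longrightarrow>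
      Poly_Mapping.keys w \<subseteq> carrier M \<times> ({..<n} \<rightarrow>\<^sub>E carrier R) \<Longrightarrow>
      \<theta> (u - w) = \<theta> u \<ominus>\<^bsub>power_module M n\<^esub> \<theta> w"
    and eval_frag_of: "x \<in> carrier M \<Longrightarrow> y \<in> {..<n} \<rightarrow>\<^sub>E carrier R \<Longrightarrow> \<theta> (frag_of (x, y)) = pure M n x y"

lemma (in plain_module) tensor_eval_exists: "\<exists>\<theta>. tensor_eval R M n \<theta>"
proof -
  interpret P: plain_module R "power_module M n" by (rule power_plain_module)
  let ?S = "carrier M \<times> ({..<n} \<rightarrow>\<^sub>E carrier R)"
  let ?G = "add_monoid (power_module M n)"
  have G: "comm_group ?G" by (rule P.a_comm_group)
  have "(\<lambda>p. pure M n (fst p) (snd p)) ` ?S \<subseteq> carrier ?G"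
  proof (rule image_subsetI)
    fix p assume "p \<in> ?S"
    then show "pure M n (fst p) (snd p) \<in> carrier ?G" using pure_closed[of "fst p" "snd p"] by (simp add: mem_Times_iff)
  qed
  from comm_group.free_Abelian_group_universal[OF G this] obtain h where
    h: "h \<in> hom (free_Abelian_group ?S) ?G" "\<And>x. x \<in> ?S \<Longrightarrow> h (frag_of x) = pure M n (fst x) (snd x)" by blast
  interpret gh: group_hom "free_Abelian_group ?S" ?G h
    unfolding group_hom_def group_hom_axioms_def
    using h(1) group_free_Abelian_group comm_group.axioms(2)[OF G] by blast
  have "h (u - w) = h u \<ominus>\<^bsub>power_module M n\<^esub> h w"
    if "Poly_Mapping.keys u \<subseteq> ?S" "Poly_Mapping.keys w \<subseteq> ?S" for u w
  proof -
    have "h (u + - w) = h u \<oplus>\<^bsub>power_module M n\<^esub> h (- w)"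
      using gh.hom_mult[of u "- w"] that by simp
    moreover have "h (- w) = \<ominus>\<^bsub>power_module M n\<^esub> h w"
      using gh.hom_inv[of w] that by (simp add: a_inv_def)
    ultimately show ?thesis by (simp add: P.M.minus_eq)
  qed
  moreover have "h u \<in> {..<n} \<rightarrow>\<^sub>E carrier M" if "Poly_Mapping.keys u \<subseteq> ?S" for u
    using gh.hom_closed[of u] that by simp
  ultimately have "tensor_eval R M n h"
    using h(2) by unfold_locales auto
  then show ?thesis by blast
qed

context tensor_eval
begin

abbreviation "Fn \<equiv> free_power R n"
abbreviation "S \<equiv> carrier M \<times> ({..<n} \<rightarrow>\<^sub>E carrier R)"
abbreviation "null \<equiv> tensor_null R M Fn"

lemmas mods = module_axioms free_module_module[of n]

sublocale P: plain_module R "power_module M n" by (rule power_plain_module)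
sublocale F: plain_module R "free_power R n" by (simp add: plain_module_def free_module_module)

lemma eval_zero: "\<theta> 0 = \<zero>\<^bsub>power_module M n\<^esub>"
  using eval_diff[of 0 0] eval_closed[of 0] by (metis P.M.r_neg P.M.minus_eq diff_self keys_zero empty_subsetI power_module_simps(1))

lemma eval_null:
  assumes z: "z \<in> null" shows "\<theta> z = \<zero>\<^bsub>power_module M n\<^esub>"
proof -
  let ?H = "{u. Poly_Mapping.keys u \<subseteq> S \<and> \<theta> u = \<zero>\<^bsub>power_module M n\<^esub>}"
  have d: "a - b \<in> ?H" if "a \<in> ?H" "b \<in> ?H" for a b
  proof -
    have "Poly_Mapping.keys (a - b) \<subseteq> S" using that keys_diff[of a b] by auto
    moreover have "\<theta> (a - b) = \<zero>\<^bsub>power_module M n\<^esub>"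
      using that eval_diff[of a b] by (simp add: P.M.minus_eq del: power_module_simps)
    ultimately show ?thesis by simp
  qed
  have k2: "Poly_Mapping.keys (frag_of a - frag_of b) \<subseteq> S" if "a \<in> S" "b \<in> S" for a b
    using keys_diff[of "frag_of a" "frag_of b"] that by auto
  have k3: "Poly_Mapping.keys (frag_of a - frag_of b - frag_of c) \<subseteq> S" if "a \<in> S" "b \<in> S" "c \<in> S" for a b c
  proof -
    have "Poly_Mapping.keys (frag_of a - frag_of b - frag_of c) \<subseteq> Poly_Mapping.keys (frag_of a - frag_of b) \<union> {c}"
      using keys_diff[of "frag_of a - frag_of b" "frag_of c"] by simp
    then show ?thesis using k2[OF that(1,2)] that(3) by blast
  qed
  have canc: "(b \<oplus>\<^bsub>power_module M n\<^esub> c) \<ominus>\<^bsub>power_module M n\<^esub> b \<ominus>\<^bsub>power_module M n\<^esub> c = \<zero>\<^bsub>power_module M n\<^esub>"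
    if "b \<in> carrier (power_module M n)" "c \<in> carrier (power_module M n)" for b c
    using that P.add_minus_cancel[OF that] P.M.r_neg P.M.minus_eq by metis
  \<comment> \<open>Serves both additivity relations, which differ only in the slot that is split;
    \<open>t2\<close> below serves the balancing relation.\<close>
  have t3: "frag_of a - frag_of b - frag_of c \<in> ?H"
    if "a \<in> S" "b \<in> S" "c \<in> S"
      and "pure M n (fst a) (snd a) = pure M n (fst b) (snd b) \<oplus>\<^bsub>power_module M n\<^esub> pure M n (fst c) (snd c)" for a b c
  proof -
    have "\<theta> (frag_of a - frag_of b - frag_of c) =
      (\<theta> (frag_of b) \<oplus>\<^bsub>power_module M n\<^esub> \<theta> (frag_of c)) \<ominus>\<^bsub>power_module M n\<^esub> \<theta> (frag_of b) \<ominus>\<^bsub>power_module M n\<^esub> \<theta> (frag_of c)"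
      using that k2[OF that(1,2)] eval_frag_of[of "fst a" "snd a"] eval_frag_of[of "fst b" "snd b"] eval_frag_of[of "fst c" "snd c"]
      by (subst eval_diff) (auto simp: eval_diff mem_Times_iff simp del: power_module_simps)
    also have "\<dots> = \<zero>\<^bsub>power_module M n\<^esub>"
    proof (rule canc)
      show "\<theta> (frag_of b) \<in> carrier (power_module M n)" "\<theta> (frag_of c) \<in> carrier (power_module M n)"
        using eval_closed[of "frag_of b"] eval_closed[of "frag_of c"] that by simp_all
    qed
    finally show ?thesis using k3[OF that(1-3)] by simp
  qed
  have t2: "frag_of a - frag_of b \<in> ?H"
    if "a \<in> S" "b \<in> S" and "pure M n (fst a) (snd a) = pure M n (fst b) (snd b)" for a b
  proof -
    have "\<theta> (frag_of a - frag_of b) = \<theta> (frag_of b) \<ominus>\<^bsub>power_module M n\<^esub> \<theta> (frag_of b)"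
      using that eval_frag_of[of "fst a" "snd a"] eval_frag_of[of "fst b" "snd b"]
      by (subst eval_diff) (auto simp: mem_Times_iff simp del: power_module_simps)
    also have "\<dots> = \<zero>\<^bsub>power_module M n\<^esub>"
      using that eval_closed[of "frag_of b"] P.M.r_neg P.M.minus_eq by auto
    finally show ?thesis using k2[OF that(1-2)] by simp
  qed
  have "tensor_rels R M Fn \<subseteq> ?H"
  proof
    fix z assume "z \<in> tensor_rels R M Fn"
    then consider (l) x x' y where "z = frag_of (x \<oplus>\<^bsub>M\<^esub> x', y) - frag_of (x, y) - frag_of (x', y)"
        "x \<in> carrier M" "x' \<in> carrier M" "y \<in> {..<n} \<rightarrow>\<^sub>E carrier R"
      | (r) x y y' where "z = frag_of (x, y \<oplus>\<^bsub>Fn\<^esub> y') - frag_of (x, y) - frag_of (x, y')"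
        "x \<in> carrier M" "y \<in> {..<n} \<rightarrow>\<^sub>E carrier R" "y' \<in> {..<n} \<rightarrow>\<^sub>E carrier R"
      | (s) a x y where "z = frag_of (a \<odot>\<^bsub>M\<^esub> x, y) - frag_of (x, a \<odot>\<^bsub>Fn\<^esub> y)"
        "a \<in> carrier R" "x \<in> carrier M" "y \<in> {..<n} \<rightarrow>\<^sub>E carrier R"
      unfolding tensor_rels_def free_carrier by blast
    then show "z \<in> ?H"
    proof cases
      case l
      show ?thesis unfolding l(1)
        by (rule t3) (use l in \<open>auto simp: pure_def fun_eq_iff PiE_iff smult_r_distr\<close>)
    next
      case r
      show ?thesis unfolding r(1)
        by (rule t3) (use r in \<open>auto simp: free_power_eq pure_def fun_eq_iff PiE_iff smult_l_distr\<close>)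
    next
      case s
      show ?thesis unfolding s(1)
        by (rule t2) (use s in \<open>auto simp: free_power_eq pure_def fun_eq_iff PiE_iff smult_assoc1[symmetric] R.m_comm\<close>)
    qed
  qed
  then have "z \<in> ?H"
    by (intro tensor_null_least[OF mods z]) (use d eval_zero in auto)
  then show ?thesis by simp
qed

abbreviation equiv_null (infix "\<bowtie>" 50) where "u \<bowtie> w \<equiv> u - w \<in> null"

lemma eqv_trans: "u \<bowtie> v \<Longrightarrow> v \<bowtie> w \<Longrightarrow> u \<bowtie> w"
  using tensor_null_add[of "u - v" R M Fn "v - w"] by simp

lemma eqv_sym: "u \<bowtie> v \<Longrightarrow> v \<bowtie> u"
  using tensor_null_diff[OF mods tensor_null_zero, of "u - v"] by simp

lemma eqv_add: "u \<bowtie> v \<Longrightarrow> u' \<bowtie> v' \<Longrightarrow> u + u' \<bowtie> v + v'"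
  using tensor_null_add[of "u - v" R M Fn "u' - v'"] by (simp add: algebra_simps)

lemma eqv_diff: "u \<bowtie> v \<Longrightarrow> u' \<bowtie> v' \<Longrightarrow> u - u' \<bowtie> v - v'"
  using tensor_null_diff[OF mods, of "u - v" "u' - v'"] by (simp add: algebra_simps)

lemma eqv_sum: "(\<And>j. j \<in> A \<Longrightarrow> u j \<bowtie> v j) \<Longrightarrow> sum u A \<bowtie> sum v A"
  by (induction A rule: infinite_finite_induct) (auto simp: tensor_null_zero intro: eqv_add[simplified])

lemma frag_add_left:
  "x \<in> carrier M \<Longrightarrow> x' \<in> carrier M \<Longrightarrow> y \<in> {..<n} \<rightarrow>\<^sub>E carrier R \<Longrightarrow>
   frag_of (x \<oplus>\<^bsub>M\<^esub> x', y) \<bowtie> frag_of (x, y) + frag_of (x', y)"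
  unfolding diff_diff_add[symmetric] by (rule tensor_rels_null) (auto simp: tensor_rels_def free_carrier)

lemma frag_add_right:
  "x \<in> carrier M \<Longrightarrow> y \<in> {..<n} \<rightarrow>\<^sub>E carrier R \<Longrightarrow> y' \<in> {..<n} \<rightarrow>\<^sub>E carrier R \<Longrightarrow>
   frag_of (x, y \<oplus>\<^bsub>Fn\<^esub> y') \<bowtie> frag_of (x, y) + frag_of (x, y')"
  unfolding diff_diff_add[symmetric] by (rule tensor_rels_null) (auto simp: tensor_rels_def free_carrier)

lemma frag_smult:
  "a \<in> carrier R \<Longrightarrow> x \<in> carrier M \<Longrightarrow> y \<in> {..<n} \<rightarrow>\<^sub>E carrier R \<Longrightarrow>
   frag_of (a \<odot>\<^bsub>M\<^esub> x, y) \<bowtie> frag_of (x, a \<odot>\<^bsub>Fn\<^esub> y)"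
  by (rule tensor_rels_null) (auto simp: tensor_rels_def free_carrier)

lemma frag_zero_left:
  assumes "y \<in> {..<n} \<rightarrow>\<^sub>E carrier R" shows "frag_of (\<zero>\<^bsub>M\<^esub>, y) \<bowtie> 0"
proof -
  have "frag_of (\<zero>\<^bsub>M\<^esub>, y) \<bowtie> frag_of (\<zero>\<^bsub>M\<^esub>, y) + frag_of (\<zero>\<^bsub>M\<^esub>, y)"
    using frag_add_left[OF M.zero_closed M.zero_closed assms] by simp
  then have "0 - frag_of (\<zero>\<^bsub>M\<^esub>, y) \<in> null" by simp
  then show ?thesis by (rule eqv_sym)
qed

lemma frag_zero_right:
  assumes "x \<in> carrier M" shows "frag_of (x, \<lambda>i\<in>{..<n}. \<zero>) \<bowtie> 0"
proof -
  have z: "(\<lambda>i\<in>{..<n}. \<zero>) \<in> {..<n} \<rightarrow>\<^sub>E carrier R" by auto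
  have "(\<lambda>i\<in>{..<n}. \<zero>) \<oplus>\<^bsub>Fn\<^esub> (\<lambda>i\<in>{..<n}. \<zero>) = (\<lambda>i\<in>{..<n}. \<zero>)" by (auto simp: free_power_eq fun_eq_iff)
  then have "frag_of (x, \<lambda>i\<in>{..<n}. \<zero>) \<bowtie> frag_of (x, \<lambda>i\<in>{..<n}. \<zero>) + frag_of (x, \<lambda>i\<in>{..<n}. \<zero>)"
    using frag_add_right[OF assms z z] by simp
  then have "0 - frag_of (x, \<lambda>i\<in>{..<n}. \<zero>) \<in> null" by simp
  then show ?thesis by (rule eqv_sym)
qed

text \<open>A lift of v to the sum of the v_j \<otimes> e_j, inverse to evaluation modulo the
  relations.\<close>

definition section_of :: "(nat \<Rightarrow> 'm) \<Rightarrow> ('m \<times> (nat \<Rightarrow> 'a) \<Rightarrow>\<^sub>0 int)" where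
  "section_of v = (\<Sum>j<n. frag_of (v j, unit_vec R n j))"

lemma section_add:
  assumes "v \<in> {..<n} \<rightarrow>\<^sub>E carrier M" "w \<in> {..<n} \<rightarrow>\<^sub>E carrier M"
  shows "section_of (v \<oplus>\<^bsub>power_module M n\<^esub> w) \<bowtie> section_of v + section_of w"
proof -
  have "frag_of ((v \<oplus>\<^bsub>power_module M n\<^esub> w) j, unit_vec R n j) \<bowtie>
      frag_of (v j, unit_vec R n j) + frag_of (w j, unit_vec R n j)" if "j < n" for j
  proof -
    have "v j \<in> carrier M" "w j \<in> carrier M" using assms that by (auto simp: PiE_iff)
    then show ?thesis using frag_add_left[OF _ _ unit_vec_closed, of "v j" "w j" j] that by simp
  qed
  then show ?thesis unfolding section_of_def sum.distrib[symmetric] by (intro eqv_sum) auto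
qed

lemma section_zero: "section_of \<zero>\<^bsub>power_module M n\<^esub> \<bowtie> 0"
proof -
  have "section_of \<zero>\<^bsub>power_module M n\<^esub> \<bowtie> (\<Sum>j<n. 0)"
    unfolding section_of_def by (rule eqv_sum) (use frag_zero_left in auto)
  then show ?thesis by simp
qed

lemma section_diff:
  assumes "v \<in> {..<n} \<rightarrow>\<^sub>E carrier M" "w \<in> {..<n} \<rightarrow>\<^sub>E carrier M"
  shows "section_of (v \<ominus>\<^bsub>power_module M n\<^esub> w) \<bowtie> section_of v - section_of w"
proof -
  have c: "v \<ominus>\<^bsub>power_module M n\<^esub> w \<in> {..<n} \<rightarrow>\<^sub>E carrier M"
    using P.M.minus_closed[of v w] assms by simp
  have "section_of ((v \<ominus>\<^bsub>power_module M n\<^esub> w) \<oplus>\<^bsub>power_module M n\<^esub> w) \<bowtie> section_of (v \<ominus>\<^bsub>power_module M n\<^esub> w) + section_of w"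
    by (rule section_add[OF c assms(2)])
  moreover have "(v \<ominus>\<^bsub>power_module M n\<^esub> w) \<oplus>\<^bsub>power_module M n\<^esub> w = v"
    using P.minus_add_cancel[of v w] assms by (simp del: power_module_simps(3))
  ultimately have "section_of v \<bowtie> section_of (v \<ominus>\<^bsub>power_module M n\<^esub> w) + section_of w" by metis
  then have "section_of v - section_of w \<bowtie> section_of (v \<ominus>\<^bsub>power_module M n\<^esub> w)" by (simp add: algebra_simps)
  then show ?thesis by (rule eqv_sym)
qed

text \<open>In the tensor product x \<otimes> y equals the sum of the (y_j x) \<otimes> e_j. It is
  enough to see this for multiples of unit vectors, where scalars move across the tensor sign, and
  both sides are additive in y modulo the relations.\<close>

lemma frag_of_section:
  assumes x: "x \<in> carrier M" and y: "y \<in> {..<n} \<rightarrow>\<^sub>E carrier R"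
  shows "frag_of (x, y) \<bowtie> section_of (pure M n x y)"
  using y
proof (induction rule: free_induct)
  case zero
  have "pure M n x (\<lambda>i\<in>{..<n}. \<zero>) = \<zero>\<^bsub>power_module M n\<^esub>" using x by (auto simp: pure_def fun_eq_iff)
  then show ?case using eqv_trans[OF frag_zero_right[OF x] eqv_sym[OF section_zero]] by metis
next
  case (emb k a)
  have e: "pure M n x (a \<odot>\<^bsub>Fn\<^esub> unit_vec R n k) j = (if j = k then a \<odot>\<^bsub>M\<^esub> x else \<zero>\<^bsub>M\<^esub>)" if "j < n" for j
    using emb x that by (auto simp: pure_def free_power_eq unit_vec_def)
  have "section_of (pure M n x (a \<odot>\<^bsub>Fn\<^esub> unit_vec R n k)) \<bowtie>
      (\<Sum>j<n. if j = k then frag_of (a \<odot>\<^bsub>M\<^esub> x, unit_vec R n k) else 0)"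
    unfolding section_of_def by (rule eqv_sum) (auto simp: e tensor_null_zero frag_zero_left[simplified])
  also have "(\<Sum>j<n. if j = k then frag_of (a \<odot>\<^bsub>M\<^esub> x, unit_vec R n k) else 0) = frag_of (a \<odot>\<^bsub>M\<^esub> x, unit_vec R n k)"
    using emb by simp
  finally have "section_of (pure M n x (a \<odot>\<^bsub>Fn\<^esub> unit_vec R n k)) \<bowtie> frag_of (a \<odot>\<^bsub>M\<^esub> x, unit_vec R n k)" .
  then show ?case using frag_smult[OF emb(2) x unit_vec_closed] eqv_trans eqv_sym by blast
next
  case (add v w)
  have p: "pure M n x (v \<oplus>\<^bsub>Fn\<^esub> w) = pure M n x v \<oplus>\<^bsub>power_module M n\<^esub> pure M n x w"
    using add x by (auto simp: pure_def free_power_eq fun_eq_iff PiE_iff smult_l_distr)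
  have "frag_of (x, v \<oplus>\<^bsub>Fn\<^esub> w) \<bowtie> section_of (pure M n x v) + section_of (pure M n x w)"
    using eqv_trans[OF frag_add_right[OF x add(1,2)] eqv_add[OF add(3,4)]] .
  also have "section_of (pure M n x v) + section_of (pure M n x w) \<bowtie> section_of (pure M n x (v \<oplus>\<^bsub>Fn\<^esub> w))"
    unfolding p by (rule eqv_sym[OF section_add]) (use add x in auto)
  ultimately show ?case using eqv_trans by blast
qed

lemma section_eval:
  assumes "Poly_Mapping.keys u \<subseteq> S" shows "u \<bowtie> section_of (\<theta> u)"
  using assms
proof (induction rule: formal_sum_induct)
  case zero then show ?case unfolding eval_zero by (rule eqv_sym[OF section_zero])
next
  case (diff u w)
  have "u - w \<bowtie> section_of (\<theta> u) - section_of (\<theta> w)" by (rule eqv_diff[OF diff(3,4)])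
  also have "section_of (\<theta> u) - section_of (\<theta> w) \<bowtie> section_of (\<theta> (u - w))"
    unfolding eval_diff[OF diff(1,2)] by (rule eqv_sym[OF section_diff]) (use diff eval_closed in auto)
  ultimately show ?case using eqv_trans by blast
next
  case (frag_of a)
  then obtain x y where a: "a = (x, y)" "x \<in> carrier M" "y \<in> {..<n} \<rightarrow>\<^sub>E carrier R" by blast
  show ?case unfolding a(1) eval_frag_of[OF a(2,3)] by (rule frag_of_section[OF a(2,3)])
qed

text \<open>Injectivity of the map from M \<otimes> R^n to M^n: u is congruent to the section of its
  own value, which is the section of zero.\<close>

lemma eval_eq_zeroD:
  assumes "Poly_Mapping.keys u \<subseteq> S" "\<theta> u = \<zero>\<^bsub>power_module M n\<^esub>" shows "u \<in> null"
  using eqv_trans[OF section_eval[OF assms(1), unfolded assms(2)] section_zero] by simp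

lemma eval_surj:
  assumes "v \<in> {..<n} \<rightarrow>\<^sub>E carrier M"
  obtains u where "Poly_Mapping.keys u \<subseteq> S" "\<theta> u = v"
proof -
  have "\<exists>u. Poly_Mapping.keys u \<subseteq> S \<and> \<theta> u = v"
    using assms carrier_is_submodule
  proof (induction rule: power_induct)
    case zero then show ?case by (intro exI[of _ 0]) (simp add: eval_zero del: power_module_simps)
  next
    case (emb j x)
    then show ?case by (intro exI[of _ "frag_of (x, unit_vec R n j)"]) (auto simp: eval_frag_of pure_unit_vec)
  next
    case (add v w)
    then obtain u u' where u: "Poly_Mapping.keys u \<subseteq> S" "\<theta> u = v" "Poly_Mapping.keys u' \<subseteq> S" "\<theta> u' = w" by blast
    \<comment> \<open>The sum u + u' is rewritten with differences, the only operation for which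
      \<theta> is assumed compatible.\<close>
    have "\<theta> (u - (0 - u')) = v \<ominus>\<^bsub>power_module M n\<^esub> (\<zero>\<^bsub>power_module M n\<^esub> \<ominus>\<^bsub>power_module M n\<^esub> w)"
      using u by (subst eval_diff; (subst eval_diff)?) (auto simp: eval_zero simp del: power_module_simps)
    also have "\<dots> = v \<oplus>\<^bsub>power_module M n\<^esub> w"
    proof -
      have c: "v \<in> carrier (power_module M n)" "w \<in> carrier (power_module M n)" using add by auto
      then have "\<zero>\<^bsub>power_module M n\<^esub> \<ominus>\<^bsub>power_module M n\<^esub> w = \<ominus>\<^bsub>power_module M n\<^esub> w"
        by (simp add: P.M.minus_eq del: power_module_simps)
      then show ?thesis using c by (simp add: P.M.minus_eq del: power_module_simps)
    qed
    finally have e: "\<theta> (u + u') = v \<oplus>\<^bsub>power_module M n\<^esub> w" by simp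
    have "Poly_Mapping.keys (u + u') \<subseteq> S" using keys_add[of u u'] u by auto
    with e show ?case by blast
  qed
  then show thesis using that by blast
qed

end

section \<open>Vanishing of Tor as exactness of the complex \<open>M \<otimes> F\<close>\<close>

text \<open>The definition of \<open>tensor_map\<close> takes a union over all representatives.
  Since id \<otimes> g sends relations to relations, every representative \<open>w + u\<close> with
  w null contributes the same coset.\<close>

lemma tensor_map_coset:
  assumes M: "module R M" and N: "module R N" and N': "module R N'" and g: "g \<in> module_hom R N N'"
  shows "tensor_map R M N' g (tensor_null R M N #>\<^bsub>tensor_pre M N\<^esub> u) =
    tensor_null R M N' #>\<^bsub>tensor_pre M N'\<^esub> frag_extend (\<lambda>(x, y). frag_of (x, g y)) u"
proof -
  let ?g = "frag_extend (\<lambda>(x, y). frag_of (x, g y))"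
  let ?K = "tensor_null R M N" and ?K' = "tensor_null R M N'"
  interpret g: module_homomorphism R N N' g by (intro module_homI N N' g)
  have null: "?g z \<in> ?K'" if z: "z \<in> ?K" for z
  proof -
    have "z \<in> {z. ?g z \<in> ?K'}"
    proof (rule tensor_null_least[OF M N z])
      show "tensor_rels R M N \<subseteq> {z. ?g z \<in> ?K'}"
      proof
        fix z assume "z \<in> tensor_rels R M N"
        then consider (l) x x' y where "z = frag_of (x \<oplus>\<^bsub>M\<^esub> x', y) - frag_of (x, y) - frag_of (x', y)"
            "x \<in> carrier M" "x' \<in> carrier M" "y \<in> carrier N"
          | (r) x y y' where "z = frag_of (x, y \<oplus>\<^bsub>N\<^esub> y') - frag_of (x, y) - frag_of (x, y')"
            "x \<in> carrier M" "y \<in> carrier N" "y' \<in> carrier N"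
          | (s) a x y where "z = frag_of (a \<odot>\<^bsub>M\<^esub> x, y) - frag_of (x, a \<odot>\<^bsub>N\<^esub> y)"
            "a \<in> carrier R" "x \<in> carrier M" "y \<in> carrier N"
          unfolding tensor_rels_def by blast
        then have "?g z \<in> tensor_rels R M N'"
        proof cases
          case l
          then have "?g z = frag_of (x \<oplus>\<^bsub>M\<^esub> x', g y) - frag_of (x, g y) - frag_of (x', g y)"
            by (simp add: frag_extend_diff)
          then show ?thesis unfolding tensor_rels_def using l g.closed by blast
        next
          case r
          then have "?g z = frag_of (x, g y \<oplus>\<^bsub>N'\<^esub> g y') - frag_of (x, g y) - frag_of (x, g y')"
            by (simp add: frag_extend_diff)
          then show ?thesis unfolding tensor_rels_def using r g.closed by blast
        next
          case s
          then have "?g z = frag_of (a \<odot>\<^bsub>M\<^esub> x, g y) - frag_of (x, a \<odot>\<^bsub>N'\<^esub> g y)"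
            by (simp add: frag_extend_diff)
          then show ?thesis unfolding tensor_rels_def using s g.closed by blast
        qed
        then show "z \<in> {z. ?g z \<in> ?K'}" by (simp add: tensor_rels_null)
      qed
    qed (auto simp: tensor_null_zero frag_extend_diff tensor_null_diff[OF M N'])
    then show ?thesis by simp
  qed
  have "(\<lambda>z. z + ?g (w + u)) ` ?K' = (\<lambda>z. z + ?g u) ` ?K'" if w: "w \<in> ?K" for w
  proof -
    have e: "z + ?g (w + u) = (z + ?g w) + ?g u" "z + ?g u = (z - ?g w) + ?g (w + u)" for z
      by (simp_all add: frag_extend_add)
    have m: "z + ?g w \<in> ?K'" "z - ?g w \<in> ?K'" if "z \<in> ?K'" for z
      using that null[OF w] by (auto intro: tensor_null_add tensor_null_diff[OF M N'])
    show ?thesis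
    proof (intro subset_antisym image_subsetI)
      fix z assume "z \<in> ?K'"
      then show "z + ?g (w + u) \<in> (\<lambda>z. z + ?g u) ` ?K'" by (intro image_eqI[where x = "z + ?g w"] e(1) m(1))
    next
      fix z assume "z \<in> ?K'"
      then show "z + ?g u \<in> (\<lambda>z. z + ?g (w + u)) ` ?K'" by (intro image_eqI[where x = "z - ?g w"] e(2) m(2))
    qed
  qed
  then have "(\<Union>v\<in>(\<lambda>z. z + u) ` ?K. (\<lambda>z. z + ?g v) ` ?K') = (\<Union>w\<in>?K. (\<lambda>z. z + ?g u) ` ?K')" by simp
  also have "\<dots> = (\<lambda>z. z + ?g u) ` ?K'" using tensor_null_zero[of R M N] by blast
  finally show ?thesis unfolding tensor_map_def rcoset_free_Abelian .
qed

text \<open>Exactness of V^n1 to V^n2 to V^n3 in the form that cycles are boundaries; the converse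
  inclusion is automatic in a complex.\<close>

definition exact_at ::
  "('a, 'r) ring_scheme \<Rightarrow> ('a, 'm) module \<Rightarrow> nat \<Rightarrow> nat \<Rightarrow> nat \<Rightarrow>
   ((nat \<Rightarrow> 'a) \<Rightarrow> (nat \<Rightarrow> 'a)) \<Rightarrow> ((nat \<Rightarrow> 'a) \<Rightarrow> (nat \<Rightarrow> 'a)) \<Rightarrow> bool" where
  "exact_at R M n1 n2 n3 \<phi> \<psi> \<longleftrightarrow>
     (\<forall>v \<in> carrier (power_module M n2). induced_map R M n2 n3 \<psi> v = \<zero>\<^bsub>power_module M n3\<^esub> \<longrightarrow>
        (\<exists>w \<in> carrier (power_module M n1). induced_map R M n1 n2 \<phi> w = v))"

text \<open>A cycle v in M^n2 is lifted to a formal sum. Its coset is a cycle because evaluation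
  over n3 is injective on classes, hence it is the image of some coset, and evaluating a
  representative of the latter gives w.\<close>

lemma (in plain_module) exact_at_tensor:
  assumes \<phi>: "\<phi> \<in> module_hom R (free_power R n1) (free_power R n2)"
    and \<psi>: "\<psi> \<in> module_hom R (free_power R n2) (free_power R n3)"
    and ex: "\<And>A. A \<in> carrier (tensor_module R M (free_power R n2)) \<Longrightarrow>
      tensor_map R M (free_power R n3) \<psi> A = tensor_null R M (free_power R n3) \<Longrightarrow>
      A \<in> tensor_map R M (free_power R n2) \<phi> ` carrier (tensor_module R M (free_power R n1))"
  shows "exact_at R M n1 n2 n3 \<phi> \<psi>"
  unfolding exact_at_def
proof (intro ballI impI)
  obtain t1 where "tensor_eval R M n1 t1" using tensor_eval_exists by blast
  then interpret T1: tensor_eval R M n1 t1 .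
  obtain t2 where "tensor_eval R M n2 t2" using tensor_eval_exists by blast
  then interpret T2: tensor_eval R M n2 t2 .
  obtain t3 where "tensor_eval R M n3 t3" using tensor_eval_exists by blast
  then interpret T3: tensor_eval R M n3 t3 .
  \<comment> \<open>Evaluation turns the map of formal sums given by \<phi> into
    \<open>induced_map\<close>; stated for arbitrary ranks, since it is used for both \<phi> and
    \<psi>.\<close>
  have nat: "Poly_Mapping.keys (frag_extend (\<lambda>(x, y). frag_of (x, \<phi> y)) u) \<subseteq> carrier M \<times> ({..<m} \<rightarrow>\<^sub>E carrier R) \<and>
      t' (frag_extend (\<lambda>(x, y). frag_of (x, \<phi> y)) u) = induced_map R M n m \<phi> (t u)"
    if u: "Poly_Mapping.keys u \<subseteq> carrier M \<times> ({..<n} \<rightarrow>\<^sub>E carrier R)"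
      and \<phi>: "\<phi> \<in> module_hom R (free_power R n) (free_power R m)"
      and t: "tensor_eval R M n t" and t': "tensor_eval R M m t'" for n m t t' \<phi> u
  proof -
    interpret T: tensor_eval R M n t by (rule t)
    interpret T': tensor_eval R M m t' by (rule t')
    interpret h: module_homomorphism R "power_module M n" "power_module M m" "induced_map R M n m \<phi>"
      by (intro module_homI power_module_module induced_map_hom \<phi>)
    show ?thesis
      using u
    proof (induction rule: formal_sum_induct)
      case zero then show ?case using h.zero by (simp add: T.eval_zero T'.eval_zero del: power_module_simps)
    next
      case (diff u w)
      let ?e = "frag_extend (\<lambda>(x, y). frag_of (x, \<phi> y))"
      have k: "Poly_Mapping.keys (?e u) \<subseteq> carrier M \<times> ({..<m} \<rightarrow>\<^sub>E carrier R)"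
        "Poly_Mapping.keys (?e w) \<subseteq> carrier M \<times> ({..<m} \<rightarrow>\<^sub>E carrier R)" using diff by blast+
      have e: "?e (u - w) = ?e u - ?e w" by (rule frag_extend_diff)
      have c: "t u \<in> carrier (power_module M n)" "t w \<in> carrier (power_module M n)"
        using T.eval_closed[OF diff(1)] T.eval_closed[OF diff(2)] by simp_all
      have "t' (?e (u - w)) = t' (?e u) \<ominus>\<^bsub>power_module M m\<^esub> t' (?e w)"
        unfolding e by (rule T'.eval_diff[OF k])
      also have "\<dots> = induced_map R M n m \<phi> (t u) \<ominus>\<^bsub>power_module M m\<^esub> induced_map R M n m \<phi> (t w)"
        using diff by metis
      also have "\<dots> = induced_map R M n m \<phi> (t (u - w))"
        unfolding T.eval_diff[OF diff(1,2)] by (rule h.minus[OF c, symmetric])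
      finally have "t' (?e (u - w)) = induced_map R M n m \<phi> (t (u - w))" .
      moreover have "Poly_Mapping.keys (?e (u - w)) \<subseteq> carrier M \<times> ({..<m} \<rightarrow>\<^sub>E carrier R)"
        unfolding e by (rule subset_trans[OF keys_diff]) (use k in blast)
      ultimately show ?case by blast
    next
      case (frag_of a)
      then obtain x y where a: "a = (x, y)" "x \<in> carrier M" "y \<in> {..<n} \<rightarrow>\<^sub>E carrier R" by blast
      have "\<phi> y \<in> {..<m} \<rightarrow>\<^sub>E carrier R"
        using \<phi> a(3) unfolding module_hom_def free_carrier by blast
      then show ?case unfolding a(1)
        using a(2,3) by (simp add: T.eval_frag_of T'.eval_frag_of induced_map_pure[OF \<phi>] del: PiE_iff)
    qed
  qed
  note nat1 = nat[OF _ \<phi> T1.tensor_eval_axioms T2.tensor_eval_axioms]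
  note nat2 = nat[OF _ \<psi> T2.tensor_eval_axioms T3.tensor_eval_axioms]
  fix v assume v: "v \<in> carrier (power_module M n2)" and z: "induced_map R M n2 n3 \<psi> v = \<zero>\<^bsub>power_module M n3\<^esub>"
  obtain u where u: "Poly_Mapping.keys u \<subseteq> carrier M \<times> ({..<n2} \<rightarrow>\<^sub>E carrier R)" "t2 u = v"
    using T2.eval_surj v by auto
  let ?A = "tensor_null R M (free_power R n2) #>\<^bsub>tensor_pre M (free_power R n2)\<^esub> u"
  have "frag_extend (\<lambda>(x, y). frag_of (x, \<psi> y)) u \<in> tensor_null R M (free_power R n3)"
    by (rule T3.eval_eq_zeroD) (use nat2[OF u(1)] u z in auto)
  then have "tensor_map R M (free_power R n3) \<psi> ?A = tensor_null R M (free_power R n3)"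
    using tensor_map_coset[OF module_axioms free_module_module free_module_module \<psi>, of u]
      subgroup.rcos_const[OF tensor_null_subgroup[OF module_axioms free_module_module] group_free_Abelian_group]
    by simp
  moreover have "?A \<in> carrier (tensor_module R M (free_power R n2))"
    unfolding tensor_module_def using u by (auto simp: RCOSETS_def free_carrier)
  ultimately obtain B where B: "B \<in> carrier (tensor_module R M (free_power R n1))"
    "?A = tensor_map R M (free_power R n2) \<phi> B" using ex by blast
  then obtain u' where u': "Poly_Mapping.keys u' \<subseteq> carrier M \<times> ({..<n1} \<rightarrow>\<^sub>E carrier R)"
    "B = tensor_null R M (free_power R n1) #>\<^bsub>tensor_pre M (free_power R n1)\<^esub> u'"
    unfolding tensor_module_def by (auto simp: RCOSETS_def free_carrier)
  let ?w = "frag_extend (\<lambda>(x, y). frag_of (x, \<phi> y)) u'"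
  have "?A = tensor_null R M (free_power R n2) #>\<^bsub>tensor_pre M (free_power R n2)\<^esub> ?w"
    using B(2) u'(2) tensor_map_coset[OF module_axioms free_module_module free_module_module \<phi>, of u'] by simp
  moreover have "0 + u \<in> ?A" unfolding rcoset_free_Abelian using tensor_null_zero by blast
  ultimately obtain z where z: "z \<in> tensor_null R M (free_power R n2)" "u = z + ?w"
    unfolding rcoset_free_Abelian by auto
  have zero: "t2 z = \<zero>\<^bsub>power_module M n2\<^esub>" by (rule T2.eval_null[OF z(1)])
  have "z = u - ?w" using z by simp
  then have "t2 u \<ominus>\<^bsub>power_module M n2\<^esub> t2 ?w = \<zero>\<^bsub>power_module M n2\<^esub>"
    using zero T2.eval_diff[OF u(1), of ?w] nat1[OF u'(1)] by simp
  then have "t2 u = t2 ?w"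
    using T2.P.minus_add_cancel[of "t2 u" "t2 ?w"] T2.eval_closed[OF u(1)] T2.eval_closed[of ?w] nat1[OF u'(1)]
    by (metis T2.P.M.l_zero power_module_simps(1))
  then show "\<exists>w\<in>carrier (power_module M n1). induced_map R M n1 n2 \<phi> w = v"
    using nat1[OF u'(1)] u T1.eval_closed[OF u'(1)] by (intro bexI[of _ "t1 u'"]) auto
qed

text \<open>Tor in degree i + 1 is homology at F_(i+1), where \<open>d (Suc i)\<close> comes in and
  \<open>d i\<close> goes out. This offset by one persists in all later indices.\<close>

lemma Tor_zero_imp_exact:
  assumes M: "module R M" and fr: "free_resolution R N (fst (chosen_resolution R N)) (snd (chosen_resolution R N)) \<epsilon>"
    and zero: "zero_module (Tor R (Suc i) M N)"
  defines "b \<equiv> fst (chosen_resolution R N)" and "d \<equiv> snd (chosen_resolution R N)"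
  shows "exact_at R M (b (Suc (Suc i))) (b (Suc i)) (b i) (d (Suc i)) (d i)"
proof -
  interpret M: plain_module R M by (simp add: plain_module_def M)
  have hom: "d j \<in> module_hom R (free_power R (b (Suc j))) (free_power R (b j))" for j
    using fr by (simp add: free_resolution_def Let_def b_def d_def)
  let ?T = "\<lambda>n. tensor_module R M (free_power R n)" and ?K = "\<lambda>n. tensor_null R M (free_power R n)"
  show ?thesis
  proof (rule M.exact_at_tensor[OF hom hom])
    fix A assume A: "A \<in> carrier (?T (b (Suc i)))"
      and ker: "tensor_map R M (free_power R (b i)) (d i) A = ?K (b i)"
    let ?B = "tor_boundaries R M N (Suc i)" and ?C = "tor_complex R M N (Suc i)"
    have B: "?B = tensor_map R M (free_power R (b (Suc i))) (d (Suc i)) ` carrier (?T (b (Suc (Suc i))))"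
      by (simp add: tor_boundaries_def tor_diff_def tor_complex_def b_def d_def)
    have zz: "(\<lambda>z. z + 0) ` H = H" for H :: "('c \<times> (nat \<Rightarrow> 'a) \<Rightarrow>\<^sub>0 int) set" by simp
    have null_in: "?K n \<in> carrier (?T n)" for n
      unfolding tensor_module_def RCOSETS_def rcoset_free_Abelian by (auto intro!: bexI[of _ 0])
    have map0: "tensor_map R M (free_power R (b (Suc i))) (d (Suc i)) (?K (b (Suc (Suc i)))) = ?K (b (Suc i))"
      using tensor_map_coset[OF M M.free_module_module M.free_module_module hom[of "Suc i"], of 0]
      by (simp add: rcoset_free_Abelian)
    have KB: "?K (b (Suc i)) \<in> ?B" unfolding B using map0 null_in by (metis imageI)
    have "A \<in> tor_cycles R M N (Suc i)"
      using A ker by (simp add: tor_cycles_def module_kernel_def tor_complex_def tor_diff_def b_def d_def tensor_module_def)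
    \<comment> \<open>Vanishing of Tor makes the coset of A equal to the set of boundaries. The zero
      class lies among the boundaries, so its sum with A, which is A, does too.\<close>
    then have "?B +>\<^bsub>?C\<lparr>carrier := tor_cycles R M N (Suc i)\<rparr>\<^esub> A = ?B"
      using zero unfolding zero_module_def Tor_def quotient_module_def by (auto simp: A_RCOSETS_def RCOSETS_def a_r_coset_def)
    then have "(\<lambda>h. h <#>\<^bsub>tensor_pre M (free_power R (b (Suc i)))\<^esub> A) ` ?B = ?B"
      by (auto simp: a_r_coset_def r_coset_def tor_complex_def tensor_module_def b_def)
    then have "?K (b (Suc i)) <#>\<^bsub>tensor_pre M (free_power R (b (Suc i)))\<^esub> A \<in> ?B" using KB by blast
    moreover have "?K (b (Suc i)) <#>\<^bsub>tensor_pre M (free_power R (b (Suc i)))\<^esub> A = A"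
    proof -
      obtain u where u: "A = (\<lambda>z. z + u) ` ?K (b (Suc i))"
        using A by (auto simp: tensor_module_def RCOSETS_def rcoset_free_Abelian)
      have "(z + (z' + u)) \<in> A" if "z \<in> ?K (b (Suc i))" "z' \<in> ?K (b (Suc i))" for z z'
        unfolding u using tensor_null_add[OF that] by (metis add.assoc imageI)
      moreover have "z + u = 0 + (z + u)" for z by simp
      ultimately show ?thesis unfolding set_mult_def
        using u tensor_null_zero[of R M "free_power R (b (Suc i))"] by auto
    qed
    ultimately show "A \<in> tensor_map R M (free_power R (b (Suc i))) (d (Suc i)) ` carrier (?T (b (Suc (Suc i))))"
      using B by simp
  qed
qed

section \<open>Comparison of resolutions\<close>

locale resolution = N: plain_module R N
  for R :: "('a, 'r) ring_scheme" (structure) and N :: "('a, 'n) module" +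
  fixes b :: "nat \<Rightarrow> nat" and d :: "nat \<Rightarrow> (nat \<Rightarrow> 'a) \<Rightarrow> (nat \<Rightarrow> 'a)" and \<epsilon> :: "(nat \<Rightarrow> 'a) \<Rightarrow> 'n"
  assumes resolution: "free_resolution R N b d \<epsilon>"
begin

abbreviation "Fr n \<equiv> free_power R (b n)"

lemma
  shows aug_hom: "\<epsilon> \<in> module_hom R (Fr 0) N"
    and diff_hom: "d i \<in> module_hom R (Fr (Suc i)) (Fr i)"
    and aug_surj: "\<epsilon> ` carrier (Fr 0) = carrier N"
    and image_diff_0: "d 0 ` carrier (Fr (Suc 0)) = module_kernel (Fr 0) N \<epsilon>"
    and image_diff_Suc: "d (Suc i) ` carrier (Fr (Suc (Suc i))) = module_kernel (Fr (Suc i)) (Fr i) (d i)"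
  using resolution by (simp_all add: free_resolution_def Let_def)

sublocale Fr: plain_module R "free_power R (b n)" for n
  by (simp add: plain_module_def N.free_module_module)

sublocale aug: module_homomorphism R "free_power R (b 0)" N \<epsilon>
  by (intro module_homI Fr.module_axioms N.module_axioms aug_hom)

sublocale diff: module_homomorphism R "free_power R (b (Suc n))" "free_power R (b n)" "d n" for n
  by (intro module_homI Fr.module_axioms diff_hom)

lemma aug_diff [simp]: "y \<in> carrier (Fr (Suc 0)) \<Longrightarrow> \<epsilon> (d 0 y) = \<zero>\<^bsub>N\<^esub>"
  using image_diff_0 by (auto simp: module_kernel_def)

lemma diff_diff [simp]: "y \<in> carrier (Fr (Suc (Suc i))) \<Longrightarrow> d i (d (Suc i) y) = \<zero>\<^bsub>Fr i\<^esub>"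
  using image_diff_Suc[of i] by (auto simp: module_kernel_def)

lemma aug_eq_zeroD: "y \<in> carrier (Fr 0) \<Longrightarrow> \<epsilon> y = \<zero>\<^bsub>N\<^esub> \<Longrightarrow> y \<in> d 0 ` carrier (Fr (Suc 0))"
  unfolding image_diff_0 by (simp add: module_kernel_def)

lemma diff_eq_zeroD:
  "y \<in> carrier (Fr (Suc i)) \<Longrightarrow> d i y = \<zero>\<^bsub>Fr i\<^esub> \<Longrightarrow> y \<in> d (Suc i) ` carrier (Fr (Suc (Suc i)))"
  unfolding image_diff_Suc by (simp add: module_kernel_def)

end

locale two_resolutions = A: resolution R N b d \<epsilon> + B: resolution R N b' d' \<epsilon>'
  for R :: "('a, 'r) ring_scheme" (structure) and N :: "('a, 'n) module" and b d \<epsilon> b' d' \<epsilon>'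
begin

text \<open>The comparison theorem: each component is obtained by lifting the preceding one through
  a differential with free source.\<close>

lemma chain_map_exists:
  obtains f where "\<And>i. f i \<in> module_hom R (B.Fr i) (A.Fr i)"
    "\<And>y. y \<in> carrier (B.Fr 0) \<Longrightarrow> \<epsilon> (f 0 y) = \<epsilon>' y"
    "\<And>i y. y \<in> carrier (B.Fr (Suc i)) \<Longrightarrow> d i (f (Suc i) y) = f i (d' i y)"
proof -
  \<comment> \<open>Besides linearity, P records that f after \<open>d' i\<close> lands in the image
    of \<open>d i\<close>, exactly what the lifting of the next component requires; Q is the
    commuting square between consecutive components.\<close>
  define P where "P i f \<longleftrightarrow> f \<in> module_hom R (B.Fr i) (A.Fr i) \<and>
    (\<forall>y\<in>carrier (B.Fr (Suc i)). f (d' i y) \<in> d i ` carrier (A.Fr (Suc i))) \<and>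
    (i = 0 \<longrightarrow> (\<forall>y\<in>carrier (B.Fr 0). \<epsilon> (f y) = \<epsilon>' y))" for i f
  define Q where "Q i f g \<longleftrightarrow> (\<forall>y\<in>carrier (B.Fr (Suc i)). d i (g y) = f (d' i y))" for i f g
  have base: "\<exists>f. P 0 f"
  proof -
    have "\<epsilon>' ` carrier (B.Fr 0) \<subseteq> \<epsilon> ` carrier (A.Fr 0)" by (simp add: A.aug_surj B.aug_surj)
    from A.N.free_lift[OF B.aug_hom A.aug_hom this] obtain f where
      f: "f \<in> module_hom R (B.Fr 0) (A.Fr 0)" "\<And>y. y \<in> carrier (B.Fr 0) \<Longrightarrow> \<epsilon> (f y) = \<epsilon>' y" by blast
    interpret f: module_homomorphism R "free_power R (b' 0)" "free_power R (b 0)" f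
      by (intro module_homI B.Fr.module_axioms A.Fr.module_axioms f(1))
    have "f (d' 0 y) \<in> d 0 ` carrier (A.Fr (Suc 0))" if "y \<in> carrier (B.Fr (Suc 0))" for y
      by (rule A.aug_eq_zeroD) (use that f(2) in simp_all)
    then show ?thesis using f unfolding P_def by blast
  qed
  have step: "\<exists>g. P (Suc i) g \<and> Q i f g" if P: "P i f" for i f
  proof -
    have f: "f \<in> module_hom R (B.Fr i) (A.Fr i)" using P by (simp add: P_def)
    interpret f: module_homomorphism R "free_power R (b' i)" "free_power R (b i)" f
      by (intro module_homI B.Fr.module_axioms A.Fr.module_axioms f)
    have "(\<lambda>y. f (d' i y)) ` carrier (B.Fr (Suc i)) \<subseteq> d i ` carrier (A.Fr (Suc i))"
      using P unfolding P_def by (intro image_subsetI) blast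
    from A.Fr.free_lift[OF module_hom_comp[OF B.diff_hom f] A.diff_hom this] obtain g where
      g: "g \<in> module_hom R (B.Fr (Suc i)) (A.Fr (Suc i))"
      "\<And>y. y \<in> carrier (B.Fr (Suc i)) \<Longrightarrow> d i (g y) = f (d' i y)" by blast
    interpret g: module_homomorphism R "free_power R (b' (Suc i))" "free_power R (b (Suc i))" g
      by (intro module_homI B.Fr.module_axioms A.Fr.module_axioms g(1))
    have "g (d' (Suc i) y) \<in> d (Suc i) ` carrier (A.Fr (Suc (Suc i)))" if "y \<in> carrier (B.Fr (Suc (Suc i)))" for y
      by (rule A.diff_eq_zeroD) (use that g(2) in simp_all)
    then show ?thesis using g unfolding P_def Q_def by blast
  qed
  from dependent_nat_choice[of P Q, OF base step] obtain f where f: "\<And>i. P i (f i)" "\<And>i. Q i (f i) (f (Suc i))"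
    by blast
  show thesis
  proof (rule that)
    show "f i \<in> module_hom R (B.Fr i) (A.Fr i)" for i using f(1)[of i] by (simp add: P_def)
    show "\<epsilon> (f 0 y) = \<epsilon>' y" if "y \<in> carrier (B.Fr 0)" for y using f(1)[of 0] that by (simp add: P_def)
    show "d i (f (Suc i) y) = f i (d' i y)" if "y \<in> carrier (B.Fr (Suc i))" for i y
      using f(2)[of i] that by (simp add: Q_def)
  qed
qed

end

text \<open>A chain endomorphism over the identity of N is homotopic to the identity. The two
  components around degree n + 1 are exported; the induction carries only d h d = (k - id) d, which
  is the part of the homotopy identity that makes the next lift possible.\<close>

lemma (in resolution) homotopy_exists:
  fixes n :: nat
  assumes k: "\<And>i. k i \<in> module_hom R (Fr i) (Fr i)"
    and k0: "\<And>y. y \<in> carrier (Fr 0) \<Longrightarrow> \<epsilon> (k 0 y) = \<epsilon> y"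
    and kd: "\<And>i y. y \<in> carrier (Fr (Suc i)) \<Longrightarrow> d i (k (Suc i) y) = k i (d i y)"
  shows "\<exists>h\<in>module_hom R (Fr n) (Fr (Suc n)). \<exists>h'\<in>module_hom R (Fr (Suc n)) (Fr (Suc (Suc n))).
    \<forall>y\<in>carrier (Fr (Suc n)). k (Suc n) y = y \<oplus>\<^bsub>Fr (Suc n)\<^esub> (d (Suc n) (h' y) \<oplus>\<^bsub>Fr (Suc n)\<^esub> h (d n y))"
proof -
  interpret k: module_homomorphism R "free_power R (b i)" "free_power R (b i)" "k i" for i
    by (intro module_homI Fr.module_axioms k)
  have idh: "(\<lambda>y. y) \<in> module_hom R (Fr i) (Fr i)" for i by (simp add: module_hom_def)
  have e: "(\<lambda>y. k i y \<ominus>\<^bsub>Fr i\<^esub> y) \<in> module_hom R (Fr i) (Fr i)" for i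
    by (rule Fr.free_hom_minus[OF k idh])
  have step: "\<exists>h'\<in>module_hom R (Fr (Suc i)) (Fr (Suc (Suc i))). \<forall>y\<in>carrier (Fr (Suc i)).
      d (Suc i) (h' y) = (k (Suc i) y \<ominus>\<^bsub>Fr (Suc i)\<^esub> y) \<ominus>\<^bsub>Fr (Suc i)\<^esub> h (d i y)"
    if h: "h \<in> module_hom R (Fr i) (Fr (Suc i))"
      and hd: "\<And>y. y \<in> carrier (Fr (Suc i)) \<Longrightarrow> d i (h (d i y)) = k i (d i y) \<ominus>\<^bsub>Fr i\<^esub> d i y" for i h
  proof -
    interpret h: module_homomorphism R "free_power R (b i)" "free_power R (b (Suc i))" h
      by (intro module_homI Fr.module_axioms h)
    have hom: "(\<lambda>y. (k (Suc i) y \<ominus>\<^bsub>Fr (Suc i)\<^esub> y) \<ominus>\<^bsub>Fr (Suc i)\<^esub> h (d i y)) \<in> module_hom R (Fr (Suc i)) (Fr (Suc i))"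
      by (rule Fr.free_hom_minus[OF e module_hom_comp[OF diff_hom h]])
    have "(\<lambda>y. (k (Suc i) y \<ominus>\<^bsub>Fr (Suc i)\<^esub> y) \<ominus>\<^bsub>Fr (Suc i)\<^esub> h (d i y)) ` carrier (Fr (Suc i)) \<subseteq>
        d (Suc i) ` carrier (Fr (Suc (Suc i)))"
    proof (intro image_subsetI diff_eq_zeroD)
      fix y assume y: "y \<in> carrier (Fr (Suc i))"
      then have dy: "d i y \<in> carrier (Fr i)" by simp
      have c: "k i (d i y) \<ominus>\<^bsub>Fr i\<^esub> d i y \<in> carrier (Fr i)" using dy by simp
      show "(k (Suc i) y \<ominus>\<^bsub>Fr (Suc i)\<^esub> y) \<ominus>\<^bsub>Fr (Suc i)\<^esub> h (d i y) \<in> carrier (Fr (Suc i))"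
        using y dy by simp
      show "d i ((k (Suc i) y \<ominus>\<^bsub>Fr (Suc i)\<^esub> y) \<ominus>\<^bsub>Fr (Suc i)\<^esub> h (d i y)) = \<zero>\<^bsub>Fr i\<^esub>"
        using y dy hd[OF y] kd[OF y] c Fr.M.r_neg[OF c] by (simp add: Fr.M.minus_eq)
    qed
    from Fr.free_lift[OF hom diff_hom this] obtain h' where
      "h' \<in> module_hom R (Fr (Suc i)) (Fr (Suc (Suc i)))"
      "\<And>y. y \<in> carrier (Fr (Suc i)) \<Longrightarrow>
        d (Suc i) (h' y) = (k (Suc i) y \<ominus>\<^bsub>Fr (Suc i)\<^esub> y) \<ominus>\<^bsub>Fr (Suc i)\<^esub> h (d i y)" by blast
    then show ?thesis by (intro bexI[of _ h'] ballI)
  qed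
  have "\<exists>h\<in>module_hom R (Fr i) (Fr (Suc i)). \<forall>y\<in>carrier (Fr (Suc i)). d i (h (d i y)) = k i (d i y) \<ominus>\<^bsub>Fr i\<^esub> d i y" for i
  proof (induction i)
    case 0
    have "(\<lambda>y. k 0 y \<ominus>\<^bsub>Fr 0\<^esub> y) ` carrier (Fr 0) \<subseteq> d 0 ` carrier (Fr (Suc 0))"
    proof (intro image_subsetI aug_eq_zeroD)
      fix y assume y: "y \<in> carrier (Fr 0)"
      show "k 0 y \<ominus>\<^bsub>Fr 0\<^esub> y \<in> carrier (Fr 0)" using y by simp
      show "\<epsilon> (k 0 y \<ominus>\<^bsub>Fr 0\<^esub> y) = \<zero>\<^bsub>N\<^esub>" using y k0[OF y] by (simp add: N.M.minus_eq N.M.r_neg)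
    qed
    from Fr.free_lift[OF e diff_hom this] obtain h where
      "h \<in> module_hom R (Fr 0) (Fr (Suc 0))" "\<And>y. y \<in> carrier (Fr 0) \<Longrightarrow> d 0 (h y) = k 0 y \<ominus>\<^bsub>Fr 0\<^esub> y" by blast
    then show ?case by (intro bexI[of _ h]) simp_all
  next
    case (Suc i)
    then obtain h where h: "h \<in> module_hom R (Fr i) (Fr (Suc i))"
      "\<And>y. y \<in> carrier (Fr (Suc i)) \<Longrightarrow> d i (h (d i y)) = k i (d i y) \<ominus>\<^bsub>Fr i\<^esub> d i y" by blast
    interpret h: module_homomorphism R "free_power R (b i)" "free_power R (b (Suc i))" h
      by (intro module_homI Fr.module_axioms h)
    from step[OF h] obtain h' where h': "h' \<in> module_hom R (Fr (Suc i)) (Fr (Suc (Suc i)))"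
      "\<And>y. y \<in> carrier (Fr (Suc i)) \<Longrightarrow>
        d (Suc i) (h' y) = (k (Suc i) y \<ominus>\<^bsub>Fr (Suc i)\<^esub> y) \<ominus>\<^bsub>Fr (Suc i)\<^esub> h (d i y)" by blast
    have "d (Suc i) (h' (d (Suc i) y)) = k (Suc i) (d (Suc i) y) \<ominus>\<^bsub>Fr (Suc i)\<^esub> d (Suc i) y"
      if "y \<in> carrier (Fr (Suc (Suc i)))" for y
      using that h'(2)[of "d (Suc i) y"] by (simp add: Fr.M.minus_eq)
    then show ?case using h'(1) by blast
  qed
  from this[of n] obtain h where h: "h \<in> module_hom R (Fr n) (Fr (Suc n))"
    "\<And>y. y \<in> carrier (Fr (Suc n)) \<Longrightarrow> d n (h (d n y)) = k n (d n y) \<ominus>\<^bsub>Fr n\<^esub> d n y" by blast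
  interpret h: module_homomorphism R "free_power R (b n)" "free_power R (b (Suc n))" h
    by (intro module_homI Fr.module_axioms h)
  from step[OF h] obtain h' where h': "h' \<in> module_hom R (Fr (Suc n)) (Fr (Suc (Suc n)))"
    "\<And>y. y \<in> carrier (Fr (Suc n)) \<Longrightarrow>
      d (Suc n) (h' y) = (k (Suc n) y \<ominus>\<^bsub>Fr (Suc n)\<^esub> y) \<ominus>\<^bsub>Fr (Suc n)\<^esub> h (d n y)" by blast
  show ?thesis
  proof (rule bexI[OF _ h(1)], rule bexI[OF _ h'(1)], rule ballI)
    fix y assume y: "y \<in> carrier (Fr (Suc n))"
    then have c: "k (Suc n) y \<in> carrier (Fr (Suc n))" "h (d n y) \<in> carrier (Fr (Suc n))" by simp_all
    have "d (Suc n) (h' y) \<oplus>\<^bsub>Fr (Suc n)\<^esub> h (d n y) = k (Suc n) y \<ominus>\<^bsub>Fr (Suc n)\<^esub> y"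
      unfolding h'(2)[OF y] by (rule Fr.minus_add_cancel) (use c y in simp_all)
    then show "k (Suc n) y = y \<oplus>\<^bsub>Fr (Suc n)\<^esub> (d (Suc n) (h' y) \<oplus>\<^bsub>Fr (Suc n)\<^esub> h (d n y))"
      using c y Fr.minus_add_cancel[OF c(1) y] by (simp add: Fr.M.a_comm)
  qed
qed

text \<open>With chain maps f and g over the identity of N, g f = id + d' h' + h d'. For a cycle z
  the cycle f z is a boundary d w, so d'(g w) = g f z = z + d'(h' z), and z is the boundary of g w -
  h' z.\<close>

lemma (in two_resolutions) exact_at_transfer:
  assumes M: "module R M" and ex: "exact_at R M (b (Suc (Suc i))) (b (Suc i)) (b i) (d (Suc i)) (d i)"
  shows "exact_at R M (b' (Suc (Suc i))) (b' (Suc i)) (b' i) (d' (Suc i)) (d' i)"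
proof -
  interpret M: plain_module R M by (simp add: plain_module_def M)
  interpret BA: two_resolutions R N b' d' \<epsilon>' b d \<epsilon> by unfold_locales
  obtain f where f: "\<And>i. f i \<in> module_hom R (B.Fr i) (A.Fr i)"
    "\<And>y. y \<in> carrier (B.Fr 0) \<Longrightarrow> \<epsilon> (f 0 y) = \<epsilon>' y"
    "\<And>i y. y \<in> carrier (B.Fr (Suc i)) \<Longrightarrow> d i (f (Suc i) y) = f i (d' i y)"
    using chain_map_exists by blast
  obtain g where g: "\<And>i. g i \<in> module_hom R (A.Fr i) (B.Fr i)"
    "\<And>y. y \<in> carrier (A.Fr 0) \<Longrightarrow> \<epsilon>' (g 0 y) = \<epsilon> y"
    "\<And>i y. y \<in> carrier (A.Fr (Suc i)) \<Longrightarrow> d' i (g (Suc i) y) = g i (d i y)"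
    using BA.chain_map_exists by blast
  interpret f: module_homomorphism R "free_power R (b' j)" "free_power R (b j)" "f j" for j
    by (intro module_homI B.Fr.module_axioms A.Fr.module_axioms f)
  interpret g: module_homomorphism R "free_power R (b j)" "free_power R (b' j)" "g j" for j
    by (intro module_homI B.Fr.module_axioms A.Fr.module_axioms g)
  have k1: "(\<lambda>y. g i (f i y)) \<in> module_hom R (B.Fr i) (B.Fr i)" for i
    by (rule module_hom_comp[OF f(1) g(1)])
  have k2: "\<epsilon>' (g 0 (f 0 y)) = \<epsilon>' y" if "y \<in> carrier (B.Fr 0)" for y
    using that f(2) g(2) f.closed by simp
  have k3: "d' i (g (Suc i) (f (Suc i) y)) = g i (f i (d' i y))" if "y \<in> carrier (B.Fr (Suc i))" for i y
    using that f(3) g(3) f.closed by simp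
  obtain h h' where h: "h \<in> module_hom R (B.Fr i) (B.Fr (Suc i))"
      "h' \<in> module_hom R (B.Fr (Suc i)) (B.Fr (Suc (Suc i)))"
    and k: "\<And>y. y \<in> carrier (B.Fr (Suc i)) \<Longrightarrow> g (Suc i) (f (Suc i) y) =
      y \<oplus>\<^bsub>B.Fr (Suc i)\<^esub> (d' (Suc i) (h' y) \<oplus>\<^bsub>B.Fr (Suc i)\<^esub> h (d' i y))"
    using B.homotopy_exists[of "\<lambda>i y. g i (f i y)" i, OF k1 k2 k3] by blast
  let ?I = "induced_map R M"
  have idh: "(\<lambda>y. y) \<in> module_hom R (B.Fr (Suc i)) (B.Fr (Suc i))" by (simp add: module_hom_def)
  note hd = module_hom_comp[OF B.diff_hom[of i] h(1)] and dh = module_hom_comp[OF h(2) B.diff_hom[of "Suc i"]]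
  show ?thesis unfolding exact_at_def
  proof (intro ballI impI)
    fix z assume "z \<in> carrier (power_module M (b' (Suc i)))"
      and dz: "?I (b' (Suc i)) (b' i) (d' i) z = \<zero>\<^bsub>power_module M (b' i)\<^esub>"
    then have z: "z \<in> {..<b' (Suc i)} \<rightarrow>\<^sub>E carrier M" by simp
    interpret P: plain_module R "power_module M n" for n by (rule M.power_plain_module)
    interpret If: module_homomorphism R "power_module M (b' j)" "power_module M (b j)" "?I (b' j) (b j) (f j)" for j
      by (intro module_homI M.power_module_module M.induced_map_hom f)
    interpret Ig: module_homomorphism R "power_module M (b j)" "power_module M (b' j)" "?I (b j) (b' j) (g j)" for j
      by (intro module_homI M.power_module_module M.induced_map_hom g)
    interpret Id': module_homomorphism R "power_module M (b' (Suc j))" "power_module M (b' j)" "?I (b' (Suc j)) (b' j) (d' j)" for j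
      by (intro module_homI M.power_module_module M.induced_map_hom B.diff_hom)
    interpret Ih: module_homomorphism R "power_module M (b' i)" "power_module M (b' (Suc i))" "?I (b' i) (b' (Suc i)) h"
      by (intro module_homI M.power_module_module M.induced_map_hom h)
    interpret Ih': module_homomorphism R "power_module M (b' (Suc i))" "power_module M (b' (Suc (Suc i)))"
        "?I (b' (Suc i)) (b' (Suc (Suc i))) h'"
      by (intro module_homI M.power_module_module M.induced_map_hom h)
    let ?fz = "?I (b' (Suc i)) (b (Suc i)) (f (Suc i)) z"
    have fz: "?fz \<in> carrier (power_module M (b (Suc i)))" using If.closed z by simp
    have "?I (b (Suc i)) (b i) (d i) ?fz = ?I (b' (Suc i)) (b i) (\<lambda>y. d i (f (Suc i) y)) z"
      by (rule M.induced_map_comp[OF f(1) A.diff_hom z])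
    also have "\<dots> = ?I (b' (Suc i)) (b i) (\<lambda>y. f i (d' i y)) z"
      by (rule M.induced_map_cong) (simp add: f(3) M.free_carrier)
    also have "\<dots> = ?I (b' i) (b i) (f i) (?I (b' (Suc i)) (b' i) (d' i) z)"
      by (rule M.induced_map_comp[OF B.diff_hom f(1) z, symmetric])
    also have "\<dots> = \<zero>\<^bsub>power_module M (b i)\<^esub>" unfolding dz by (rule If.zero)
    finally obtain w where w: "w \<in> carrier (power_module M (b (Suc (Suc i))))"
      "?I (b (Suc (Suc i))) (b (Suc i)) (d (Suc i)) w = ?fz"
      using ex fz unfolding exact_at_def by blast
    let ?gw = "?I (b (Suc (Suc i))) (b' (Suc (Suc i))) (g (Suc (Suc i))) w"
    let ?hz = "?I (b' (Suc i)) (b' (Suc (Suc i))) h' z"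
    have gw: "?gw \<in> carrier (power_module M (b' (Suc (Suc i))))" using Ig.closed w(1) by simp
    have hz: "?hz \<in> carrier (power_module M (b' (Suc (Suc i))))" using Ih'.closed z by simp
    have w1: "w \<in> {..<b (Suc (Suc i))} \<rightarrow>\<^sub>E carrier M" using w(1) by simp
    have "?I (b (Suc i)) (b' (Suc i)) (g (Suc i)) ?fz = ?I (b (Suc (Suc i))) (b' (Suc i)) (\<lambda>y. g (Suc i) (d (Suc i) y)) w"
      unfolding w(2)[symmetric] by (rule M.induced_map_comp[OF A.diff_hom g(1) w1])
    also have "\<dots> = ?I (b (Suc (Suc i))) (b' (Suc i)) (\<lambda>y. d' (Suc i) (g (Suc (Suc i)) y)) w"
      by (rule M.induced_map_cong) (simp add: g(3) M.free_carrier)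
    also have "\<dots> = ?I (b' (Suc (Suc i))) (b' (Suc i)) (d' (Suc i)) ?gw"
      by (rule M.induced_map_comp[OF g(1) B.diff_hom w1, symmetric])
    finally have 1: "?I (b (Suc i)) (b' (Suc i)) (g (Suc i)) ?fz = ?I (b' (Suc (Suc i))) (b' (Suc i)) (d' (Suc i)) ?gw" .
    have "?I (b (Suc i)) (b' (Suc i)) (g (Suc i)) ?fz = ?I (b' (Suc i)) (b' (Suc i)) (\<lambda>y. g (Suc i) (f (Suc i) y)) z"
      by (rule M.induced_map_comp[OF f(1) g(1) z])
    also have "\<dots> = ?I (b' (Suc i)) (b' (Suc i)) (\<lambda>y. y \<oplus>\<^bsub>B.Fr (Suc i)\<^esub> (d' (Suc i) (h' y) \<oplus>\<^bsub>B.Fr (Suc i)\<^esub> h (d' i y))) z"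
      by (rule M.induced_map_cong) (simp add: k M.free_carrier)
    also have "\<dots> = ?I (b' (Suc i)) (b' (Suc i)) (\<lambda>y. y) z \<oplus>\<^bsub>power_module M (b' (Suc i))\<^esub>
        (?I (b' (Suc i)) (b' (Suc i)) (\<lambda>y. d' (Suc i) (h' y)) z \<oplus>\<^bsub>power_module M (b' (Suc i))\<^esub>
         ?I (b' (Suc i)) (b' (Suc i)) (\<lambda>y. h (d' i y)) z)"
      using M.induced_map_add[OF idh B.Fr.free_hom_add[OF dh hd] z] M.induced_map_add[OF dh hd z] by simp
    also have "\<dots> = z \<oplus>\<^bsub>power_module M (b' (Suc i))\<^esub> (?I (b' (Suc (Suc i))) (b' (Suc i)) (d' (Suc i)) ?hz
        \<oplus>\<^bsub>power_module M (b' (Suc i))\<^esub> ?I (b' i) (b' (Suc i)) h \<zero>\<^bsub>power_module M (b' i)\<^esub>)"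
      unfolding M.induced_map_id[OF z] M.induced_map_comp[OF h(2) B.diff_hom z, symmetric]
        M.induced_map_comp[OF B.diff_hom h(1) z, symmetric] dz ..
    also have "\<dots> = z \<oplus>\<^bsub>power_module M (b' (Suc i))\<^esub> ?I (b' (Suc (Suc i))) (b' (Suc i)) (d' (Suc i)) ?hz"
      using Id'.closed[OF hz] Ih.zero P.M.r_zero by metis
    finally have 2: "?I (b' (Suc (Suc i))) (b' (Suc i)) (d' (Suc i)) ?gw =
        z \<oplus>\<^bsub>power_module M (b' (Suc i))\<^esub> ?I (b' (Suc (Suc i))) (b' (Suc i)) (d' (Suc i)) ?hz"
      unfolding 1 .
    have zc: "z \<in> carrier (power_module M (b' (Suc i)))" using z by simp
    have "?I (b' (Suc (Suc i))) (b' (Suc i)) (d' (Suc i)) (?gw \<ominus>\<^bsub>power_module M (b' (Suc (Suc i)))\<^esub> ?hz) =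
        ?I (b' (Suc (Suc i))) (b' (Suc i)) (d' (Suc i)) ?gw \<ominus>\<^bsub>power_module M (b' (Suc i))\<^esub>
        ?I (b' (Suc (Suc i))) (b' (Suc i)) (d' (Suc i)) ?hz" by (rule Id'.minus[OF gw hz])
    also have "\<dots> = z" unfolding 2
      using P.add_minus_cancel[OF Id'.closed[OF hz] zc] P.M.a_comm[OF zc Id'.closed[OF hz]] by metis
    finally show "\<exists>w\<in>carrier (power_module M (b' (Suc (Suc i)))). ?I (b' (Suc (Suc i))) (b' (Suc i)) (d' (Suc i)) w = z"
      using P.M.minus_closed[OF gw hz] by blast
  qed
qed

section \<open>Dimension shifting\<close>

text \<open>With coefficients R^\<nu> the complex is a sum of \<nu> copies of the given one, so the
  chosen preimages can be found separately for each coordinate t.\<close>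

lemma (in plain_module) exact_at_free:
  assumes \<phi>: "\<phi> \<in> module_hom R (free_power R n1) (free_power R n2)"
    and \<psi>: "\<psi> \<in> module_hom R (free_power R n2) (free_power R n3)"
    and ex: "\<And>y. y \<in> carrier (free_power R n2) \<Longrightarrow> \<psi> y = \<zero>\<^bsub>free_power R n3\<^esub> \<Longrightarrow> y \<in> \<phi> ` carrier (free_power R n1)"
  shows "exact_at R (free_power R \<nu>) n1 n2 n3 \<phi> \<psi>"
  unfolding exact_at_def
proof (intro ballI impI)
  interpret L: plain_module R "ring_module R" by (rule ring_plain_module)
  interpret G: plain_module R "free_power R \<nu>" by (simp add: plain_module_def free_module_module)
  have pr: "module_homomorphism R (free_power R \<nu>) (ring_module R) (\<lambda>v. v t)" if "t < \<nu>" for t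
    by (intro module_homI G.module_axioms L.module_axioms) (use L.proj_hom[OF that] in \<open>simp add: free_power_eq\<close>)
  fix v assume v: "v \<in> carrier (power_module (free_power R \<nu>) n2)"
    and z: "induced_map R (free_power R \<nu>) n2 n3 \<psi> v = \<zero>\<^bsub>power_module (free_power R \<nu>) n3\<^esub>"
  have vc: "v \<in> {..<n2} \<rightarrow>\<^sub>E carrier (free_power R \<nu>)" using v by simp
  let ?v = "\<lambda>t. \<lambda>i\<in>{..<n2}. v i t"
  have vt: "?v t \<in> {..<n2} \<rightarrow>\<^sub>E carrier R" if "t < \<nu>" for t
    using vc that by (auto simp: free_carrier PiE_iff)
  have "\<exists>x. x \<in> carrier (free_power R n1) \<and> \<phi> x = ?v t" if t: "t < \<nu>" for t
  proof -
    have "\<psi> (?v t) = induced_map R (ring_module R) n2 n3 \<psi> (?v t)" by (rule induced_map_ring[OF \<psi> vt[OF t], symmetric])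
    also have "\<dots> = (\<lambda>i\<in>{..<n3}. induced_map R (free_power R \<nu>) n2 n3 \<psi> v i t)"
      by (rule module_homomorphism.induced_map_natural[OF pr[OF t] \<psi> vc])
    also have "\<dots> = \<zero>\<^bsub>free_power R n3\<^esub>" unfolding z using t by (simp add: free_power_eq fun_eq_iff)
    finally show ?thesis using ex[of "?v t"] vt[OF t] by (auto simp: free_carrier)
  qed
  then have "\<forall>t. \<exists>x. t < \<nu> \<longrightarrow> x \<in> carrier (free_power R n1) \<and> \<phi> x = ?v t" by blast
  from choice[OF this] obtain x where x: "\<And>t. t < \<nu> \<Longrightarrow> x t \<in> carrier (free_power R n1)" "\<And>t. t < \<nu> \<Longrightarrow> \<phi> (x t) = ?v t"
    by blast
  \<comment> \<open>The transpose of the family of preimages: w is indexed first by the rank n1,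
    then by the coordinate of the coefficients.\<close>
  define w where "w = (\<lambda>i\<in>{..<n1}. \<lambda>t\<in>{..<\<nu>}. x t i)"
  have w: "w \<in> {..<n1} \<rightarrow>\<^sub>E carrier (free_power R \<nu>)"
    using x(1) by (auto simp: w_def free_carrier PiE_iff)
  have wt: "(\<lambda>i\<in>{..<n1}. w i t) = x t" if t: "t < \<nu>" for t
    by (rule power_ext[where A = "carrier R" and B = "carrier R"])
      (use w x(1)[OF t] t in \<open>auto simp: free_carrier PiE_iff w_def\<close>)
  interpret I: module_homomorphism R "power_module (free_power R \<nu>) n1" "power_module (free_power R \<nu>) n2"
      "induced_map R (free_power R \<nu>) n1 n2 \<phi>"
    by (intro module_homI G.power_module_module G.induced_map_hom \<phi>)
  have Iw: "induced_map R (free_power R \<nu>) n1 n2 \<phi> w \<in> {..<n2} \<rightarrow>\<^sub>E carrier (free_power R \<nu>)"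
    using I.closed[of w] w by simp
  have "induced_map R (free_power R \<nu>) n1 n2 \<phi> w i t = v i t" if i: "i < n2" and t: "t < \<nu>" for i t
  proof -
    have "(\<lambda>i\<in>{..<n2}. induced_map R (free_power R \<nu>) n1 n2 \<phi> w i t) = induced_map R (ring_module R) n1 n2 \<phi> (\<lambda>i\<in>{..<n1}. w i t)"
      by (rule module_homomorphism.induced_map_natural[OF pr[OF t] \<phi> w, symmetric])
    also have "\<dots> = ?v t" unfolding wt[OF t]
      using induced_map_ring[OF \<phi>] x[OF t] by (simp add: free_carrier)
    finally show ?thesis using i by (metis (no_types, lifting) lessThan_iff restrict_apply)
  qed
  moreover have "induced_map R (free_power R \<nu>) n1 n2 \<phi> w i \<in> {..<\<nu>} \<rightarrow>\<^sub>E carrier R" "v i \<in> {..<\<nu>} \<rightarrow>\<^sub>E carrier R"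
    if "i < n2" for i
    using PiE_mem[OF Iw, of i] PiE_mem[OF vc, of i] that by (simp_all add: free_carrier)
  ultimately have "induced_map R (free_power R \<nu>) n1 n2 \<phi> w = v"
    by (intro power_ext[OF Iw vc]) (rule power_ext)
  then show "\<exists>w\<in>carrier (power_module (free_power R \<nu>) n1). induced_map R (free_power R \<nu>) n1 n2 \<phi> w = v"
    using w by (intro bexI[of _ w]) auto
qed

text \<open>Part of the long exact sequence for 0 -> K -> M -> N -> 0: vanishing for N one degree
  higher and for M in the same degree gives vanishing for K. A cycle z of K is the boundary of some
  w over M; the image of w over N is a cycle, hence the boundary of some u, and subtracting from w
  the boundary of a lift of u moves w into K.\<close>

lemma (in module_homomorphism) exact_at_kernel:
  assumes \<phi>: "\<phi> \<in> module_hom R (free_power R n1) (free_power R n2)"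
    and \<psi>: "\<psi> \<in> module_hom R (free_power R n2) (free_power R n3)"
    and \<chi>: "\<chi> \<in> module_hom R (free_power R n3) (free_power R n4)"
    and \<psi>\<phi>: "\<And>y. y \<in> carrier (free_power R n1) \<Longrightarrow> \<psi> (\<phi> y) = \<zero>\<^bsub>free_power R n3\<^esub>"
    and surj: "h ` carrier M = carrier N"
    and exN: "exact_at R N n1 n2 n3 \<phi> \<psi>" and exM: "exact_at R M n2 n3 n4 \<psi> \<chi>"
  shows "exact_at R (M\<lparr>carrier := module_kernel M N h\<rparr>) n2 n3 n4 \<psi> \<chi>"
proof -
  let ?K = "M\<lparr>carrier := module_kernel M N h\<rparr>"
  have Ksub: "submodule (module_kernel M N h) R M" by (rule kernel_submodule)
  have Kmod: "module R ?K" by (rule submodule.submodule_is_module[OF Ksub M.module_axioms])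
  interpret K: plain_module R ?K by (simp add: plain_module_def Kmod)
  have incl: "module_homomorphism R ?K M (\<lambda>x. x)"
    by (intro module_homI Kmod M.module_axioms) (auto simp: module_hom_def module_kernel_def)
  \<comment> \<open>Naturality for the inclusion of K: maps induced on powers of K are restrictions
    of those on powers of M.\<close>
  have IK: "induced_map R ?K n m \<theta> v = induced_map R M n m \<theta> v"
    if "\<theta> \<in> module_hom R (free_power R n) (free_power R m)" "v \<in> {..<n} \<rightarrow>\<^sub>E module_kernel M N h" for n m \<theta> v
  proof -
    have r: "(\<lambda>i\<in>{..<n}. w i) = w" if "w \<in> {..<n} \<rightarrow>\<^sub>E A" for w :: "nat \<Rightarrow> 'b" and A n
      using that by (auto simp: PiE_iff extensional_def fun_eq_iff)
    have v: "v \<in> {..<n} \<rightarrow>\<^sub>E carrier ?K" using that by simp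
    have "induced_map R ?K n m \<theta> v \<in> {..<m} \<rightarrow>\<^sub>E carrier ?K"
      using K.induced_map_hom[OF that(1)] v unfolding module_hom_def power_module_simps by blast
    then show ?thesis
      using module_homomorphism.induced_map_natural[OF incl that(1) v] r[OF v] r by metis
  qed
  show ?thesis unfolding exact_at_def
  proof (intro ballI impI)
    fix z assume zK: "z \<in> carrier (power_module ?K n3)"
      and cz: "induced_map R ?K n3 n4 \<chi> z = \<zero>\<^bsub>power_module ?K n4\<^esub>"
    have z0: "z \<in> {..<n3} \<rightarrow>\<^sub>E module_kernel M N h" using zK by simp
    have z: "z \<in> carrier (power_module M n3)" using z0 by (auto simp: PiE_iff module_kernel_def)
    have "induced_map R M n3 n4 \<chi> z = \<zero>\<^bsub>power_module M n4\<^esub>"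
      using cz IK[OF \<chi> z0] by simp
    then obtain w where w: "w \<in> carrier (power_module M n2)" "induced_map R M n2 n3 \<psi> w = z"
      using exM z unfolding exact_at_def by blast
    have w': "w \<in> {..<n2} \<rightarrow>\<^sub>E carrier M" using w by simp
    let ?h = "\<lambda>n v. \<lambda>i\<in>{..<n}. h (v i)"
    have hw: "?h n2 w \<in> carrier (power_module N n2)" using w' by (auto simp: PiE_iff)
    have "induced_map R N n2 n3 \<psi> (?h n2 w) = ?h n3 z"
      using induced_map_natural[OF \<psi> w'] w(2) by simp
    also have "\<dots> = \<zero>\<^bsub>power_module N n3\<^esub>" using z0 by (auto simp: PiE_iff module_kernel_def fun_eq_iff)
    finally obtain u where u: "u \<in> carrier (power_module N n1)" "induced_map R N n1 n2 \<phi> u = ?h n2 w"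
      using exN hw unfolding exact_at_def by blast
    have "\<forall>i. \<exists>x. i < n1 \<longrightarrow> x \<in> carrier M \<and> h x = u i"
    proof
      fix i
      have "i < n1 \<Longrightarrow> u i \<in> h ` carrier M" using u(1) surj by (auto simp: PiE_iff)
      then show "\<exists>x. i < n1 \<longrightarrow> x \<in> carrier M \<and> h x = u i" by (metis imageE)
    qed
    from choice[OF this] obtain x where x: "\<And>i. i < n1 \<Longrightarrow> x i \<in> carrier M" "\<And>i. i < n1 \<Longrightarrow> h (x i) = u i" by blast
    let ?x = "\<lambda>i\<in>{..<n1}. x i"
    have xc: "?x \<in> {..<n1} \<rightarrow>\<^sub>E carrier M" using x by auto
    have hx: "?h n1 ?x = u"
      by (rule power_ext[where A = "carrier N" and B = "carrier N"]) (use x u(1) in \<open>auto simp: PiE_iff\<close>)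
    interpret P: plain_module R "power_module M n" for n by (rule M.power_plain_module)
    interpret I\<phi>: module_homomorphism R "power_module M n1" "power_module M n2" "induced_map R M n1 n2 \<phi>"
      by (intro module_homI M.power_module_module M.induced_map_hom \<phi>)
    interpret I\<psi>: module_homomorphism R "power_module M n2" "power_module M n3" "induced_map R M n2 n3 \<psi>"
      by (intro module_homI M.power_module_module M.induced_map_hom \<psi>)
    interpret H: module_homomorphism R "power_module M n2" "power_module N n2" "?h n2"
      by (intro module_homI M.power_module_module N.power_module_module power_map_hom)
    let ?y = "induced_map R M n1 n2 \<phi> ?x"
    have y: "?y \<in> carrier (power_module M n2)" using I\<phi>.closed[of ?x] xc by simp
    have hy: "?h n2 ?y = ?h n2 w" using induced_map_natural[OF \<phi> xc] hx u(2) by simp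
    let ?w = "w \<ominus>\<^bsub>power_module M n2\<^esub> ?y"
    have wc: "?w \<in> carrier (power_module M n2)" by (rule P.M.minus_closed[OF w(1) y])
    have "?h n2 ?w = ?h n2 w \<ominus>\<^bsub>power_module N n2\<^esub> ?h n2 ?y" by (rule H.minus[OF w(1) y])
    also have "\<dots> = \<zero>\<^bsub>power_module N n2\<^esub>" unfolding hy
      using H.N.M.r_neg[OF hw] by (simp only: H.N.M.minus_eq)
    finally have "?h n2 ?w = \<zero>\<^bsub>power_module N n2\<^esub>" .
    then have "h (?w i) = \<zero>\<^bsub>N\<^esub>" if "i < n2" for i
      using that by (metis (no_types, lifting) lessThan_iff power_module_simps(2) restrict_apply)
    then have wK: "?w \<in> {..<n2} \<rightarrow>\<^sub>E module_kernel M N h"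
      using wc unfolding power_module_simps(1) module_kernel_def PiE_iff by blast
    have "induced_map R M n2 n3 \<psi> ?y = induced_map R M n1 n3 (\<lambda>y. \<psi> (\<phi> y)) ?x"
      by (rule M.induced_map_comp[OF \<phi> \<psi> xc])
    also have "\<dots> = \<zero>\<^bsub>power_module M n3\<^esub>"
      by (rule M.induced_map_zero[OF xc]) (use \<psi>\<phi> in \<open>simp add: M.free_carrier\<close>)
    finally have "induced_map R M n2 n3 \<psi> ?w = z \<ominus>\<^bsub>power_module M n3\<^esub> \<zero>\<^bsub>power_module M n3\<^esub>"
      using I\<psi>.minus[OF w(1) y] w(2) by simp
    also have "\<dots> = z" using z by (simp add: P.M.minus_eq del: power_module_simps)
    finally have "induced_map R ?K n2 n3 \<psi> ?w = z" using IK[OF \<psi> wK] by simp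
    then show "\<exists>w\<in>carrier (power_module ?K n2). induced_map R ?K n2 n3 \<psi> w = z"
      using wK by (intro bexI[of _ ?w]) simp_all
  qed
qed

section \<open>Modules over an Artinian local ring\<close>

text \<open>Zorn's lemma, applied twice: with x = \<one> it yields a maximal ideal above a nonunit,
  and for the layers of the ring it yields a complement to a line.\<close>

lemma (in plain_module) maximal_submodule_avoiding:
  assumes B: "submodule B R M" and x: "x \<notin> B"
  obtains H where "submodule H R M" "B \<subseteq> H" "x \<notin> H"
    "\<And>K. submodule K R M \<Longrightarrow> H \<subseteq> K \<Longrightarrow> x \<notin> K \<Longrightarrow> K = H"
proof -
  let ?A = "{H. submodule H R M \<and> B \<subseteq> H \<and> x \<notin> H}"
  have "\<exists>H\<in>?A. \<forall>K\<in>?A. H \<subseteq> K \<longrightarrow> K = H"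
  proof (rule subset_Zorn_nonempty)
    show "?A \<noteq> {}" using B x by blast
    fix C assume ne: "C \<noteq> {}" and ch: "subset.chain ?A C"
    have C: "H \<in> C \<Longrightarrow> submodule H R M \<and> B \<subseteq> H \<and> x \<notin> H" for H
      using ch unfolding subset.chain_def by blast
    have dir: "\<exists>H\<in>C. a \<in> H \<and> c \<in> H" if "a \<in> \<Union>C" "c \<in> \<Union>C" for a c
    proof -
      obtain H where H: "H \<in> C" "a \<in> H" using \<open>a \<in> \<Union>C\<close> by (rule UnionE)
      obtain K where K: "K \<in> C" "c \<in> K" using \<open>c \<in> \<Union>C\<close> by (rule UnionE)
      note HK = H K
      then have "H \<subseteq> K \<or> K \<subseteq> H" using ch unfolding subset.chain_def by blast
      then show ?thesis using HK by blast
    qed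
    have "submodule (\<Union>C) R M"
      unfolding submodule_iff
    proof (intro conjI ballI)
      show "\<Union>C \<subseteq> carrier M"
      proof (rule Union_least)
        fix H assume "H \<in> C"
        then show "H \<subseteq> carrier M" using C[of H] submoduleE(1)[of H] by simp
      qed
      obtain H where "H \<in> C" using ne by blast
      then have "\<zero>\<^bsub>M\<^esub> \<in> H" using C[of H] by (simp add: submodule_iff)
      then show "\<zero>\<^bsub>M\<^esub> \<in> \<Union>C" using \<open>H \<in> C\<close> by blast
      fix a c assume "a \<in> \<Union>C" "c \<in> \<Union>C"
      from dir[OF this] obtain H where H: "H \<in> C" "a \<in> H" "c \<in> H" by blast
      then have "a \<oplus>\<^bsub>M\<^esub> c \<in> H" using C[of H] by (simp add: submodule_iff)
      then show "a \<oplus>\<^bsub>M\<^esub> c \<in> \<Union>C" using H(1) by blast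
    next
      fix r a assume r: "r \<in> carrier R" and "a \<in> \<Union>C"
      from this(2) obtain H where H: "H \<in> C" "a \<in> H" by (rule UnionE)
      then have "r \<odot>\<^bsub>M\<^esub> a \<in> H" using C[of H] r by (simp add: submodule_iff)
      then show "r \<odot>\<^bsub>M\<^esub> a \<in> \<Union>C" using H(1) by blast
    qed
    then show "\<Union>C \<in> ?A" using C ne by blast
  qed
  then obtain H where H: "submodule H R M" "B \<subseteq> H" "x \<notin> H" and "\<forall>K\<in>?A. H \<subseteq> K \<longrightarrow> K = H" by blast
  then have "K = H" if "submodule K R M" "H \<subseteq> K" "x \<notin> K" for K using that by blast
  with H show thesis by (rule that)
qed

definition cyclic :: "('a, 'r) ring_scheme \<Rightarrow> ('a, 'm) module \<Rightarrow> 'm \<Rightarrow> 'm set" where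
  "cyclic R V x = (\<lambda>r. r \<odot>\<^bsub>V\<^esub> x) ` carrier R"

lemma (in plain_module) cyclic_submodule: "x \<in> carrier M \<Longrightarrow> submodule (cyclic R M x) R M"
  unfolding submodule_iff cyclic_def
proof (intro conjI ballI)
  assume x: "x \<in> carrier M"
  show "(\<lambda>r. r \<odot>\<^bsub>M\<^esub> x) ` carrier R \<subseteq> carrier M" using x by auto
  show "\<zero>\<^bsub>M\<^esub> \<in> (\<lambda>r. r \<odot>\<^bsub>M\<^esub> x) ` carrier R" by (rule image_eqI[of _ _ "\<zero>"]) (use x in auto)
  fix a c assume "a \<in> (\<lambda>r. r \<odot>\<^bsub>M\<^esub> x) ` carrier R" "c \<in> (\<lambda>r. r \<odot>\<^bsub>M\<^esub> x) ` carrier R"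
  then obtain r s where "r \<in> carrier R" "s \<in> carrier R" "a = r \<odot>\<^bsub>M\<^esub> x" "c = s \<odot>\<^bsub>M\<^esub> x" by auto
  then show "a \<oplus>\<^bsub>M\<^esub> c \<in> (\<lambda>r. r \<odot>\<^bsub>M\<^esub> x) ` carrier R"
    by (intro image_eqI[of _ _ "r \<oplus> s"]) (use x in \<open>simp_all add: smult_l_distr\<close>)
next
  assume x: "x \<in> carrier M"
  fix t a assume "t \<in> carrier R" "a \<in> (\<lambda>r. r \<odot>\<^bsub>M\<^esub> x) ` carrier R"
  then obtain r where "r \<in> carrier R" "a = r \<odot>\<^bsub>M\<^esub> x" by auto
  then show "t \<odot>\<^bsub>M\<^esub> a \<in> (\<lambda>r. r \<odot>\<^bsub>M\<^esub> x) ` carrier R"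
    by (intro image_eqI[of _ _ "t \<otimes> r"]) (use x \<open>t \<in> carrier R\<close> in \<open>simp_all add: smult_assoc1\<close>)
qed

lemma (in plain_module) cyclic_self: "x \<in> carrier M \<Longrightarrow> x \<in> cyclic R M x"
  unfolding cyclic_def by (rule image_eqI[of _ _ "\<one>"]) auto

lemma (in plain_module) cyclic_least: "submodule H R M \<Longrightarrow> x \<in> H \<Longrightarrow> cyclic R M x \<subseteq> H"
  by (auto simp: cyclic_def submodule_iff)

lemma (in cring) ideal_iff_submodule: "submodule I R (ring_module R) \<longleftrightarrow> ideal I R"
proof -
  interpret L: plain_module R "ring_module R" by (simp add: plain_module_def ring_module_module)
  show ?thesis
  proof
    assume s: "submodule I R (ring_module R)"
    note i = s[unfolded L.submodule_iff, simplified]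
    show "ideal I R"
    proof (rule idealI[OF ring_axioms])
      show "subgroup I (add_monoid R)"
      proof (rule add.subgroupI)
        show "I \<subseteq> carrier R" "I \<noteq> {}" using i by auto
        show "\<ominus> a \<in> I" if "a \<in> I" for a
          using i that l_minus[of \<one> a] by (metis a_inv_closed l_one one_closed subsetD)
        show "a \<oplus> b \<in> I" if "a \<in> I" "b \<in> I" for a b using i that by blast
      qed
      show "x \<otimes> a \<in> I" if "a \<in> I" "x \<in> carrier R" for a x using i that by blast
      then show "a \<otimes> x \<in> I" if "a \<in> I" "x \<in> carrier R" for a x
        using i that m_comm[of a x] by auto
    qed
  next
    assume "ideal I R"
    then interpret ideal I R .
    show "submodule I R (ring_module R)" unfolding L.submodule_iff
      using a_subset I_l_closed by (auto simp: Icarr)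
  qed
qed

lemma (in plain_module) smult_span_assoc:
  assumes I: "I \<subseteq> carrier R" and J: "J \<subseteq> carrier R" and A: "A \<subseteq> carrier M"
  shows "smult_span R M I (smult_span R M J A) \<subseteq> smult_span R M (smult_span R (ring_module R) I J) A"
proof -
  interpret L: plain_module R "ring_module R" by (rule ring_plain_module)
  let ?IJ = "smult_span R (ring_module R) I J"
  have IJ: "?IJ \<subseteq> carrier R" using L.smult_span_submodule[OF I, of J] J by (simp add: L.submodule_iff)
  have s: "submodule (smult_span R M ?IJ A) R M" by (rule smult_span_submodule[OF IJ A])
  show ?thesis
  proof (rule smult_span_least[OF s])
    fix a x assume a: "a \<in> I" and x: "x \<in> smult_span R M J A"
    have ac: "a \<in> carrier R" using a I by auto
    have "smult_span R M J A \<subseteq> {x \<in> carrier M. a \<odot>\<^bsub>M\<^esub> x \<in> smult_span R M ?IJ A}"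
    proof (rule smult_span_least)
      have lc: "a \<odot>\<^bsub>M\<^esub> (r \<odot>\<^bsub>M\<^esub> x) = r \<odot>\<^bsub>M\<^esub> (a \<odot>\<^bsub>M\<^esub> x)" if "r \<in> carrier R" "x \<in> carrier M" for r x
        using that ac by (simp add: smult_assoc1[symmetric] R.m_comm)
      show "submodule {x \<in> carrier M. a \<odot>\<^bsub>M\<^esub> x \<in> smult_span R M ?IJ A} R M"
        unfolding submodule_iff using s[unfolded submodule_iff] ac by (auto simp: smult_r_distr lc)
      fix c y assume c: "c \<in> J" and y: "y \<in> A"
      have cc: "c \<in> carrier R" "y \<in> carrier M" using c y J A by auto
      have "a \<odot>\<^bsub>ring_module R\<^esub> c \<in> ?IJ" by (rule smult_spanI[OF a c])
      then have "(a \<odot>\<^bsub>ring_module R\<^esub> c) \<odot>\<^bsub>M\<^esub> y \<in> smult_span R M ?IJ A" by (rule smult_spanI[OF _ y])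
      then show "c \<odot>\<^bsub>M\<^esub> y \<in> {x \<in> carrier M. a \<odot>\<^bsub>M\<^esub> x \<in> smult_span R M ?IJ A}"
        using cc ac by (simp add: smult_assoc1)
    qed
    then show "a \<odot>\<^bsub>M\<^esub> x \<in> smult_span R M ?IJ A" using x by auto
  qed
qed

lemma ideal_power_0: "ideal_power R I 0 = carrier R"
  by (simp add: ideals_set_def)

lemma ideal_power_Suc: "ideal_power R I (Suc n) = ideal_prod R (ideal_power R I n) I"
  by (simp add: nat_pow_def ideals_set_def)

text \<open>The factors change places because \<open>ideal_power\<close> appends \<mm> on the right,
  whereas scalars stand on the left in \<open>smult_span\<close>.\<close>

lemma (in cring) ideal_prod_eq_smult_span:
  assumes I: "ideal I R" and J: "ideal J R"
  shows "ideal_prod R J I = smult_span R (ring_module R) I J"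
proof
  interpret L: plain_module R "ring_module R" by (simp add: plain_module_def ring_module_module)
  have Ic: "I \<subseteq> carrier R" and Jc: "J \<subseteq> carrier R" using ideal.Icarr[OF I] ideal.Icarr[OF J] by blast+
  have s: "submodule (smult_span R (ring_module R) I J) R (ring_module R)"
    by (rule L.smult_span_submodule) (use Ic Jc in auto)
  show "ideal_prod R J I \<subseteq> smult_span R (ring_module R) I J"
  proof
    fix z assume "z \<in> ideal_prod R J I"
    then show "z \<in> smult_span R (ring_module R) I J"
    proof (induction rule: ideal_prod.induct)
      case (prod j i)
      then have "i \<odot>\<^bsub>ring_module R\<^esub> j \<in> smult_span R (ring_module R) I J" by (intro smult_spanI)
      moreover have "i \<otimes> j = j \<otimes> i" using prod Ic Jc by (intro m_comm) auto
      ultimately show ?case by simp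
    next
      case (sum s1 s2) then show ?case using s[unfolded L.submodule_iff] by auto
    qed
  qed
  show "smult_span R (ring_module R) I J \<subseteq> ideal_prod R J I"
  proof (rule smult_span_least)
    show "submodule (ideal_prod R J I) R (ring_module R)"
      unfolding ideal_iff_submodule by (rule ideal_prod_is_ideal[OF J I])
    fix a x assume "a \<in> I" "x \<in> J"
    moreover have "a \<otimes> x = x \<otimes> a" using \<open>a \<in> I\<close> \<open>x \<in> J\<close> Ic Jc by (intro m_comm) auto
    ultimately show "a \<odot>\<^bsub>ring_module R\<^esub> x \<in> ideal_prod R J I" by (simp add: ideal_prod.prod)
  qed
qed

section \<open>Units, powers of the maximal ideal and its nilpotency\<close>

context artinian_local_ring
begin

abbreviation "\<L> \<equiv> ring_module R"

sublocale L: plain_module R "ring_module R"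
  by (simp add: plain_module_def ring_module_module)

lemma m_ideal: "ideal \<mm> R"
  using maximal by (rule maximalideal.axioms)

lemma m_carrier: "\<mm> \<subseteq> carrier R"
  using ideal.Icarr[OF m_ideal] by blast

lemma m_submodule: "submodule \<mm> R \<L>"
  by (simp add: ideal_iff_submodule m_ideal)

lemma one_notin_m: "\<one> \<notin> \<mm>"
  using maximalideal.I_notcarr[OF maximal] ideal.one_imp_carrier[OF m_ideal] by blast

lemma one_neq_zero: "\<one> \<noteq> \<zero>"
  using one_notin_m m_submodule by (auto simp: L.submodule_iff)

text \<open>If \<one> were not a multiple of a, an ideal containing a and maximal among those
  avoiding \<one> would be a maximal ideal, hence equal to \<mm>, although a lies outside
  \<mm>.\<close>

lemma unit_of_notin_m:
  assumes a: "a \<in> carrier R" "a \<notin> \<mm>"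
  obtains u where "u \<in> carrier R" "u \<otimes> a = \<one>"
proof (rule ccontr)
  assume no: "\<not> thesis"
  have sub: "submodule (cyclic R \<L> a) R \<L>" by (rule L.cyclic_submodule) (use a in simp)
  have "\<one> \<notin> cyclic R \<L> a"
  proof
    assume "\<one> \<in> cyclic R \<L> a"
    then obtain u where "u \<in> carrier R" "\<one> = u \<otimes> a" by (auto simp: cyclic_def)
    then show False using no that by metis
  qed
  from L.maximal_submodule_avoiding[OF sub this] obtain H where
    H: "submodule H R \<L>" "cyclic R \<L> a \<subseteq> H" "\<one> \<notin> H"
    and max: "\<And>K. submodule K R \<L> \<Longrightarrow> H \<subseteq> K \<Longrightarrow> \<one> \<notin> K \<Longrightarrow> K = H" by blast
  have "maximalideal H R"
  proof (rule maximalidealI)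
    show "ideal H R" using H(1) by (simp add: ideal_iff_submodule)
    show "carrier R \<noteq> H" using H(3) one_closed by blast
    fix J assume J: "ideal J R" "H \<subseteq> J" "J \<subseteq> carrier R"
    then show "J = H \<or> J = carrier R"
      using max[of J] ideal.one_imp_carrier[OF J(1)] by (auto simp: ideal_iff_submodule)
  qed
  then have "H = \<mm>" by (rule unique_maximal)
  moreover have "a \<in> H" using H(2) L.cyclic_self[of a] a by auto
  ultimately show False using a by blast
qed

definition mpow :: "nat \<Rightarrow> 'a set" where
  "mpow n = ideal_power R \<mm> n"

lemma mpow_0: "mpow 0 = carrier R"
  by (simp only: mpow_def ideal_power_0)

lemma power_ideal: "ideal (mpow n) R"
proof (induction n)
  case 0 then show ?case unfolding mpow_def ideal_power_0 by (rule oneideal)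
next
  case (Suc n) then show ?case unfolding mpow_def ideal_power_Suc by (intro ideal_prod_is_ideal m_ideal)
qed

lemma power_submodule_ring: "submodule (mpow n) R \<L>"
  by (simp add: ideal_iff_submodule power_ideal)

lemma power_Suc: "mpow (Suc n) = smult_span R \<L> \<mm> (mpow n)"
  using ideal_prod_eq_smult_span[OF m_ideal power_ideal] unfolding mpow_def ideal_power_Suc .

lemma power_decreasing: "mpow (Suc n) \<subseteq> mpow n"
  unfolding power_Suc by (rule L.smult_span_subset[OF m_carrier power_submodule_ring])

lemma power_antimono: "i \<le> j \<Longrightarrow> mpow j \<subseteq> mpow i"
proof (induction rule: dec_induct)
  case (step n) then show ?case using power_decreasing[of n] by blast
qed simp

lemma power_1: "mpow 1 = \<mm>"
proof -
  have "smult_span R \<L> \<mm> (carrier R) = \<mm>"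
  proof
    show "smult_span R \<L> \<mm> (carrier R) \<subseteq> \<mm>"
      by (rule smult_span_least[OF m_submodule]) (simp add: ideal.I_r_closed[OF m_ideal])
    show "\<mm> \<subseteq> smult_span R \<L> \<mm> (carrier R)"
    proof
      fix a assume "a \<in> \<mm>"
      then have "a \<odot>\<^bsub>\<L>\<^esub> \<one> \<in> smult_span R \<L> \<mm> (carrier R)" by (intro smult_spanI) auto
      moreover have "a \<otimes> \<one> = a" using \<open>a \<in> \<mm>\<close> m_carrier by auto
      ultimately show "a \<in> smult_span R \<L> \<mm> (carrier R)" by simp
    qed
  qed
  then show ?thesis using power_Suc[of 0] mpow_0 by simp
qed

lemma descending_wf:
  assumes I: "\<And>n. submodule (I n) R \<L>" and d: "\<And>n. I (Suc n) \<subset> I n"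
  shows False
proof -
  have "\<exists>n. \<forall>k\<ge>n. I k = I n"
    by (rule descending_chain) (use I d in \<open>auto simp: ideal_iff_submodule\<close>)
  then show False using d by (metis less_irrefl lessI less_imp_le psubset_eq)
qed

lemma minimal_ideal_exists:
  assumes P: "P I" "submodule I R \<L>"
  obtains J where "P J" "submodule J R \<L>" "\<And>K. submodule K R \<L> \<Longrightarrow> P K \<Longrightarrow> K \<subseteq> J \<Longrightarrow> K = J"
proof (rule ccontr)
  assume "\<not> thesis"
  then have step: "\<exists>K. (P K \<and> submodule K R \<L>) \<and> K \<subset> J" if "P J \<and> submodule J R \<L>" for J
    using that \<open>\<And>J. P J \<Longrightarrow> submodule J R \<L> \<Longrightarrow> (\<And>K. submodule K R \<L> \<Longrightarrow> P K \<Longrightarrow> K \<subseteq> J \<Longrightarrow> K = J) \<Longrightarrow> thesis\<close>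
    by blast
  have "\<exists>f. \<forall>n. (P (f n) \<and> submodule (f n) R \<L>) \<and> f (Suc n) \<subset> f n"
    by (rule dependent_nat_choice) (use P step in auto)
  then obtain f where "\<And>n. submodule (f n) R \<L>" "\<And>n. f (Suc n) \<subset> f n" by blast
  then show False by (rule descending_wf)
qed

text \<open>Let I be the stable power of \<mm>, so that I I = I. If I is nonzero, take J minimal
  among ideals with I J nonzero and x in J with I x nonzero. Minimality gives I x = J, so x = c x
  with c in I, and 1 - c is a unit because c lies in \<mm>; hence x = 0.\<close>

lemma nilpotent: obtains n where "mpow n = {\<zero>}"
proof -
  have "\<exists>n. \<forall>k\<ge>n. mpow k = mpow n"
    by (rule descending_chain[of mpow, OF power_ideal power_decreasing])
  then obtain n where n: "\<And>k. k \<ge> n \<Longrightarrow> mpow k = mpow n" by blast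
  let ?I = "mpow n"
  have mI: "smult_span R \<L> \<mm> ?I = ?I" using power_Suc[of n] n[of "Suc n"] by simp
  have Ic: "?I \<subseteq> carrier R" using ideal.Icarr[OF power_ideal] by blast
  have idem: "smult_span R \<L> ?I ?I = ?I"
  proof -
    \<comment> \<open>Idempotence is the case i = n; the induction on the exponent uses only that
      multiplying by \<mm> fixes the stable power.\<close>
    have "smult_span R \<L> (mpow i) ?I = ?I" for i
    proof (induction i)
      case 0
      show ?case
      proof
        show "smult_span R \<L> (mpow 0) ?I \<subseteq> ?I"
          by (rule L.smult_span_subset[OF _ power_submodule_ring]) (simp add: mpow_0)
        show "?I \<subseteq> smult_span R \<L> (mpow 0) ?I"
        proof
          fix a assume a: "a \<in> ?I"
          have "\<one> \<odot>\<^bsub>\<L>\<^esub> a \<in> smult_span R \<L> (carrier R) ?I" using a by (intro smult_spanI) auto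
          moreover have "\<one> \<otimes> a = a" using a Ic by auto
          ultimately show "a \<in> smult_span R \<L> (mpow 0) ?I" by (simp only: mpow_0 ring_module_simps)
        qed
      qed
    next
      case (Suc i)
      have Jc: "mpow j \<subseteq> carrier R" for j using ideal.Icarr[OF power_ideal] by blast
      show ?case
      proof
        show "smult_span R \<L> (mpow (Suc i)) ?I \<subseteq> ?I"
          by (rule L.smult_span_subset[OF Jc power_submodule_ring])
        show "?I \<subseteq> smult_span R \<L> (mpow (Suc i)) ?I"
          using L.smult_span_assoc[OF m_carrier Jc[of i], of ?I] Suc mI Ic by (simp add: power_Suc)
      qed
    qed
    then show ?thesis .
  qed
  have "?I = {\<zero>}"
  proof (rule ccontr)
    assume nz: "?I \<noteq> {\<zero>}"
    have z: "\<zero> \<in> ?I" using power_submodule_ring[of n, unfolded L.submodule_iff] by simp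
    define P where "P J \<longleftrightarrow> (\<exists>a\<in>?I. \<exists>x\<in>J. a \<otimes> x \<noteq> \<zero>)" for J
    have "P ?I"
    proof (rule ccontr)
      assume "\<not> P ?I"
      then have "smult_span R \<L> ?I ?I \<subseteq> {\<zero>\<^bsub>\<L>\<^esub>}"
        by (intro smult_span_least[OF L.submodule_zero]) (auto simp: P_def)
      then show False using idem nz z by auto
    qed
    from minimal_ideal_exists[of P, OF this power_submodule_ring] obtain J where
      J: "P J" "submodule J R \<L>" and min: "\<And>K. submodule K R \<L> \<Longrightarrow> P K \<Longrightarrow> K \<subseteq> J \<Longrightarrow> K = J" by blast
    obtain a x where ax: "a \<in> ?I" "x \<in> J" "a \<otimes> x \<noteq> \<zero>" using J(1) by (auto simp: P_def)
    have xc: "x \<in> carrier R" using ax J(2) by (auto simp: L.submodule_iff)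
    let ?K = "(\<lambda>c. c \<otimes> x) ` ?I"
    have Ka: "submodule ?K R \<L>"
      unfolding L.submodule_iff ring_module_simps
    proof (intro conjI ballI)
      show "?K \<subseteq> carrier R" using Ic xc by auto
      show "\<zero> \<in> ?K" by (rule image_eqI[of _ _ "\<zero>"]) (use z xc in auto)
      fix p q assume "p \<in> ?K" "q \<in> ?K"
      then obtain c e where "c \<in> ?I" "e \<in> ?I" "p = c \<otimes> x" "q = e \<otimes> x" by auto
      then show "p \<oplus> q \<in> ?K"
        by (intro image_eqI[of _ _ "c \<oplus> e"]) (use Ic xc power_submodule_ring[of n, unfolded L.submodule_iff] in \<open>auto simp: l_distr subset_iff\<close>)
    next
      fix r p assume r: "r \<in> carrier R" and "p \<in> ?K"
      then obtain c where "c \<in> ?I" "p = c \<otimes> x" by auto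
      then show "r \<otimes> p \<in> ?K"
        by (intro image_eqI[of _ _ "r \<otimes> c"]) (use r Ic xc power_submodule_ring[of n, unfolded L.submodule_iff] in \<open>auto simp: m_assoc subset_iff\<close>)
    qed
    have KJ: "?K \<subseteq> J" using J(2) ax(2) Ic by (auto simp: L.submodule_iff)
    \<comment> \<open>If I annihilated I x, then I = I I would annihilate x, against the choice of
      x.\<close>
    have "P ?K"
    proof (rule ccontr)
      assume "\<not> P ?K"
      then have 0: "a' \<otimes> (c \<otimes> x) = \<zero>" if "a' \<in> ?I" "c \<in> ?I" for a' c using that by (auto simp: P_def)
      have "smult_span R \<L> ?I ?I \<subseteq> {y \<in> carrier R. y \<otimes> x = \<zero>}"
      proof (rule smult_span_least)
        show "submodule {y \<in> carrier R. y \<otimes> x = \<zero>} R \<L>"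
          unfolding L.submodule_iff using xc by (auto simp: l_distr m_assoc)
        fix a' c assume "a' \<in> ?I" "c \<in> ?I"
        then show "a' \<odot>\<^bsub>\<L>\<^esub> c \<in> {y \<in> carrier R. y \<otimes> x = \<zero>}" using 0 Ic xc by (auto simp: m_assoc subset_iff)
      qed
      then show False using idem ax by auto
    qed
    then have "?K = J" using min Ka KJ by blast
    then obtain c where c: "c \<in> ?I" "x = c \<otimes> x" using ax(2) by auto
    \<comment> \<open>For n = 0 the stable power would be the whole ring, and then \<mm> would
      contain \<one>.\<close>
    have cm: "c \<in> \<mm>"
    proof (cases n)
      case 0
      have "carrier R = \<mm>" using n[of 1] 0 power_1 mpow_0 by simp
      then show ?thesis using one_notin_m one_closed by simp
    next
      case (Suc n')
      then show ?thesis using c(1) power_antimono[of 1 n] power_1 by auto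
    qed
    have cc: "c \<in> carrier R" using c Ic by auto
    have "\<one> \<ominus> c \<notin> \<mm>"
    proof
      assume "\<one> \<ominus> c \<in> \<mm>"
      then have "(\<one> \<ominus> c) \<oplus> c \<in> \<mm>" using cm m_submodule by (auto simp: L.submodule_iff)
      moreover have "(\<one> \<ominus> c) \<oplus> c = \<one>" using cc by (simp add: minus_eq a_assoc l_neg)
      ultimately show False using one_notin_m by simp
    qed
    then obtain u where u: "u \<in> carrier R" "u \<otimes> (\<one> \<ominus> c) = \<one>" using unit_of_notin_m[of "\<one> \<ominus> c"] cc by auto
    have "(\<one> \<ominus> c) \<otimes> x = x \<ominus> c \<otimes> x" using cc xc by (simp add: minus_eq l_distr l_minus)
    also have "\<dots> = \<zero>" using c(2) xc by (metis minus_eq r_neg)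
    finally have 0: "(\<one> \<ominus> c) \<otimes> x = \<zero>" .
    have "(u \<otimes> (\<one> \<ominus> c)) \<otimes> x = u \<otimes> ((\<one> \<ominus> c) \<otimes> x)" using u(1) cc xc by (intro m_assoc) auto
    then have "(u \<otimes> (\<one> \<ominus> c)) \<otimes> x = \<zero>" using 0 u(1) by simp
    then have "x = \<zero>" using u xc by simp
    then show False using ax Ic by auto
  qed
  then show thesis by (rule that)
qed

text \<open>Connects the \<open>GREATEST\<close> of \<open>loewy_length\<close> with its two working
  properties: nilpotency bounds the exponents in question, and
  \<open>\<one> \<noteq> \<zero>\<close> provides the exponent 0.\<close>

lemma power_zero_iff:
  obtains h where "mpow h \<noteq> {\<zero>}" "mpow (Suc h) = {\<zero>}" "loewy_length R \<mm> = h"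
proof -
  obtain n where n: "mpow n = {\<zero>}" by (rule nilpotent)
  have z: "\<zero> \<in> mpow i" for i using power_submodule_ring[of i, unfolded L.submodule_iff] by simp
  have up: "mpow i = {\<zero>}" if "i \<ge> n" for i using power_antimono[OF that] n z[of i] by blast
  have 0: "mpow 0 \<noteq> {\<zero>}" unfolding mpow_0 using one_neq_zero one_closed by blast
  let ?P = "\<lambda>h. mpow h \<noteq> {\<zero>}"
  have bd: "i \<le> n" if "?P i" for i using that up by (meson linorder_le_cases)
  have "?P (Greatest ?P)" by (rule GreatestI_nat[of ?P, OF 0 bd])
  moreover have "\<not> ?P (Suc (Greatest ?P))"
    using Greatest_le_nat[of ?P "Suc (Greatest ?P)" n] bd by auto
  ultimately show thesis using that[of "Greatest ?P"] by (auto simp: loewy_length_def mpow_def)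
qed

end

lemma (in plain_module) submodule_carrier: "submodule A R M \<Longrightarrow> A \<subseteq> carrier M"
  by (simp add: submodule_iff)

lemma (in plain_module) span_mono_submodule: "S \<subseteq> T \<Longrightarrow> span_module R M S \<subseteq> span_module R M T"
  by (auto simp: span_module_def)

section \<open>Nakayama's lemma and intervals of length one\<close>

locale al_module = artinian_local_ring R \<mm> + plain_module R M
  for R :: "('a, 'r) ring_scheme" (structure) and \<mm> and M :: "('a, 'm) module" (structure)
begin

abbreviation mm :: "'m set \<Rightarrow> 'm set" where "mm A \<equiv> smult_span R M \<mm> A"

lemma mm_submodule: "submodule A R M \<Longrightarrow> submodule (mm A) R M"
  by (rule smult_span_submodule[OF m_carrier]) (simp add: submodule_iff)

lemma mm_subset: "submodule A R M \<Longrightarrow> mm A \<subseteq> A"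
  by (rule smult_span_subset[OF m_carrier])

lemma mm_mono: "submodule B R M \<Longrightarrow> A \<subseteq> B \<Longrightarrow> mm A \<subseteq> mm B"
  by (rule smult_span_mono[OF m_carrier]) (simp_all add: submodule_iff)

lemma mm_iterate:
  assumes A: "submodule A R M"
  shows "submodule ((mm ^^ n) A) R M \<and> (mm ^^ n) A \<subseteq> smult_span R M (mpow n) A"
proof (induction n)
  case 0
  have "A \<subseteq> smult_span R M (carrier R) A"
  proof
    fix x assume x: "x \<in> A"
    then have "\<one> \<odot>\<^bsub>M\<^esub> x \<in> smult_span R M (carrier R) A" by (intro smult_spanI) auto
    then show "x \<in> smult_span R M (carrier R) A" using submodule_carrier[OF A] x by auto
  qed
  then show ?case using A by (simp add: mpow_0)
next
  case (Suc n)
  have c: "mpow n \<subseteq> carrier R" using ideal.Icarr[OF power_ideal] by blast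
  have s: "submodule (smult_span R M (mpow n) A) R M"
    by (rule smult_span_submodule[OF c submodule_carrier[OF A]])
  have "mm ((mm ^^ n) A) \<subseteq> mm (smult_span R M (mpow n) A)" using Suc mm_mono[OF s] by blast
  also have "\<dots> \<subseteq> smult_span R M (mpow (Suc n)) A"
    unfolding power_Suc by (rule smult_span_assoc[OF m_carrier c submodule_carrier[OF A]])
  finally show ?case using Suc mm_submodule by simp
qed

lemma mm_iterate_zero:
  assumes n: "mpow n = {\<zero>}" and A: "submodule A R M"
  shows "(mm ^^ n) A \<subseteq> {\<zero>\<^bsub>M\<^esub>}"
proof -
  have "smult_span R M (mpow n) A \<subseteq> {\<zero>\<^bsub>M\<^esub>}"
    by (rule smult_span_least[OF submodule_zero]) (use n submodule_carrier[OF A] in auto)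
  then show ?thesis using mm_iterate[OF A, of n] by blast
qed

text \<open>Nilpotency of \<mm> plays the part of finite generation: iterating A \<subseteq> B +
  \<mm> A gives A \<subseteq> B + \<mm>^n A for all n, and the last summand eventually
  vanishes.\<close>

lemma nakayama:
  assumes A: "submodule A R M" and B: "submodule B R M" and BA: "B \<subseteq> A" and le: "A \<subseteq> B <+>\<^bsub>M\<^esub> mm A"
  shows "A = B"
proof -
  have it: "submodule ((mm ^^ n) A) R M" for n using mm_iterate[OF A] by blast
  have "A \<subseteq> B <+>\<^bsub>M\<^esub> (mm ^^ n) A" for n
  proof (induction n)
    case 0 then show ?case using subset_sum(2)[OF B A] by simp
  next
    case (Suc n)
    let ?S = "B <+>\<^bsub>M\<^esub> mm ((mm ^^ n) A)"
    have S: "submodule ?S R M" by (rule submodule_sum[OF B mm_submodule[OF it]])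
    have "mm (B <+>\<^bsub>M\<^esub> (mm ^^ n) A) \<subseteq> ?S"
    proof (rule smult_span_least[OF S])
      fix a x assume a: "a \<in> \<mm>" and "x \<in> B <+>\<^bsub>M\<^esub> (mm ^^ n) A"
      then obtain b c where bc: "b \<in> B" "c \<in> (mm ^^ n) A" "x = b \<oplus>\<^bsub>M\<^esub> c" unfolding set_add_mem by blast
      have ac: "a \<in> carrier R" using a m_carrier by blast
      have "a \<odot>\<^bsub>M\<^esub> x = a \<odot>\<^bsub>M\<^esub> b \<oplus>\<^bsub>M\<^esub> a \<odot>\<^bsub>M\<^esub> c"
        unfolding bc(3) using bc submodule_carrier[OF B] submodule_carrier[OF it] ac by (intro smult_r_distr) auto
      moreover have "a \<odot>\<^bsub>M\<^esub> b \<in> B" using B bc ac by (simp add: submodule_iff)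
      moreover have "a \<odot>\<^bsub>M\<^esub> c \<in> mm ((mm ^^ n) A)" by (rule smult_spanI[OF a bc(2)])
      ultimately show "a \<odot>\<^bsub>M\<^esub> x \<in> ?S" unfolding set_add_mem by blast
    qed
    then have "mm A \<subseteq> ?S" using mm_mono[OF submodule_sum[OF B it] Suc.IH] by blast
    then have "B <+>\<^bsub>M\<^esub> mm A \<subseteq> ?S" by (rule sum_least[OF S subset_sum(1)[OF B mm_submodule[OF it]]])
    then show ?case using le by auto
  qed
  moreover obtain n where n: "mpow n = {\<zero>}" by (rule nilpotent)
  ultimately have "A \<subseteq> B <+>\<^bsub>M\<^esub> {\<zero>\<^bsub>M\<^esub>}" using mm_iterate_zero[OF n A] sum_mono[of B B "(mm ^^ n) A"] by blast
  also have "\<dots> \<subseteq> B" by (rule sum_least[OF B]) (use B in \<open>auto simp: submodule_iff\<close>)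
  finally show ?thesis using BA by blast
qed

lemma mm_eq_self: "submodule A R M \<Longrightarrow> A \<subseteq> mm A \<Longrightarrow> A = {\<zero>\<^bsub>M\<^esub>}"
  by (rule nakayama[OF _ submodule_zero])
    (use subset_sum(2)[OF submodule_zero mm_submodule] in \<open>auto simp: submodule_iff\<close>)

text \<open>Modulo B the element x spans a quotient of the residue field. An element of B + R x
  outside B has the form b + r x with r outside \<mm>, and inverting r recovers x, so nothing lies
  strictly between.\<close>

lemma cyclic_interval:
  assumes B: "submodule B R M" and x: "x \<in> carrier M" and mx: "\<And>a. a \<in> \<mm> \<Longrightarrow> a \<odot>\<^bsub>M\<^esub> x \<in> B"
  shows "finite_ilen R M B (B <+>\<^bsub>M\<^esub> cyclic R M x)" "x \<notin> B \<Longrightarrow> ilen R M B (B <+>\<^bsub>M\<^esub> cyclic R M x) = 1"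
proof -
  let ?T = "B <+>\<^bsub>M\<^esub> cyclic R M x"
  have T: "submodule ?T R M" by (rule submodule_sum[OF B cyclic_submodule[OF x]])
  have BT: "B \<subseteq> ?T" by (rule subset_sum(1)[OF B cyclic_submodule[OF x]])
  have two: "C = B \<or> C = ?T" if C: "submodule C R M" "B \<subseteq> C" "C \<subseteq> ?T" for C
  proof (cases "C \<subseteq> B")
    case False
    then obtain y where y: "y \<in> C" "y \<notin> B" by blast
    obtain b w where bw: "b \<in> B" "w \<in> cyclic R M x" "y = b \<oplus>\<^bsub>M\<^esub> w"
      using subsetD[OF C(3) y(1)] unfolding set_add_mem by blast
    obtain r where r: "r \<in> carrier R" "w = r \<odot>\<^bsub>M\<^esub> x" using bw(2) unfolding cyclic_def by blast
    note br = bw(1) r(1) bw(3)[unfolded r(2)]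
    have bc: "b \<in> carrier M" using br submodule_carrier[OF B] by blast
    have "r \<notin> \<mm>" using mx[of r] y br B by (auto simp: submodule_iff)
    then obtain u where u: "u \<in> carrier R" "u \<otimes> r = \<one>" using unit_of_notin_m br(2) by metis
    have "y \<ominus>\<^bsub>M\<^esub> b \<in> C" using submodule_minus[OF C(1) y(1)] br C by blast
    moreover have "y \<ominus>\<^bsub>M\<^esub> b = r \<odot>\<^bsub>M\<^esub> x" using br bc x by simp
    ultimately have "u \<odot>\<^bsub>M\<^esub> (r \<odot>\<^bsub>M\<^esub> x) \<in> C" using C(1) u by (simp add: submodule_iff)
    moreover have "u \<odot>\<^bsub>M\<^esub> (r \<odot>\<^bsub>M\<^esub> x) = x" using u br x by (simp add: smult_assoc1[symmetric])
    ultimately have "x \<in> C" by simp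
    then have "?T \<subseteq> C" by (intro sum_least[OF C(1) C(2)] cyclic_least[OF C(1)])
    then show ?thesis using C by blast
  qed (use C in blast)
  have le: "n \<le> 1" if n: "chain_in R M B ?T n" for n
  proof (rule ccontr)
    assume "\<not> n \<le> 1"
    then have n2: "2 \<le> n" by simp
    obtain C where C: "is_chain R M B ?T n C" using n by (auto simp: chain_in_def)
    have "C i = B \<or> C i = ?T" if "i \<le> n" for i using is_chainD(1)[OF C that] two by blast
    then have "C 0 = B \<or> C 0 = ?T" "C 1 = B \<or> C 1 = ?T" "C 2 = B \<or> C 2 = ?T" using n2 by auto
    moreover have "C 0 \<subset> C 1" "C 1 \<subset> C 2" using is_chainD(2)[OF C, of 0] is_chainD(2)[OF C, of 1] n2
      by (auto simp: numeral_2_eq_2)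
    ultimately show False using BT by auto
  qed
  then show fin: "finite_ilen R M B ?T" unfolding finite_ilen_def by blast
  assume "x \<notin> B"
  then have "B \<subset> ?T" using BT subset_sum(2)[OF B cyclic_submodule[OF x]] cyclic_self[OF x] by blast
  then have "ilen R M B ?T > 0" by (rule ilen_pos[OF fin B T])
  moreover have "ilen R M B ?T \<le> 1" by (rule ilen_leI[OF fin T BT le])
  ultimately show "ilen R M B ?T = 1" by simp
qed

end

section \<open>Finite length of the ring and of its free modules\<close>

context artinian_local_ring
begin

lemma al_moduleI: "module R V \<Longrightarrow> al_module R \<mm> V"
  by (simp add: al_module_def plain_module_def artinian_local_ring_axioms)

sublocale LA: al_module R \<mm> "ring_module R"
  by (rule al_moduleI) (rule ring_module_module)

text \<open>A/B is a vector space over the residue field. Were its length infinite, every H between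
  B and A of finite colength in A would contain a strictly smaller one of the same kind, namely a
  hyperplane avoiding a chosen x in H outside B; this contradicts the descending chain
  condition.\<close>

lemma finite_ilen_layer:
  assumes A: "submodule A R \<L>" and B: "submodule B R \<L>" and BA: "B \<subseteq> A" and mA: "LA.mm A \<subseteq> B"
  shows "finite_ilen R \<L> B A"
proof (rule ccontr)
  assume inf: "\<not> finite_ilen R \<L> B A"
  let ?P = "\<lambda>H. submodule H R \<L> \<and> B \<subseteq> H \<and> H \<subseteq> A \<and> finite_ilen R \<L> H A"
  have finA: "finite_ilen R \<L> A A"
    unfolding finite_ilen_def
  proof (intro exI allI impI)
    fix n assume "chain_in R \<L> A A n"
    then obtain C where C: "is_chain R \<L> A A n C" by (auto simp: chain_in_def)
    show "n \<le> 0"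
    proof (rule ccontr)
      assume "\<not> n \<le> 0"
      then have "C 0 \<subset> C 1" "C 0 = A" "C 1 = A"
        using is_chainD(2)[OF C, of 0] is_chainD(1)[OF C, of 0] is_chainD(1)[OF C, of 1] by auto
      then show False by blast
    qed
  qed
  have step: "\<exists>H'. ?P H' \<and> H' \<subset> H" if H: "?P H" for H
  proof -
    have "H \<noteq> B" using H inf by blast
    then obtain x where x: "x \<in> H" "x \<notin> B" using H by blast
    have xc: "x \<in> carrier \<L>" using x H L.submodule_carrier by blast
    from L.maximal_submodule_avoiding[OF B x(2)] obtain K where
      K: "submodule K R \<L>" "B \<subseteq> K" "x \<notin> K"
      and max: "\<And>J. submodule J R \<L> \<Longrightarrow> K \<subseteq> J \<Longrightarrow> x \<notin> J \<Longrightarrow> J = K" by blast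
    let ?K = "K \<inter> H"
    have K': "submodule ?K R \<L>" using L.submodule_Int K(1) H by blast
    have mx: "a \<odot>\<^bsub>\<L>\<^esub> y \<in> B" if "a \<in> \<mm>" "y \<in> H" for a y
      using mA smult_spanI[of a \<mm> y A \<L> R] that H by blast
    let ?T = "?K <+>\<^bsub>\<L>\<^esub> cyclic R \<L> x"
    have T: "submodule ?T R \<L>" by (rule L.submodule_sum[OF K' L.cyclic_submodule[OF xc]])
    have "H \<subseteq> ?T"
    proof
      fix y assume y: "y \<in> H"
      have yc: "y \<in> carrier \<L>" using y H L.submodule_carrier by blast
      show "y \<in> ?T"
      proof (cases "y \<in> K")
        case True then show ?thesis using y L.subset_sum(1)[OF K' L.cyclic_submodule[OF xc]] by blast
      next
        case False
        let ?J = "K <+>\<^bsub>\<L>\<^esub> cyclic R \<L> y"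
        have J: "submodule ?J R \<L>" by (rule L.submodule_sum[OF K(1) L.cyclic_submodule[OF yc]])
        have "?J \<noteq> K" using False L.subset_sum(2)[OF K(1) L.cyclic_submodule[OF yc]] L.cyclic_self[OF yc] by blast
        then have "x \<in> ?J" using max[OF J L.subset_sum(1)[OF K(1) L.cyclic_submodule[OF yc]]] by blast
        then obtain k w where kw: "k \<in> K" "w \<in> cyclic R \<L> y" "x = k \<oplus>\<^bsub>\<L>\<^esub> w"
          unfolding L.set_add_mem by blast
        obtain r where r: "r \<in> carrier R" "w = r \<odot>\<^bsub>\<L>\<^esub> y" using kw(2) unfolding cyclic_def by blast
        note kr = kw(1) r(1) kw(3)[unfolded r(2)]
        have kc: "k \<in> carrier \<L>" using kr K(1) L.submodule_carrier by blast
        have "r \<notin> \<mm>"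
        proof
          assume "r \<in> \<mm>"
          then have "r \<odot>\<^bsub>\<L>\<^esub> y \<in> K" using mx y K(2) by blast
          then show False using kr K by (auto simp: L.submodule_iff)
        qed
        then obtain u where u: "u \<in> carrier R" "u \<otimes> r = \<one>" using unit_of_notin_m kr(2) by metis
        have ryc: "r \<odot>\<^bsub>\<L>\<^esub> y \<in> carrier \<L>" using kr(2) yc by simp
        have "k = x \<ominus>\<^bsub>\<L>\<^esub> r \<odot>\<^bsub>\<L>\<^esub> y"
          unfolding kr(3) using L.add_minus_cancel[OF ryc kc] L.M.a_comm[OF kc ryc] by simp
        then have "k \<in> H" using L.submodule_minus[of H x "r \<odot>\<^bsub>\<L>\<^esub> y"] H x(1) y kr(2)
          by (metis L.submodule_iff)
        then have kK: "k \<in> ?K" using kr by blast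
        have "y = u \<odot>\<^bsub>\<L>\<^esub> (r \<odot>\<^bsub>\<L>\<^esub> y)" using u kr(2) yc by (simp add: m_assoc[symmetric])
        also have "r \<odot>\<^bsub>\<L>\<^esub> y = x \<ominus>\<^bsub>\<L>\<^esub> k" unfolding kr(3) by (rule L.add_minus_cancel[OF kc ryc, symmetric])
        finally have "y = u \<odot>\<^bsub>\<L>\<^esub> (x \<ominus>\<^bsub>\<L>\<^esub> k)" .
        moreover have "x \<in> ?T" "k \<in> ?T"
          using L.subset_sum[OF K' L.cyclic_submodule[OF xc]] L.cyclic_self[OF xc] kK by blast+
        ultimately show ?thesis using L.submodule_minus[OF T] T u(1) by (metis L.submodule_iff)
      qed
    qed
    moreover have "?T \<subseteq> H" by (rule L.sum_least) (use H x L.cyclic_least in auto)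
    ultimately have TH: "?T = H" by blast
    have "finite_ilen R \<L> ?K ?T" by (rule LA.cyclic_interval(1)[OF K' xc]) (use mx x K(2) H in blast)
    then have "finite_ilen R \<L> ?K A"
      unfolding TH using L.finite_ilen_trans[of ?K H A] H A by blast
    then have "?P ?K" using K' K(2) H by blast
    moreover have "?K \<subset> H" using x K by blast
    ultimately show ?thesis by blast
  qed
  have "\<exists>f. \<forall>n. ?P (f n) \<and> f (Suc n) \<subset> f n"
    by (rule dependent_nat_choice) (use A BA finA step in blast)+
  then obtain f where "\<And>n. submodule (f n) R \<L>" "\<And>n. f (Suc n) \<subset> f n" by blast
  then show False by (rule descending_wf)
qed

lemma finite_ilen_power: "finite_ilen R \<L> (mpow n) (carrier R)"
proof (induction n)
  case 0
  have "LA.mm (carrier R) \<subseteq> carrier R" using LA.mm_subset[OF power_submodule_ring[of 0]] by (simp add: mpow_0)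
  then show ?case using finite_ilen_layer[OF power_submodule_ring[of 0] power_submodule_ring[of 0]] by (simp add: mpow_0)
next
  case (Suc n)
  have "finite_ilen R \<L> (mpow (Suc n)) (mpow n)"
    by (rule finite_ilen_layer[OF power_submodule_ring power_submodule_ring power_decreasing]) (simp add: power_Suc)
  from L.finite_ilen_trans[OF this Suc.IH power_submodule_ring power_decreasing] show ?case
    using L.carrier_is_submodule power_submodule_ring[of n] by (simp add: L.submodule_iff)
qed

sublocale LF: finite_length_module R "ring_module R"
proof unfold_locales
  obtain n where "mpow n = {\<zero>}" by (rule nilpotent)
  then show "finite_ilen R \<L> {\<zero>\<^bsub>\<L>\<^esub>} (carrier \<L>)" using finite_ilen_power[of n] by simp
qed

lemma len_ring: "len R \<L> (carrier R) = len R \<L> \<mm> + 1"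
proof -
  let ?T = "\<mm> <+>\<^bsub>\<L>\<^esub> cyclic R \<L> \<one>"
  have o: "\<one> \<in> carrier \<L>" by simp
  have T: "submodule ?T R \<L>" by (rule L.submodule_sum[OF m_submodule L.cyclic_submodule[OF o]])
  have "\<one> \<in> ?T" using L.subset_sum(2)[OF m_submodule L.cyclic_submodule[OF o]] L.cyclic_self[OF o] by blast
  then have "?T = carrier R" using T ideal.one_imp_carrier[of ?T R] by (simp add: ideal_iff_submodule)
  moreover have "ilen R \<L> \<mm> ?T = 1"
    by (rule LA.cyclic_interval(2)[OF m_submodule o _ one_notin_m]) (use m_carrier in \<open>auto simp: subset_iff\<close>)
  ultimately have "ilen R \<L> \<mm> (carrier R) = 1" by simp
  then show ?thesis using LF.len_add[OF L.carrier_is_submodule m_submodule] m_carrier by simp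
qed

end

text \<open>Induction along 0 -> A^n -> A^(n+1) -> A -> 0, where the first map pads with a zero and
  the second reads the last coordinate.\<close>

lemma (in plain_module) len_power:
  assumes A: "submodule A R M" and fin: "finite_ilen R M {\<zero>\<^bsub>M\<^esub>} A"
  shows "finite_ilen R (power_module M n) {\<zero>\<^bsub>power_module M n\<^esub>} ({..<n} \<rightarrow>\<^sub>E A)
    \<and> len R (power_module M n) ({..<n} \<rightarrow>\<^sub>E A) = n * len R M A"
proof (induction n)
  case 0
  have z: "{..<0::nat} \<rightarrow>\<^sub>E A = {\<zero>\<^bsub>power_module M 0\<^esub>}" by auto
  have s: "submodule {\<zero>\<^bsub>power_module M 0\<^esub>} R (power_module M 0)"
    by (rule plain_module.submodule_zero[OF power_plain_module])
  have "finite_ilen R (power_module M 0) {\<zero>\<^bsub>power_module M 0\<^esub>} {\<zero>\<^bsub>power_module M 0\<^esub>}"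
    unfolding finite_ilen_def
  proof (intro exI allI impI)
    fix n assume "chain_in R (power_module M 0) {\<zero>\<^bsub>power_module M 0\<^esub>} {\<zero>\<^bsub>power_module M 0\<^esub>} n"
    then obtain C where C: "is_chain R (power_module M 0) {\<zero>\<^bsub>power_module M 0\<^esub>} {\<zero>\<^bsub>power_module M 0\<^esub>} n C"
      by (auto simp: chain_in_def)
    show "n \<le> 0"
    proof (rule ccontr)
      assume "\<not> n \<le> 0"
      then have "C 0 \<subset> C 1" "C 0 = {\<zero>\<^bsub>power_module M 0\<^esub>}" "C 1 = {\<zero>\<^bsub>power_module M 0\<^esub>}"
        using is_chainD(2)[OF C, of 0] is_chainD(1)[OF C, of 0] is_chainD(1)[OF C, of 1] by auto
      then show False by blast
    qed
  qed
  then show ?case unfolding z by (simp only: ilen_self[OF s] mult_0 simp_thms)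
next
  case (Suc n)
  have A0: "\<zero>\<^bsub>M\<^esub> \<in> A" and Ac: "A \<subseteq> carrier M" using A by (simp_all add: submodule_iff)
  let ?P = "power_module M"
  interpret P: plain_module R "power_module M k" for k by (rule power_plain_module)
  interpret p: module_homomorphism R "?P (Suc n)" M "\<lambda>v. v n"
    by (intro module_homI power_module_module module_axioms proj_hom) simp
  let ?e = "\<lambda>v. \<lambda>i\<in>{..<Suc n}. if i < n then v i else \<zero>\<^bsub>M\<^esub>"
  have eh: "?e \<in> module_hom R (?P n) (?P (Suc n))"
    by (auto simp: module_hom_def fun_eq_iff PiE_iff)
  interpret e: module_homomorphism R "?P n" "?P (Suc n)" ?e
    by (intro module_homI power_module_module eh)
  let ?An = "{..<n} \<rightarrow>\<^sub>E A" and ?AS = "{..<Suc n} \<rightarrow>\<^sub>E A"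
  have sn: "submodule ?An R (?P n)" "submodule ?AS R (?P (Suc n))" using power_submodule[OF A] by blast+
  have kere: "?An \<inter> module_kernel (?P n) (?P (Suc n)) ?e = {\<zero>\<^bsub>?P n\<^esub>}"
  proof
    show "?An \<inter> module_kernel (?P n) (?P (Suc n)) ?e \<subseteq> {\<zero>\<^bsub>?P n\<^esub>}"
    proof
      fix v assume "v \<in> ?An \<inter> module_kernel (?P n) (?P (Suc n)) ?e"
      then have v: "v \<in> ?An" and z: "?e v = \<zero>\<^bsub>?P (Suc n)\<^esub>" by (simp_all add: module_kernel_def)
      have "v = \<zero>\<^bsub>?P n\<^esub>"
      proof (rule power_ext[OF v])
        show "\<zero>\<^bsub>?P n\<^esub> \<in> {..<n} \<rightarrow>\<^sub>E A" using A0 by auto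
        fix i assume "i < n"
        then show "v i = \<zero>\<^bsub>?P n\<^esub> i" using fun_cong[OF z, of i] by simp
      qed
      then show "v \<in> {\<zero>\<^bsub>?P n\<^esub>}" by blast
    qed
    show "{\<zero>\<^bsub>?P n\<^esub>} \<subseteq> ?An \<inter> module_kernel (?P n) (?P (Suc n)) ?e"
      using P.submodule_zero[of n] sn(1) e.kernel_submodule by (auto simp: P.submodule_iff)
  qed
  have kerp: "?AS \<inter> module_kernel (?P (Suc n)) M (\<lambda>v. v n) = ?e ` ?An"
  proof
    show "?AS \<inter> module_kernel (?P (Suc n)) M (\<lambda>v. v n) \<subseteq> ?e ` ?An"
    proof
      fix v assume "v \<in> ?AS \<inter> module_kernel (?P (Suc n)) M (\<lambda>v. v n)"
      then have v: "v \<in> ?AS" "v n = \<zero>\<^bsub>M\<^esub>" by (simp_all add: module_kernel_def)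
      have r: "(\<lambda>i\<in>{..<n}. v i) \<in> ?An" using v by (auto simp: PiE_iff)
      have "v = ?e (\<lambda>i\<in>{..<n}. v i)"
        by (rule power_ext[OF v(1), where B = UNIV]) (use v(2) in \<open>auto simp: less_Suc_eq\<close>)
      then show "v \<in> ?e ` ?An" using r by (rule image_eqI)
    qed
    show "?e ` ?An \<subseteq> ?AS \<inter> module_kernel (?P (Suc n)) M (\<lambda>v. v n)"
    proof (intro image_subsetI IntI)
      fix v assume v: "v \<in> ?An"
      show "?e v \<in> ?AS" using v A0 by (auto simp: PiE_iff)
      then show "?e v \<in> module_kernel (?P (Suc n)) M (\<lambda>v. v n)"
        using Ac by (auto simp: module_kernel_def PiE_iff)
    qed
  qed
  have img: "(\<lambda>v. v n) ` ?AS = A"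
  proof
    show "A \<subseteq> (\<lambda>v. v n) ` ?AS"
    proof
      fix x assume "x \<in> A"
      then show "x \<in> (\<lambda>v. v n) ` ?AS" by (intro image_eqI[of _ _ "\<lambda>i\<in>{..<Suc n}. x"]) auto
    qed
  qed (auto simp: PiE_iff)
  have f1: "finite_ilen R (?P (Suc n)) {\<zero>\<^bsub>?P (Suc n)\<^esub>} (?e ` ?An)"
    using e.finite_len_iff[OF sn(1)] Suc.IH by blast
  have l1: "len R (?P n) ?An = len R (?P (Suc n)) (?e ` ?An)"
    using e.len_image[OF sn(1) conjunct1[OF Suc.IH]] unfolding kere ilen_self[OF P.submodule_zero[of n]] by (simp only: add_0)
  have f2: "finite_ilen R (?P (Suc n)) {\<zero>\<^bsub>?P (Suc n)\<^esub>} ?AS"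
    using p.finite_len_iff[OF sn(2)] f1 fin unfolding kerp img by blast
  have "len R (?P (Suc n)) ?AS = len R (?P (Suc n)) (?e ` ?An) + len R M A"
    using p.len_image[OF sn(2) f2] unfolding kerp img .
  also have "\<dots> = Suc n * len R M A" unfolding l1[symmetric] conjunct2[OF Suc.IH] by (simp only: mult_Suc add.commute)
  finally show ?case using f2 by blast
qed

lemma (in plain_module) span_image_of_free:
  assumes S: "finite S" "S \<subseteq> carrier M"
  obtains \<phi> where "\<phi> \<in> module_hom R (free_power R (card S)) M" "\<phi> ` carrier (free_power R (card S)) = span_module R M S"
proof -
  obtain xs where xs: "bij_betw xs {..<card S} S"
    using ex_bij_betw_nat_finite[OF S(1)] by (metis atLeast0LessThan)
  have x: "xs j \<in> S" if "j < card S" for j using xs that by (auto simp: bij_betw_def)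
  let ?\<phi> = "comb M (card S) xs"
  have h: "?\<phi> \<in> module_hom R (free_power R (card S)) M" by (rule comb_hom) (use x S in blast)
  interpret h: module_homomorphism R "free_power R (card S)" M ?\<phi>
    by (intro module_homI free_module_module module_axioms h)
  have "span_module R M S \<subseteq> ?\<phi> ` carrier (free_power R (card S))"
  proof (rule span_least)
    show "submodule (?\<phi> ` carrier (free_power R (card S))) R M"
      by (rule h.image_submodule[OF h.M.carrier_is_submodule])
    show "S \<subseteq> ?\<phi> ` carrier (free_power R (card S))"
    proof
      fix s assume "s \<in> S"
      then obtain j where j: "j < card S" "s = xs j" using xs by (auto simp: bij_betw_def)
      have "?\<phi> (unit_vec R (card S) j) = s" unfolding j(2) by (rule comb_unit_vec[OF _ j(1)]) (use x S in blast)
      then show "s \<in> ?\<phi> ` carrier (free_power R (card S))"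
        by (intro image_eqI[of _ _ "unit_vec R (card S) j"]) (simp_all add: free_carrier)
    qed
  qed
  moreover have "?\<phi> ` carrier (free_power R (card S)) \<subseteq> span_module R M S"
  proof (rule image_subsetI)
    fix y assume y: "y \<in> carrier (free_power R (card S))"
    have sp: "submodule (span_module R M S) R M" by (rule span_submodule[OF S(2)])
    show "?\<phi> y \<in> span_module R M S" unfolding comb_def
    proof (rule lsum_mem[OF sp])
      fix j assume j: "j < card S"
      have "xs j \<in> span_module R M S" by (rule subsetD[OF span_subset x[OF j]])
      moreover have "y j \<in> carrier R" using y j by (auto simp: free_carrier PiE_iff)
      ultimately show "y j \<odot>\<^bsub>M\<^esub> xs j \<in> span_module R M S" using sp by (simp add: submodule_iff)
    qed
  qed
  ultimately show thesis using that h by blast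
qed

lemma (in al_module) finitely_generated_finite_length:
  assumes "finitely_generated R M"
  shows "finite_length_module R M"
proof unfold_locales
  obtain S where S: "finite S" "S \<subseteq> carrier M" "span_module R M S = carrier M"
    using assms by (auto simp: finitely_generated_def generates_module_def)
  obtain \<phi> where \<phi>: "\<phi> \<in> module_hom R (free_power R (card S)) M"
    "\<phi> ` carrier (free_power R (card S)) = span_module R M S" by (rule span_image_of_free[OF S(1,2)])
  interpret h: module_homomorphism R "free_power R (card S)" M \<phi>
    by (intro module_homI free_module_module module_axioms \<phi>)
  have "finite_ilen R (free_power R (card S)) {\<zero>\<^bsub>free_power R (card S)\<^esub>} (carrier (free_power R (card S)))"
    using L.len_power[OF L.carrier_is_submodule] LF.finite_len unfolding free_power_eq by simp
  then show "finite_ilen R M {\<zero>\<^bsub>M\<^esub>} (carrier M)"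
    using h.finite_len_iff[OF h.M.carrier_is_submodule] \<phi>(2) S(3) by simp
qed

section \<open>Minimal covers and minimal free resolutions\<close>

locale al_fl_module = al_module R \<mm> M + finite_length_module R M
  for R :: "('a, 'r) ring_scheme" (structure) and \<mm> and M :: "('a, 'm) module" (structure)
begin

text \<open>Generators are picked one at a time, starting from B = \<mm> A: an element of A outside
  B shortens the interval from B to A by exactly one. Nakayama then turns generation modulo \<mm> A
  into generation of A.\<close>

lemma small_generating_set:
  assumes A: "submodule A R M"
  obtains S where "finite S" "S \<subseteq> A" "card S \<le> ilen R M (mm A) A" "span_module R M S = A"
proof -
  have "\<exists>S. finite S \<and> S \<subseteq> A \<and> card S \<le> ilen R M B A \<and> A \<subseteq> B <+>\<^bsub>M\<^esub> span_module R M S"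
    if "submodule B R M" "mm A \<subseteq> B" "B \<subseteq> A" for B
    using that
  proof (induction "ilen R M B A" arbitrary: B rule: less_induct)
    case less
    have Ac: "A \<subseteq> carrier M" by (rule submodule_carrier[OF A])
    show ?case
    proof (cases "A \<subseteq> B")
      case True
      then have "A \<subseteq> B <+>\<^bsub>M\<^esub> span_module R M {}"
        using subset_sum(1)[OF less(2) span_submodule[of "{}"]] by auto
      then show ?thesis by (intro exI[of _ "{}"]) simp
    next
      case False
      then obtain x where x: "x \<in> A" "x \<notin> B" by blast
      have xc: "x \<in> carrier M" using x Ac by blast
      let ?T = "B <+>\<^bsub>M\<^esub> cyclic R M x"
      have cy: "submodule (cyclic R M x) R M" by (rule cyclic_submodule[OF xc])
      have T: "submodule ?T R M" by (rule submodule_sum[OF less(2) cy])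
      have BT: "B \<subseteq> ?T" by (rule subset_sum(1)[OF less(2) cy])
      have TA: "?T \<subseteq> A" by (rule sum_least[OF A less(4) cyclic_least[OF A x(1)]])
      have mx: "a \<odot>\<^bsub>M\<^esub> x \<in> B" if "a \<in> \<mm>" for a by (rule subsetD[OF less(3) smult_spanI[OF that x(1)]])
      have 1: "ilen R M B ?T = 1" by (rule cyclic_interval(2)[OF less(2) xc mx x(2)])
      have e: "ilen R M B A = ilen R M B ?T + ilen R M ?T A"
        by (rule ilen_add[OF fin[OF A less(2)] T BT TA A])
      have "mm A \<subseteq> ?T" using less(3) BT by blast
      from less(1)[OF _ T this TA] e 1 obtain S where
        S: "finite S" "S \<subseteq> A" "card S \<le> ilen R M ?T A" "A \<subseteq> ?T <+>\<^bsub>M\<^esub> span_module R M S" by auto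
      let ?S = "insert x S"
      have Sc: "?S \<subseteq> carrier M" using S(2) x Ac by blast
      let ?U = "B <+>\<^bsub>M\<^esub> span_module R M ?S"
      have sp: "submodule (span_module R M ?S) R M" by (rule span_submodule[OF Sc])
      have U: "submodule ?U R M" by (rule submodule_sum[OF less(2) sp])
      have spU: "span_module R M ?S \<subseteq> ?U" by (rule subset_sum(2)[OF less(2) sp])
      have "x \<in> ?U" using spU span_subset[of ?S R M] by blast
      then have "?T \<subseteq> ?U" by (intro sum_least[OF U subset_sum(1)[OF less(2) sp]] cyclic_least[OF U])
      moreover have "span_module R M S \<subseteq> ?U" using span_mono_submodule[of S ?S] spU by blast
      ultimately have "?T <+>\<^bsub>M\<^esub> span_module R M S \<subseteq> ?U" by (rule sum_least[OF U])
      then have "A \<subseteq> ?U" using S(4) by blast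
      moreover have "card ?S \<le> ilen R M B A" using card_insert_le_m1[of "ilen R M B A" S x] S(3) e 1 by simp
      ultimately show ?thesis using S(1,2) x(1) by (intro exI[of _ ?S]) auto
    qed
  qed
  from this[OF mm_submodule[OF A] _ mm_subset[OF A]] obtain S where
    S: "finite S" "S \<subseteq> A" "card S \<le> ilen R M (mm A) A" "A \<subseteq> mm A <+>\<^bsub>M\<^esub> span_module R M S" by blast
  have Sc: "S \<subseteq> carrier M" using S(2) submodule_carrier[OF A] by blast
  have sp: "submodule (span_module R M S) R M" by (rule span_submodule[OF Sc])
  have "A = span_module R M S"
  proof (rule nakayama[OF A sp span_least[OF A S(2)]])
    show "A \<subseteq> span_module R M S <+>\<^bsub>M\<^esub> mm A"
    proof
      fix x assume "x \<in> A"
      then obtain p q where pq: "p \<in> mm A" "q \<in> span_module R M S" "x = p \<oplus>\<^bsub>M\<^esub> q"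
        using subsetD[OF S(4)] unfolding set_add_mem by blast
      then have "x = q \<oplus>\<^bsub>M\<^esub> p"
        using M.a_comm submodule_carrier[OF mm_submodule[OF A]] submodule_carrier[OF sp] by blast
      then show "x \<in> span_module R M S <+>\<^bsub>M\<^esub> mm A" unfolding set_add_mem using pq by blast
    qed
  qed
  then show thesis using S that by metis
qed

end

lemma (in artinian_local_ring) free_al_fl: "al_fl_module R \<mm> (free_power R n)"
proof -
  have "al_module R \<mm> (free_power R n)" by (rule al_moduleI[OF L.free_module_module])
  moreover have "finite_ilen R (free_power R n) {\<zero>\<^bsub>free_power R n\<^esub>} (carrier (free_power R n))"
    using L.len_power[OF L.carrier_is_submodule] LF.finite_len unfolding free_power_eq by simp
  ultimately show ?thesis
    unfolding al_fl_module_def finite_length_module_def finite_length_module_axioms_def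
    by (simp add: al_module_def)
qed

lemma (in artinian_local_ring) mm_free:
  "smult_span R (free_power R n) \<mm> ({..<n} \<rightarrow>\<^sub>E mpow k) = {..<n} \<rightarrow>\<^sub>E mpow (Suc k)"
  unfolding free_power_eq power_Suc by (rule L.power_smult_span[OF m_carrier power_submodule_ring])

lemma (in artinian_local_ring) free_power_submodule: "submodule ({..<n} \<rightarrow>\<^sub>E mpow k) R (free_power R n)"
  unfolding free_power_eq by (rule L.power_submodule[OF power_submodule_ring])

lemma (in artinian_local_ring) len_free:
  assumes "submodule I R \<L>"
  shows "len R (free_power R n) ({..<n} \<rightarrow>\<^sub>E I) = n * len R \<L> I"
  using L.len_power[OF assms LF.fin[OF assms L.submodule_zero]] unfolding free_power_eq by blast

lemma (in artinian_local_ring) mm_carrier_free: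
  "smult_span R (free_power R n) \<mm> ({..<n} \<rightarrow>\<^sub>E carrier R) = {..<n} \<rightarrow>\<^sub>E \<mm>"
  using mm_free[of n 0] power_1 by (simp add: mpow_0)

text \<open>Comparing lengths of F and \<mm> F with those of A and \<mm> A gives n = length(K / (K
  \<inter> \<mm> F)) + length(A / \<mm> A) for the kernel K. As n was chosen no larger than the last
  term, K = K \<inter> \<mm> F and n is exactly that term.\<close>

lemma (in al_fl_module) minimal_cover:
  assumes A: "submodule A R M"
  obtains n \<phi> where "\<phi> \<in> module_hom R (free_power R n) M" "\<phi> ` carrier (free_power R n) = A"
    "n = ilen R M (mm A) A" "module_kernel (free_power R n) M \<phi> \<subseteq> {..<n} \<rightarrow>\<^sub>E \<mm>"
proof -
  obtain S where S: "finite S" "S \<subseteq> A" "card S \<le> ilen R M (mm A) A" "span_module R M S = A"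
    by (rule small_generating_set[OF A])
  have Sc: "S \<subseteq> carrier M" using S(2) submodule_carrier[OF A] by blast
  obtain \<phi> where \<phi>: "\<phi> \<in> module_hom R (free_power R (card S)) M"
    "\<phi> ` carrier (free_power R (card S)) = span_module R M S" by (rule span_image_of_free[OF S(1) Sc])
  let ?n = "card S" and ?F = "free_power R (card S)"
  interpret F: al_fl_module R \<mm> ?F by (rule free_al_fl)
  interpret h: module_homomorphism R ?F M \<phi>
    by (intro module_homI free_module_module module_axioms \<phi>(1))
  let ?K = "module_kernel ?F M \<phi>" and ?mF = "{..<?n} \<rightarrow>\<^sub>E \<mm>"
  have K: "submodule ?K R ?F" by (rule h.kernel_submodule)
  have Fc: "carrier ?F = {..<?n} \<rightarrow>\<^sub>E carrier R" by (rule free_carrier)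
  have mF: "submodule ?mF R ?F" using free_power_submodule[of ?n 1] power_1 by simp
  have img: "\<phi> ` carrier ?F = A" using \<phi>(2) S(4) by simp
  have mA: "\<phi> ` ?mF = mm A"
    using h.image_smult_span[OF m_carrier order_refl] unfolding img by (simp add: Fc mm_carrier_free)
  have l1: "len R ?F (carrier ?F) = len R ?F ?K + len R M A"
    using h.len_image[OF F.carrier_is_submodule F.finite_len] F.submodule_carrier[OF K]
    unfolding img by (simp add: Int_absorb1)
  have l2: "len R ?F ?mF = len R ?F (?mF \<inter> ?K) + len R M (mm A)"
    using h.len_image[OF mF F.fin[OF mF F.submodule_zero]] unfolding mA .
  have l3: "len R ?F (carrier ?F) = len R ?F ?mF + ?n"
    unfolding Fc using len_free[OF L.carrier_is_submodule, of ?n] len_free[OF m_submodule, of ?n] len_ring by simp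
  have l4: "len R M A = len R M (mm A) + ilen R M (mm A) A"
    by (rule len_add[OF A mm_submodule[OF A] mm_subset[OF A]])
  have mK: "submodule (?mF \<inter> ?K) R ?F" by (rule F.submodule_Int[OF mF K])
  have l5: "len R ?F (?mF \<inter> ?K) \<le> len R ?F ?K" by (rule F.len_mono[OF K mK]) simp
  have "len R ?F ?K \<le> len R ?F (?mF \<inter> ?K)" using l1 l2 l3 l4 S(3) by linarith
  then have "?K = ?mF \<inter> ?K" by (intro F.len_eqD[OF K mK]) auto
  then have "?K \<subseteq> ?mF" by blast
  moreover have "?n = ilen R M (mm A) A" using l1 l2 l3 l4 S(3) l5 by linarith
  ultimately show thesis using that[OF \<phi>(1) img] by blast
qed

text \<open>Minimal covers of successive syzygies are strung together by dependent choice; that the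
  kernel of a minimal cover lies in \<mm> F is the minimality of the next differential.\<close>

lemma (in al_fl_module) minimal_free_resolution_exists:
  "\<exists>b d \<epsilon>. minimal_free_resolution R \<mm> M b d \<epsilon>"
proof -
  define F where "F n = free_power R n" for n
  obtain n0 \<epsilon> where e: "\<epsilon> \<in> module_hom R (F n0) M" "\<epsilon> ` carrier (F n0) = carrier M"
    "module_kernel (F n0) M \<epsilon> \<subseteq> {..<n0} \<rightarrow>\<^sub>E \<mm>"
    using minimal_cover[OF carrier_is_submodule] unfolding F_def by metis
  \<comment> \<open>A state holds the current rank q, a syzygy K in F q, and a minimal cover \<psi>
    of K of rank r. The last clause ties stage 0 to the augmentation, and Q passes the kernel of
    \<psi> on as the next syzygy.\<close>
  define P where "P i s \<longleftrightarrow> (case s of (q, K, r, \<psi>) \<Rightarrow> submodule K R (F q) \<and> K \<subseteq> {..<q} \<rightarrow>\<^sub>E \<mm> \<and>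
      \<psi> \<in> module_hom R (F r) (F q) \<and> \<psi> ` carrier (F r) = K \<and>
      module_kernel (F r) (F q) \<psi> \<subseteq> {..<r} \<rightarrow>\<^sub>E \<mm> \<and> (i = 0 \<longrightarrow> q = n0 \<and> K = module_kernel (F n0) M \<epsilon>))"
    for i :: nat and s :: "nat \<times> (nat \<Rightarrow> 'a) set \<times> nat \<times> ((nat \<Rightarrow> 'a) \<Rightarrow> (nat \<Rightarrow> 'a))"
  define Q where "Q i s s' \<longleftrightarrow> (case s of (q, K, r, \<psi>) \<Rightarrow> (case s' of (q', K', r', \<psi>') \<Rightarrow> q' = r \<and> K' = module_kernel (F r) (F q) \<psi>))"
    for i :: nat and s s' :: "nat \<times> (nat \<Rightarrow> 'a) set \<times> nat \<times> ((nat \<Rightarrow> 'a) \<Rightarrow> (nat \<Rightarrow> 'a))"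
  have cover: "\<exists>r \<psi>. \<psi> \<in> module_hom R (F r) (F q) \<and> \<psi> ` carrier (F r) = K \<and>
      module_kernel (F r) (F q) \<psi> \<subseteq> {..<r} \<rightarrow>\<^sub>E \<mm>" if "submodule K R (F q)" for q K
    using al_fl_module.minimal_cover[OF free_al_fl that[unfolded F_def]] unfolding F_def by metis
  have base: "\<exists>s. P 0 s"
  proof -
    interpret h: module_homomorphism R "F n0" M \<epsilon>
      by (intro module_homI module_axioms e(1)) (simp add: F_def free_module_module)
    obtain r \<psi> where "\<psi> \<in> module_hom R (F r) (F n0) \<and> \<psi> ` carrier (F r) = module_kernel (F n0) M \<epsilon> \<and>
      module_kernel (F r) (F n0) \<psi> \<subseteq> {..<r} \<rightarrow>\<^sub>E \<mm>" using cover[OF h.kernel_submodule] by blast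
    then have "P 0 (n0, module_kernel (F n0) M \<epsilon>, r, \<psi>)" using h.kernel_submodule e(3) by (simp add: P_def)
    then show ?thesis by blast
  qed
  have step: "\<exists>s'. P (Suc i) s' \<and> Q i s s'" if Ps: "P i s" for i s
  proof -
    obtain q K r \<psi> where s: "s = (q, K, r, \<psi>)" by (metis prod.exhaust)
    have \<psi>: "\<psi> \<in> module_hom R (F r) (F q)" "module_kernel (F r) (F q) \<psi> \<subseteq> {..<r} \<rightarrow>\<^sub>E \<mm>" using Ps by (simp_all add: P_def s)
    interpret h: module_homomorphism R "F r" "F q" \<psi>
      by (intro module_homI \<psi>(1)) (simp_all add: F_def free_module_module)
    obtain r' \<psi>' where "\<psi>' \<in> module_hom R (F r') (F r) \<and> \<psi>' ` carrier (F r') = module_kernel (F r) (F q) \<psi> \<and>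
      module_kernel (F r') (F r) \<psi>' \<subseteq> {..<r'} \<rightarrow>\<^sub>E \<mm>" using cover[OF h.kernel_submodule] by blast
    then have "P (Suc i) (r, module_kernel (F r) (F q) \<psi>, r', \<psi>')" "Q i s (r, module_kernel (F r) (F q) \<psi>, r', \<psi>')"
      using h.kernel_submodule \<psi>(2) by (simp_all add: P_def Q_def s)
    then show ?thesis by blast
  qed
  obtain f where f: "\<And>i. P i (f i)" "\<And>i. Q i (f i) (f (Suc i))"
    using dependent_nat_choice[of P Q, OF base step] by blast
  define b where "b i = fst (f i)" for i
  define d where "d i = snd (snd (snd (f i)))" for i
  define K where "K i = fst (snd (f i))" for i
  have fi: "f i = (b i, K i, b (Suc i), d i)" for i
    using f(2)[of i] by (cases "f i", cases "f (Suc i)") (simp add: Q_def b_def K_def d_def)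
  have Pi: "K i \<subseteq> {..<b i} \<rightarrow>\<^sub>E \<mm>" "d i \<in> module_hom R (F (b (Suc i))) (F (b i))" "d i ` carrier (F (b (Suc i))) = K i"
    for i using f(1)[of i] unfolding fi[of i] by (simp_all add: P_def)
  have P0: "b 0 = n0" "K 0 = module_kernel (F n0) M \<epsilon>" using f(1)[of 0] unfolding fi[of 0] by (simp_all add: P_def)
  have Qi: "K (Suc i) = module_kernel (F (b (Suc i))) (F (b i)) (d i)" for i
    using f(2)[of i] unfolding fi[of i] fi[of "Suc i"] by (simp add: Q_def)
  have "free_resolution R M b d \<epsilon>"
    unfolding free_resolution_def Let_def F_def[symmetric]
    using e Pi P0 Qi by (metis One_nat_def)
  moreover have "d i ` carrier (free_power R (b (Suc i))) \<subseteq> ideal_smult R \<mm> (free_power R (b i))" for i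
    using Pi(3)[of i] Pi(1)[of i] unfolding ideal_smult_eq free_carrier mm_carrier_free by (simp add: F_def free_carrier)
  ultimately show ?thesis unfolding minimal_free_resolution_def by blast
qed

text \<open>A basis is a set here, so the images of distinct unit vectors must be distinct elements;
  this is where \<open>\<one> \<noteq> \<zero>\<close> enters.\<close>

lemma (in plain_module) free_of_iso:
  assumes h: "\<phi> \<in> module_hom R (free_power R n) M" and surj: "\<phi> ` carrier (free_power R n) = carrier M"
    and inj: "module_kernel (free_power R n) M \<phi> \<subseteq> {\<zero>\<^bsub>free_power R n\<^esub>}" and nz: "\<one> \<noteq> \<zero>"
  shows "free_module R M"
proof -
  let ?F = "free_power R n"
  interpret h: module_homomorphism R ?F M \<phi> by (intro module_homI free_module_module module_axioms h)
  have inj': "u = v" if "u \<in> carrier ?F" "v \<in> carrier ?F" "\<phi> u = \<phi> v" for u v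
  proof -
    have "u \<ominus>\<^bsub>?F\<^esub> v \<in> module_kernel ?F M \<phi>"
      using that by (simp add: module_kernel_def M.minus_eq M.r_neg)
    then have "u \<ominus>\<^bsub>?F\<^esub> v = \<zero>\<^bsub>?F\<^esub>" using inj by blast
    then show ?thesis using h.M.minus_add_cancel[OF that(1,2)] h.M.M.l_zero[OF that(2)] by metis
  qed
  let ?e = "unit_vec R n"
  have ec: "?e j \<in> carrier ?F" for j by (simp add: free_carrier del: PiE_iff)
  let ?B = "(\<lambda>j. \<phi> (?e j)) ` {..<n}"
  have Bc: "?B \<subseteq> carrier M" using ec by auto
  have gen: "generates_module R M ?B"
  proof -
    have sp: "submodule (span_module R M ?B) R M" by (rule span_submodule[OF Bc])
    have "\<phi> y \<in> span_module R M ?B" if "y \<in> {..<n} \<rightarrow>\<^sub>E carrier R" for y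
      using that
    proof (induction rule: free_induct)
      case zero
      have "(\<lambda>i\<in>{..<n}. \<zero>) = \<zero>\<^bsub>?F\<^esub>" by (simp add: free_power_eq)
      then have "\<phi> (\<lambda>i\<in>{..<n}. \<zero>) = \<zero>\<^bsub>M\<^esub>" using h.zero by metis
      then show ?case using sp unfolding submodule_iff by metis
    next
      case (emb j a)
      have "\<phi> (?e j) \<in> span_module R M ?B" using emb span_subset[of ?B R M] by blast
      then show ?case using h.smult[OF emb(2) ec] sp emb by (simp add: submodule_iff)
    next
      case (add v w)
      then show ?case using h.add[of v w] sp by (simp add: free_carrier submodule_iff)
    qed
    then have "carrier M \<subseteq> span_module R M ?B"
      unfolding surj[symmetric] by (intro image_subsetI) (simp add: free_carrier)
    then show ?thesis using Bc submodule_carrier[OF sp] by (simp add: generates_module_def subset_antisym)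
  qed
  have ind: "lin_indep R M ?B"
    unfolding lin_indep_def
  proof (intro allI impI, elim conjE)
    fix A a assume A: "finite A" "A \<subseteq> ?B" "a \<in> A \<rightarrow> carrier R" and z: "(\<Oplus>\<^bsub>M\<^esub>x\<in>A. a x \<odot>\<^bsub>M\<^esub> x) = \<zero>\<^bsub>M\<^esub>"
    \<comment> \<open>A combination over T is the image of the vector whose coordinates are the
      coefficients on T and zero elsewhere; injectivity then makes that vector, and with it every
      coefficient, vanish.\<close>
    have sum: "\<exists>y\<in>carrier ?F. \<phi> y = (\<Oplus>\<^bsub>M\<^esub>x\<in>T. a x \<odot>\<^bsub>M\<^esub> x) \<and> (\<forall>j<n. y j = (if \<phi> (?e j) \<in> T then a (\<phi> (?e j)) else \<zero>))"
      if T: "T \<subseteq> A" for T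
      using finite_subset[OF T A(1)] T
    proof (induction T rule: finite_induct)
      case empty
      have "\<zero>\<^bsub>?F\<^esub> j = \<zero>" if "j < n" for j using that by (simp add: free_power_eq)
      then show ?case by (intro bexI[of _ "\<zero>\<^bsub>?F\<^esub>"]) simp_all
    next
      case (insert x T)
      then obtain y where y: "y \<in> carrier ?F" "\<phi> y = (\<Oplus>\<^bsub>M\<^esub>x\<in>T. a x \<odot>\<^bsub>M\<^esub> x)"
        "\<And>j. j < n \<Longrightarrow> y j = (if \<phi> (?e j) \<in> T then a (\<phi> (?e j)) else \<zero>)" by auto
      have xA: "x \<in> A" using insert by blast
      obtain k where k: "k < n" "x = \<phi> (?e k)" using xA A(2) by auto
      have ax: "a x \<in> carrier R" using xA A(3) by blast
      have ac: "a t \<odot>\<^bsub>M\<^esub> t \<in> carrier M" if "t \<in> T" for t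
      proof (rule smult_closed)
        have tA: "t \<in> A" using that insert.prems by blast
        show "a t \<in> carrier R" using A(3) tA by blast
        show "t \<in> carrier M" using A(2) Bc tA by blast
      qed
      have xc: "x \<in> carrier M" using k ec by simp
      let ?y = "(a x \<odot>\<^bsub>?F\<^esub> ?e k) \<oplus>\<^bsub>?F\<^esub> y"
      have yc: "?y \<in> carrier ?F" using ax ec y(1) by (intro h.M.M.a_closed h.M.smult_closed)
      have "\<phi> ?y = a x \<odot>\<^bsub>M\<^esub> x \<oplus>\<^bsub>M\<^esub> \<phi> y" using ax ec y(1) k by simp
      also have "\<dots> = (\<Oplus>\<^bsub>M\<^esub>x\<in>insert x T. a x \<odot>\<^bsub>M\<^esub> x)"
        unfolding y(2) by (rule M.finsum_insert[symmetric]) (use insert ac ax xc in auto)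
      finally have 1: "\<phi> ?y = (\<Oplus>\<^bsub>M\<^esub>x\<in>insert x T. a x \<odot>\<^bsub>M\<^esub> x)" .
      have 2: "?y j = (if \<phi> (?e j) \<in> insert x T then a (\<phi> (?e j)) else \<zero>)" if j: "j < n" for j
      proof (cases "j = k")
        case True
        then show ?thesis using insert.hyps(2) k y(3)[OF j] ax j by (simp add: free_power_eq unit_vec_def)
      next
        case False
        have "\<phi> (?e j) \<noteq> x"
        proof
          assume "\<phi> (?e j) = x"
          then have "?e j = ?e k" using inj'[OF ec ec] k by simp
          then have "?e j j = ?e k j" by simp
          then have "\<one> = \<zero>" using False j by (simp add: unit_vec_def)
          then show False using nz by blast
        qed
        moreover have "y j \<in> carrier R" using y(1) j by (auto simp: free_carrier PiE_iff)
        ultimately show ?thesis using False y(3)[OF j] ax j k by (simp add: free_power_eq unit_vec_def)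
      qed
      show ?case using yc 1 2 by (intro bexI[of _ ?y]) auto
    qed
    obtain y where y: "y \<in> carrier ?F" "\<phi> y = (\<Oplus>\<^bsub>M\<^esub>x\<in>A. a x \<odot>\<^bsub>M\<^esub> x)"
      "\<And>j. j < n \<Longrightarrow> y j = (if \<phi> (?e j) \<in> A then a (\<phi> (?e j)) else \<zero>)" using sum[OF order_refl] by blast
    have "y = \<zero>\<^bsub>?F\<^esub>" by (rule inj'[OF y(1)]) (use y(2) z h.zero in auto)
    then have y0: "y j = \<zero>" if "j < n" for j using that by (simp add: free_power_eq)
    show "\<forall>x\<in>A. a x = \<zero>"
    proof
      fix x assume "x \<in> A"
      then obtain j where "j < n" "x = \<phi> (?e j)" using A(2) by auto
      then show "a x = \<zero>" using y(3)[of j] y0[of j] \<open>x \<in> A\<close> by simp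
    qed
  qed
  show ?thesis unfolding free_module_def using gen ind by blast
qed

section \<open>Numbers of generators of submodules of \<open>\<mm>\<^sup>2 F\<close>\<close>

context artinian_local_ring
begin

text \<open>The dimension of \<mm>/\<mm>^2, by Nakayama an upper bound for the number of generators
  of \<mm>.\<close>

definition emb_dim :: nat where "emb_dim = ilen R \<L> (mpow 2) \<mm>"

lemma mpow_2: "mpow 2 = LA.mm \<mm>"
  using power_Suc[of 1] power_1 by (simp add: numeral_2_eq_2)

lemma mpow_3: "mpow 3 = LA.mm (mpow 2)"
  using power_Suc[of 2] by (simp add: numeral_3_eq_3 numeral_2_eq_2)

lemma mpow_2_subset: "mpow 2 \<subseteq> \<mm>"
  unfolding mpow_2 by (rule LA.mm_subset[OF m_submodule])

lemma len_m: "len R \<L> \<mm> = len R \<L> (mpow 2) + emb_dim"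
  unfolding emb_dim_def by (rule LF.len_add[OF m_submodule power_submodule_ring mpow_2_subset])

lemma zero_in_power: "\<zero> \<in> mpow k"
  using power_submodule_ring[of k, unfolded L.submodule_iff] by simp

text \<open>By Nakayama the powers of \<mm> drop strictly down to \<mm>^h, which still has length at
  least one.\<close>

lemma len_power_ge:
  assumes h: "mpow h \<noteq> {\<zero>}" and k: "k \<le> h"
  shows "len R \<L> (mpow k) \<ge> h + 1 - k"
  using k
proof (induction rule: inc_induct)
  case base
  have "len R \<L> (mpow h) \<noteq> 0" using LF.len_eq_0D[OF power_submodule_ring, of h] h by auto
  then show ?case by simp
next
  case (step k)
  have "len R \<L> (mpow (Suc k)) < len R \<L> (mpow k)"
  proof (rule ccontr)
    assume "\<not> ?thesis"
    then have "mpow k = mpow (Suc k)"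
      by (intro LF.len_eqD[OF power_submodule_ring power_submodule_ring power_decreasing]) simp
    then have "mpow k = {\<zero>\<^bsub>\<L>\<^esub>}" using power_Suc[of k] by (intro LA.mm_eq_self[OF power_submodule_ring]) simp
    then show False using power_antimono[of k h] step.hyps zero_in_power[of h] h by auto
  qed
  then show ?case using step by linarith
qed

lemma generators_in_power_2:
  assumes h: "mpow h \<noteq> {\<zero>}" "mpow (Suc h) = {\<zero>}" "2 \<le> h"
    and I: "submodule I R \<L>" "I \<subseteq> mpow 2"
  shows "ilen R \<L> (LA.mm I) I + h \<le> len R \<L> (mpow 2) + 2"
proof -
  define j where "j = (LEAST j. mpow (2 + j) \<subseteq> I)"
  have I0: "\<zero> \<in> I" using I(1) by (simp add: L.submodule_iff)
  \<comment> \<open>The exponent equals h + 1, where the power is zero, so a suitable j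
    exists.\<close>
  have "mpow (2 + (h - 1)) \<subseteq> I" using h I0 by (simp add: Suc_diff_le numeral_2_eq_2)
  then have j: "mpow (2 + j) \<subseteq> I" unfolding j_def by (rule LeastI)
  let ?S = "\<lambda>k. I <+>\<^bsub>\<L>\<^esub> mpow k"
  have S: "submodule (?S k) R \<L>" for k by (rule L.submodule_sum[OF I(1) power_submodule_ring])
  have drop: "len R \<L> (?S (2 + i)) + i \<le> len R \<L> (?S 2)" if "i \<le> j" for i
    using that
  proof (induction i)
    case (Suc i)
    let ?k = "2 + i"
    have sub: "?S (Suc ?k) \<subseteq> ?S ?k" by (rule L.sum_mono) (use power_decreasing in auto)
    have "len R \<L> (?S (Suc ?k)) < len R \<L> (?S ?k)"
    proof (rule ccontr)
      assume "\<not> ?thesis"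
      then have e: "?S ?k = ?S (Suc ?k)" by (intro LF.len_eqD[OF S S sub]) simp
      have "mpow (Suc ?k) \<subseteq> LA.mm (?S ?k)"
        unfolding power_Suc by (rule LA.mm_mono[OF S L.subset_sum(2)[OF I(1) power_submodule_ring]])
      then have "?S ?k \<subseteq> I <+>\<^bsub>\<L>\<^esub> LA.mm (?S ?k)" using e L.sum_mono[of I I] by blast
      then have "?S ?k = I" by (rule LA.nakayama[OF S I(1) L.subset_sum(1)[OF I(1) power_submodule_ring]])
      then have "mpow ?k \<subseteq> I" using L.subset_sum(2)[OF I(1) power_submodule_ring] by blast
      then have "j \<le> i" unfolding j_def by (rule Least_le)
      then show False using Suc.prems by simp
    qed
    then show ?case using Suc by simp
  qed simp
  have "?S (2 + j) = I"
    by (rule subset_antisym[OF L.sum_least[OF I(1) order_refl j] L.subset_sum(1)[OF I(1) power_submodule_ring]])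
  moreover have "?S 2 = mpow 2"
    by (rule subset_antisym[OF L.sum_least[OF power_submodule_ring I(2) order_refl] L.subset_sum(2)[OF I(1) power_submodule_ring]])
  ultimately have 1: "len R \<L> I + j \<le> len R \<L> (mpow 2)" using drop[of j] by simp
  have mI: "submodule (LA.mm I) R \<L>" by (rule LA.mm_submodule[OF I(1)])
  have 2: "len R \<L> I = len R \<L> (LA.mm I) + ilen R \<L> (LA.mm I) I"
    by (rule LF.len_add[OF I(1) mI LA.mm_subset[OF I(1)]])
  have 3: "h \<le> len R \<L> (LA.mm I) + 2 + j"
  \<comment> \<open>In the other case h \<le> 2 + j already gives the bound.\<close>
  proof (cases "3 + j \<le> h")
    case True
    have "mpow (3 + j) \<subseteq> LA.mm I" using LA.mm_mono[OF I(1) j] power_Suc[of "2 + j"] by (simp add: numeral_3_eq_3)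
    then have "len R \<L> (mpow (3 + j)) \<le> len R \<L> (LA.mm I)" by (rule LF.len_mono[OF mI power_submodule_ring])
    then show ?thesis using len_power_ge[OF h(1) True] by linarith
  qed simp
  show ?thesis using 1 2 3 by linarith
qed

end

text \<open>The hypothesis on R in natural numbers, with the subtraction cleared and
  \<open>emb_dim\<close> in place of the number of generators of \<mm>.\<close>

locale many_generators = artinian_local_ring +
  assumes many: "len R (ring_module R) (mpow 2) + 4 \<le> emb_dim + loewy_length R \<mm>"
begin

lemma generators_ideal:
  assumes I: "submodule I R \<L>" "I \<subseteq> mpow 2"
  shows "ilen R \<L> (LA.mm I) I + 2 \<le> emb_dim"
proof -
  obtain h where h: "mpow h \<noteq> {\<zero>}" "mpow (Suc h) = {\<zero>}" "loewy_length R \<mm> = h" by (rule power_zero_iff)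
  show ?thesis
  proof (cases "2 \<le> h")
    case True
    then show ?thesis using generators_in_power_2[OF h(1,2) True I] many h(3) by linarith
  next
    \<comment> \<open>Here \<mm>^2 = 0, so I = 0, and the hypothesis with Loewy length at most 1
      gives \<open>emb_dim\<close> at least 3.\<close>
    case False
    then have "mpow 2 \<subseteq> {\<zero>}" using power_antimono[of "Suc h" 2] h(2) by simp
    then have Iz: "I = {\<zero>\<^bsub>\<L>\<^esub>}" using I by (auto simp: L.submodule_iff)
    have "ilen R \<L> (LA.mm I) I = 0"
      using LF.len_add[OF I(1) LA.mm_submodule[OF I(1)] LA.mm_subset[OF I(1)]] ilen_self[OF I(1)] Iz by simp
    then show ?thesis using many h(3) False by linarith
  qed
qed

text \<open>Induction on the rank by projecting to the last coordinate. Numbers of generators are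
  subadditive along Y \<inter> K -> Y -> image, since \<mm> (Y \<inter> K) lies in \<mm> Y \<inter>
  K; the image is an ideal inside \<mm>^2.\<close>

lemma generators_bound:
  assumes "submodule Y R (free_power R n)" "Y \<subseteq> {..<n} \<rightarrow>\<^sub>E mpow 2"
  shows "ilen R (free_power R n) (smult_span R (free_power R n) \<mm> Y) Y + 2 * n \<le> emb_dim * n"
  using assms
proof (induction n arbitrary: Y)
  case 0
  interpret F: al_fl_module R \<mm> "free_power R 0" by (rule free_al_fl)
  have "({..<0::nat} \<rightarrow>\<^sub>E mpow 2) = {\<zero>\<^bsub>free_power R 0\<^esub>}" unfolding free_power_eq by auto
  then have "Y \<subseteq> {\<zero>\<^bsub>free_power R 0\<^esub>}" using 0(2) by simp
  then have Y: "Y = {\<zero>\<^bsub>free_power R 0\<^esub>}" using 0(1) by (auto simp: F.submodule_iff)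
  have "ilen R (free_power R 0) (F.mm Y) Y = 0"
    using F.len_add[OF 0(1) F.mm_submodule[OF 0(1)] F.mm_subset[OF 0(1)]] ilen_self[OF 0(1)] unfolding Y by simp
  then show ?case by simp
next
  case (Suc n)
  interpret F: al_fl_module R \<mm> "free_power R (Suc n)" by (rule free_al_fl)
  interpret G: al_fl_module R \<mm> "free_power R n" by (rule free_al_fl)
  let ?F = "free_power R (Suc n)" and ?G = "free_power R n"
  have Y: "submodule Y R ?F" by (rule Suc)
  have ph: "(\<lambda>v. v n) \<in> module_hom R ?F \<L>" unfolding free_power_eq by (rule L.proj_hom) simp
  interpret p: module_homomorphism R ?F \<L> "\<lambda>v. v n"
    by (intro module_homI F.module_axioms L.module_axioms ph)
  let ?r = "\<lambda>v. \<lambda>i\<in>{..<n}. v i"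
  have rh: "?r \<in> module_hom R ?F ?G"
    by (auto simp: module_hom_def free_power_eq fun_eq_iff PiE_iff)
  interpret r: module_homomorphism R ?F ?G ?r
    by (intro module_homI F.module_axioms G.module_axioms rh)
  let ?K = "module_kernel ?F \<L> (\<lambda>v. v n)"
  let ?Y = "Y \<inter> ?K"
  have K: "submodule ?K R ?F" by (rule p.kernel_submodule)
  have Y': "submodule ?Y R ?F" by (rule F.submodule_Int[OF Y K])
  have Yc: "?Y \<subseteq> carrier ?F" by (rule F.submodule_carrier[OF Y'])
  \<comment> \<open>On vectors with last coordinate zero, forgetting that coordinate is injective
    and therefore preserves lengths; this moves Y \<inter> K to rank n.\<close>
  have inj: "A \<inter> module_kernel ?F ?G ?r = {\<zero>\<^bsub>?F\<^esub>}" if A: "submodule A R ?F" "A \<subseteq> ?Y" for A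
  proof
    show "A \<inter> module_kernel ?F ?G ?r \<subseteq> {\<zero>\<^bsub>?F\<^esub>}"
    proof
      fix v assume "v \<in> A \<inter> module_kernel ?F ?G ?r"
      then have v: "v \<in> carrier ?F" "v n = \<zero>" "?r v = \<zero>\<^bsub>?G\<^esub>"
        using A(2) by (auto simp: module_kernel_def)
      have "v i = \<zero>\<^bsub>?F\<^esub> i" if "i < Suc n" for i
      proof (cases "i = n")
        case False
        then show ?thesis using fun_cong[OF v(3), of i] that by (simp add: free_power_eq)
      qed (use v(2) in \<open>simp add: free_power_eq\<close>)
      then have "v = \<zero>\<^bsub>?F\<^esub>"
        using v(1) F.M.zero_closed unfolding L.free_carrier by (intro power_ext)
      then show "v \<in> {\<zero>\<^bsub>?F\<^esub>}" by blast
    qed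
    show "{\<zero>\<^bsub>?F\<^esub>} \<subseteq> A \<inter> module_kernel ?F ?G ?r"
      using A(1) r.kernel_submodule by (simp add: F.submodule_iff)
  qed
  have mY': "submodule (F.mm ?Y) R ?F" by (rule F.mm_submodule[OF Y'])
  have l1: "len R ?F ?Y = len R ?G (?r ` ?Y)"
    using r.len_image[OF Y' F.fin[OF Y' F.submodule_zero]] unfolding inj[OF Y' order_refl] by simp
  have l2: "len R ?F (F.mm ?Y) = len R ?G (G.mm (?r ` ?Y))"
    using r.len_image[OF mY' F.fin[OF mY' F.submodule_zero]]
    unfolding inj[OF mY' F.mm_subset[OF Y']] r.image_smult_span[OF m_carrier Yc] by simp
  have rY: "submodule (?r ` ?Y) R ?G" by (rule r.image_submodule[OF Y'])
  have "?r ` ?Y \<subseteq> {..<n} \<rightarrow>\<^sub>E mpow 2"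
  proof (rule image_subsetI)
    fix v assume "v \<in> ?Y"
    then have "v \<in> {..<Suc n} \<rightarrow>\<^sub>E mpow 2" using Suc.prems(2) by blast
    then show "?r v \<in> {..<n} \<rightarrow>\<^sub>E mpow 2" by (auto simp: PiE_iff)
  qed
  from Suc.IH[OF rY this] have IH: "ilen R ?G (G.mm (?r ` ?Y)) (?r ` ?Y) + 2 * n \<le> emb_dim * n" .
  have lr: "len R ?G (?r ` ?Y) = len R ?G (G.mm (?r ` ?Y)) + ilen R ?G (G.mm (?r ` ?Y)) (?r ` ?Y)"
    by (rule G.len_add[OF rY G.mm_submodule[OF rY] G.mm_subset[OF rY]])
  let ?I = "(\<lambda>v. v n) ` Y"
  have pI: "submodule ?I R \<L>" by (rule p.image_submodule[OF Y])
  have "?I \<subseteq> mpow 2" using Suc.prems(2) by (auto simp: PiE_iff)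
  then have gI: "ilen R \<L> (LA.mm ?I) ?I + 2 \<le> emb_dim" by (rule generators_ideal[OF pI])
  have lI: "len R \<L> ?I = len R \<L> (LA.mm ?I) + ilen R \<L> (LA.mm ?I) ?I"
    by (rule LF.len_add[OF pI LA.mm_submodule[OF pI] LA.mm_subset[OF pI]])
  have mY: "submodule (F.mm Y) R ?F" by (rule F.mm_submodule[OF Y])
  have l3: "len R ?F Y = len R ?F ?Y + len R \<L> ?I"
    by (rule p.len_image[OF Y F.fin[OF Y F.submodule_zero]])
  have l4: "len R ?F (F.mm Y) = len R ?F (F.mm Y \<inter> ?K) + len R \<L> (LA.mm ?I)"
    using p.len_image[OF mY F.fin[OF mY F.submodule_zero]]
    unfolding p.image_smult_span[OF m_carrier F.submodule_carrier[OF Y]] .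
  have "F.mm ?Y \<subseteq> F.mm Y \<inter> ?K"
    using F.mm_mono[OF Y, of ?Y] F.mm_subset[OF Y'] by blast
  then have l5: "len R ?F (F.mm ?Y) \<le> len R ?F (F.mm Y \<inter> ?K)"
    by (rule F.len_mono[OF F.submodule_Int[OF mY K] mY'])
  have l6: "len R ?F Y = len R ?F (F.mm Y) + ilen R ?F (F.mm Y) Y"
    by (rule F.len_add[OF Y mY F.mm_subset[OF Y]])
  have "ilen R ?F (F.mm Y) Y \<le> ilen R ?G (G.mm (?r ` ?Y)) (?r ` ?Y) + ilen R \<L> (LA.mm ?I) ?I"
    using l1 l2 l3 l4 l5 l6 lr lI by linarith
  then show ?case using IH gI by (simp add: algebra_simps)
qed

end

section \<open>Minimal resolutions and modules annihilated by \<open>\<mm>\<^sup>2\<close>\<close>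

locale minimal_res = artinian_local_ring R \<mm> + resolution R N b d \<epsilon>
  for R :: "('a, 'r) ring_scheme" (structure) and \<mm> and N :: "('a, 'n) module" and b d \<epsilon> +
  assumes minimal: "d i ` carrier (free_power R (b (Suc i))) \<subseteq> {..<b i} \<rightarrow>\<^sub>E \<mm>"
begin

sublocale Ff: al_fl_module R \<mm> "free_power R (b n)" for n
  by (rule free_al_fl)

lemma diff_unit_mem: "k < b i \<Longrightarrow> d i (unit_vec R (b (Suc i)) j) k \<in> \<mm>"
proof -
  assume k: "k < b i"
  have "d i (unit_vec R (b (Suc i)) j) \<in> {..<b i} \<rightarrow>\<^sub>E \<mm>"
    by (rule subsetD[OF minimal], rule imageI) (simp add: L.free_carrier)
  then show ?thesis using k by (auto simp: PiE_iff)
qed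

lemma kernel_subset: "module_kernel (Fr (Suc i)) (Fr i) (d i) \<subseteq> {..<b (Suc i)} \<rightarrow>\<^sub>E \<mm>"
  unfolding image_diff_Suc[symmetric] by (rule minimal)

lemma socle_exists: obtains s where "s \<in> carrier R" "s \<noteq> \<zero>" "\<And>a. a \<in> \<mm> \<Longrightarrow> s \<otimes> a = \<zero>"
proof -
  obtain h where h: "mpow h \<noteq> {\<zero>}" "mpow (Suc h) = {\<zero>}" by (rule power_zero_iff)
  then obtain s where s: "s \<in> mpow h" "s \<noteq> \<zero>" using zero_in_power[of h] by blast
  have sc: "s \<in> carrier R" using s L.submodule_carrier[OF power_submodule_ring[of h]] by auto
  have "s \<otimes> a = \<zero>" if "a \<in> \<mm>" for a
  proof -
    have "a \<odot>\<^bsub>\<L>\<^esub> s \<in> mpow (Suc h)" unfolding power_Suc by (rule smult_spanI[OF that s(1)])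
    then show ?thesis using h(2) m_comm[OF sc, of a] m_carrier that by auto
  qed
  then show thesis using that s sc by blast
qed

text \<open>A socle element times a unit vector is a nonzero vector killed by every map with entries
  in \<mm>.\<close>

lemma socle_unit_vec:
  assumes h: "module_homomorphism R (free_power R n) (free_power R m) \<phi>"
    and im: "\<phi> ` carrier (free_power R n) \<subseteq> {..<m} \<rightarrow>\<^sub>E \<mm>" and n: "0 < n"
    and inj: "module_kernel (free_power R n) (free_power R m) \<phi> \<subseteq> {\<zero>\<^bsub>free_power R n\<^esub>}"
  shows False
proof -
  interpret h: module_homomorphism R "free_power R n" "free_power R m" \<phi> by (rule h)
  obtain s where s: "s \<in> carrier R" "s \<noteq> \<zero>" "\<And>a. a \<in> \<mm> \<Longrightarrow> s \<otimes> a = \<zero>" by (rule socle_exists) blast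
  let ?e = "unit_vec R n 0"
  have ec: "?e \<in> carrier (free_power R n)" by (simp add: L.free_carrier)
  have pe: "\<phi> ?e \<in> {..<m} \<rightarrow>\<^sub>E \<mm>" using im ec by blast
  have "\<phi> (s \<odot>\<^bsub>free_power R n\<^esub> ?e) = s \<odot>\<^bsub>free_power R m\<^esub> \<phi> ?e" by (rule h.smult[OF s(1) ec])
  also have "\<dots> = \<zero>\<^bsub>free_power R m\<^esub>" using pe s(3) by (auto simp: free_power_eq fun_eq_iff PiE_iff)
  finally have "s \<odot>\<^bsub>free_power R n\<^esub> ?e \<in> module_kernel (free_power R n) (free_power R m) \<phi>"
    using h.M.smult_closed[OF s(1) ec] by (simp add: module_kernel_def)
  then have "s \<odot>\<^bsub>free_power R n\<^esub> ?e = \<zero>\<^bsub>free_power R n\<^esub>" using inj by blast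
  from fun_cong[OF this, of 0] show False using n s by (simp add: free_power_eq unit_vec_def)
qed

text \<open>If F_(i+2) = 0, then \<open>d i\<close> is injective with entries in \<mm>, which the
  socle forbids in positive rank. Hence a minimal resolution that ends at all ends at F_0.\<close>

lemma betti_zero_back: "b (Suc (Suc i)) = 0 \<Longrightarrow> b (Suc i) = 0"
proof (rule ccontr)
  assume z: "b (Suc (Suc i)) = 0" and nz: "b (Suc i) \<noteq> 0"
  have "carrier (Fr (Suc (Suc i))) = {\<zero>\<^bsub>Fr (Suc (Suc i))\<^esub>}" using z by (auto simp: free_power_eq)
  then have "module_kernel (Fr (Suc i)) (Fr i) (d i) \<subseteq> {\<zero>\<^bsub>Fr (Suc i)\<^esub>}"
    unfolding image_diff_Suc[symmetric] using diff.zero[of "Suc i"] by simp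
  then show False using socle_unit_vec[OF diff.module_homomorphism_axioms minimal] nz by blast
qed

lemma betti_zero_1: "b (Suc i) = 0 \<Longrightarrow> b (Suc 0) = 0"
  by (induction i) (auto dest: betti_zero_back)

lemma free_of_betti_1: "b (Suc 0) = 0 \<Longrightarrow> free_module R N"
proof (rule N.free_of_iso[OF aug_hom aug_surj _ one_neq_zero])
  assume z: "b (Suc 0) = 0"
  have "carrier (Fr (Suc 0)) = {\<zero>\<^bsub>Fr (Suc 0)\<^esub>}" using z by (auto simp: free_power_eq)
  then show "module_kernel (Fr 0) N \<epsilon> \<subseteq> {\<zero>\<^bsub>Fr 0\<^esub>}"
    unfolding image_diff_0[symmetric] using diff.zero[of 0] by simp
qed

text \<open>The module $\mathfrak m N_{i+1}$, for $N_{i+1}$ the image of \<open>d i\<close>.\<close>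

definition rad_syz :: "nat \<Rightarrow> (nat \<Rightarrow> 'a) set" where
  "rad_syz i = d i ` ({..<b (Suc i)} \<rightarrow>\<^sub>E \<mm>)"

lemma free_m_submodule: "submodule ({..<n} \<rightarrow>\<^sub>E \<mm>) R (free_power R n)"
  using free_power_submodule[of n 1] power_1 by simp

lemma mm_free_m: "smult_span R (free_power R n) \<mm> ({..<n} \<rightarrow>\<^sub>E \<mm>) = {..<n} \<rightarrow>\<^sub>E mpow 2"
  using mm_free[of n 1] power_1 by (simp add: numeral_2_eq_2)

lemma mm_free_m2: "smult_span R (free_power R n) \<mm> ({..<n} \<rightarrow>\<^sub>E mpow 2) = {..<n} \<rightarrow>\<^sub>E mpow 3"
  using mm_free[of n 2] by (simp add: numeral_2_eq_2 numeral_3_eq_3)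

lemma rad_syz_submodule: "submodule (rad_syz i) R (Fr i)"
  unfolding rad_syz_def by (rule diff.image_submodule[OF free_m_submodule])

lemma rad_syz_eq: "rad_syz i = Ff.mm i (d i ` carrier (Fr (Suc i)))"
  unfolding rad_syz_def mm_carrier_free[symmetric] L.free_carrier[symmetric]
  by (rule diff.image_smult_span[OF m_carrier order_refl])

lemma rad_syz_subset: "rad_syz i \<subseteq> {..<b i} \<rightarrow>\<^sub>E mpow 2"
  unfolding rad_syz_eq mm_free_m[symmetric] by (rule Ff.mm_mono[OF free_m_submodule minimal])

lemma mm_rad_syz: "Ff.mm i (rad_syz i) = d i ` ({..<b (Suc i)} \<rightarrow>\<^sub>E mpow 2)"
  unfolding rad_syz_def mm_free_m[symmetric]
  by (rule diff.image_smult_span[OF m_carrier Fr.submodule_carrier[OF free_m_submodule], symmetric])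

lemma rad_syz_zeroD:
  "ilen R (Fr i) (Ff.mm i (rad_syz i)) (rad_syz i) = 0 \<Longrightarrow> rad_syz i = {\<zero>\<^bsub>Fr i\<^esub>}"
proof -
  assume z: "ilen R (Fr i) (Ff.mm i (rad_syz i)) (rad_syz i) = 0"
  have s: "submodule (rad_syz i) R (Fr i)" by (rule rad_syz_submodule)
  have "rad_syz i = Ff.mm i (rad_syz i)"
    by (rule Ff.len_eqD[OF s Ff.mm_submodule[OF s] Ff.mm_subset[OF s]])
      (use z Ff.len_add[OF s Ff.mm_submodule[OF s] Ff.mm_subset[OF s]] in simp)
  then show ?thesis by (intro Ff.mm_eq_self[OF s]) simp
qed

text \<open>The map \<open>d i\<close> is counted on \<mm> F_(i+1) and on \<mm>^2 F_(i+1). Its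
  kernels there are the syzygy N_(i+2) and, by the reflection hypothesis, \<mm> N_(i+2), while the
  images are \<open>rad_syz i\<close> and its radical. Subtracting, e b_(i+1) splits into b_(i+2),
  the number of generators of N_(i+2), and that of \<open>rad_syz i\<close>.\<close>

lemma rad_syz_generators:
  assumes refl: "\<And>y. y \<in> carrier (Fr (Suc (Suc i))) \<Longrightarrow> d (Suc i) y \<in> {..<b (Suc i)} \<rightarrow>\<^sub>E mpow 2 \<Longrightarrow>
      y \<in> {..<b (Suc (Suc i))} \<rightarrow>\<^sub>E \<mm>"
  shows "ilen R (Fr i) (Ff.mm i (rad_syz i)) (rad_syz i) + b (Suc (Suc i)) = emb_dim * b (Suc i)"
proof -
  let ?F1 = "Fr (Suc i)" and ?F2 = "Fr (Suc (Suc i))"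
  let ?m1 = "{..<b (Suc i)} \<rightarrow>\<^sub>E \<mm>" and ?q1 = "{..<b (Suc i)} \<rightarrow>\<^sub>E mpow 2" and ?m2 = "{..<b (Suc (Suc i))} \<rightarrow>\<^sub>E \<mm>"
  let ?K1 = "module_kernel ?F1 (Fr i) (d i)" and ?K2 = "module_kernel ?F2 ?F1 (d (Suc i))"
  have s: "submodule (rad_syz i) R (Fr i)" by (rule rad_syz_submodule)
  have q1: "submodule ?q1 R ?F1" by (rule free_power_submodule)
  note m1 = free_m_submodule[of "b (Suc i)"] and m2 = free_m_submodule[of "b (Suc (Suc i))"]
  have K1m: "?m1 \<inter> ?K1 = d (Suc i) ` carrier ?F2" unfolding image_diff_Suc[symmetric] using minimal by blast
  have K1q: "?q1 \<inter> ?K1 = rad_syz (Suc i)"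
  proof
    show "?q1 \<inter> ?K1 \<subseteq> rad_syz (Suc i)"
    proof
      fix z assume z: "z \<in> ?q1 \<inter> ?K1"
      then obtain y where y: "y \<in> carrier ?F2" "z = d (Suc i) y" unfolding image_diff_Suc[symmetric] by blast
      then have "y \<in> ?m2" using refl z by blast
      then show "z \<in> rad_syz (Suc i)" unfolding rad_syz_def using y(2) by blast
    qed
    show "rad_syz (Suc i) \<subseteq> ?q1 \<inter> ?K1"
    proof (rule Int_greatest[OF rad_syz_subset])
      show "rad_syz (Suc i) \<subseteq> ?K1"
        unfolding rad_syz_def image_diff_Suc[symmetric]
        by (rule image_mono) (rule Fr.submodule_carrier[OF free_m_submodule])
    qed
  qed
  have 1: "len R ?F1 ?m1 = len R ?F1 (d (Suc i) ` carrier ?F2) + len R (Fr i) (rad_syz i)"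
    using diff.len_image[OF m1 Ff.fin[OF m1 Fr.submodule_zero]] unfolding K1m rad_syz_def .
  have 2: "len R ?F1 ?q1 = len R ?F1 (rad_syz (Suc i)) + len R (Fr i) (Ff.mm i (rad_syz i))"
    using diff.len_image[OF q1 Ff.fin[OF q1 Fr.submodule_zero]] unfolding K1q mm_rad_syz .
  have k2: "carrier ?F2 \<inter> ?K2 = ?K2" "?m2 \<inter> ?K2 = ?K2"
    using Fr.submodule_carrier[OF diff.kernel_submodule] kernel_subset by blast+
  have 3: "len R ?F2 (carrier ?F2) = len R ?F2 ?K2 + len R ?F1 (d (Suc i) ` carrier ?F2)"
    using diff.len_image[OF Fr.carrier_is_submodule Ff.finite_len, of "Suc i"] unfolding k2 .
  have 4: "len R ?F2 ?m2 = len R ?F2 ?K2 + len R ?F1 (rad_syz (Suc i))"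
    using diff.len_image[OF m2 Ff.fin[OF m2 Fr.submodule_zero]] unfolding k2 rad_syz_def .
  have 5: "len R ?F2 (carrier ?F2) = len R ?F2 ?m2 + b (Suc (Suc i))"
    unfolding L.free_carrier using len_free[OF L.carrier_is_submodule, of "b (Suc (Suc i))"]
      len_free[OF m_submodule, of "b (Suc (Suc i))"] len_ring by simp
  have 6: "len R ?F1 ?m1 = len R ?F1 ?q1 + emb_dim * b (Suc i)"
    unfolding len_free[OF m_submodule] len_free[OF power_submodule_ring] len_m by (simp add: algebra_simps)
  have 7: "len R (Fr i) (rad_syz i) = len R (Fr i) (Ff.mm i (rad_syz i)) + ilen R (Fr i) (Ff.mm i (rad_syz i)) (rad_syz i)"
    by (rule Ff.len_add[OF s Ff.mm_submodule[OF s] Ff.mm_subset[OF s]])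
  show ?thesis using 1 2 3 4 5 6 7 by linarith
qed

end

section \<open>Coefficients in a module annihilated by the square of \<mm>\<close>

locale square_zero_setup = minimal_res R \<mm> N b d \<epsilon> + V: al_fl_module R \<mm> V
  for R :: "('a, 'r) ring_scheme" (structure) and \<mm> and N :: "('a, 'n) module" and b d \<epsilon>
    and V :: "('a, 'v) module" +
  assumes square_zero: "V.mm (V.mm (carrier V)) = {\<zero>\<^bsub>V\<^esub>}"
begin

text \<open>Expresses the vanishing of Tor in degree i + 1: the index is that of the outgoing
  differential \<open>d i\<close>.\<close>

definition tor_exact :: "nat \<Rightarrow> bool" where
  "tor_exact i \<longleftrightarrow> exact_at R V (b (Suc (Suc i))) (b (Suc i)) (b i) (d (Suc i)) (d i)"

abbreviation "W \<equiv> V.mm (carrier V)"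
abbreviation "\<delta> i \<equiv> induced_map R V (b (Suc i)) (b i) (d i)"
abbreviation "Vp n \<equiv> power_module V n"

sublocale Vp: plain_module R "power_module V n" for n by (rule V.power_plain_module)

sublocale \<delta>: module_homomorphism R "power_module V (b (Suc n))" "power_module V (b n)"
    "induced_map R V (b (Suc n)) (b n) (d n)" for n
  by (intro module_homI V.power_module_module V.induced_map_hom diff_hom)

lemma W_submodule: "submodule W R V"
  by (rule V.mm_submodule[OF V.carrier_is_submodule])

lemma boundary_subset: "\<delta> i ` carrier (Vp (b (Suc i))) \<subseteq> {..<b i} \<rightarrow>\<^sub>E W"
proof (rule image_subsetI)
  fix v assume v: "v \<in> carrier (Vp (b (Suc i)))"
  have "V.lsum (\<lambda>j. d i (unit_vec R (b (Suc i)) j) k \<odot>\<^bsub>V\<^esub> v j) (b (Suc i)) \<in> W" if "k < b i" for k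
    by (rule V.lsum_mem[OF W_submodule]) (use v diff_unit_mem[OF that] in \<open>auto simp: PiE_iff intro!: smult_spanI\<close>)
  then show "\<delta> i v \<in> {..<b i} \<rightarrow>\<^sub>E W" by (auto simp: induced_map_def)
qed

lemma boundary_W: "v \<in> {..<b (Suc i)} \<rightarrow>\<^sub>E W \<Longrightarrow> \<delta> i v = \<zero>\<^bsub>Vp (b i)\<^esub>"
proof -
  assume v: "v \<in> {..<b (Suc i)} \<rightarrow>\<^sub>E W"
  have "V.lsum (\<lambda>j. d i (unit_vec R (b (Suc i)) j) k \<odot>\<^bsub>V\<^esub> v j) (b (Suc i)) = \<zero>\<^bsub>V\<^esub>" if k: "k < b i" for k
  proof (rule V.lsum_zero)
    fix j assume "j < b (Suc i)"
    then have "v j \<in> W" using v by (auto simp: PiE_iff)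
    then have "d i (unit_vec R (b (Suc i)) j) k \<odot>\<^bsub>V\<^esub> v j \<in> V.mm W" by (intro smult_spanI diff_unit_mem[OF k])
    then show "d i (unit_vec R (b (Suc i)) j) k \<odot>\<^bsub>V\<^esub> v j = \<zero>\<^bsub>V\<^esub>" using square_zero by simp
  qed
  then show ?thesis by (simp add: induced_map_def fun_eq_iff)
qed

text \<open>Boundaries lie in W^b and W^b consists of cycles whatever Tor is; exactness closes the
  circle of inclusions.\<close>

lemma tor_exact_cycles:
  assumes "tor_exact i"
  shows "module_kernel (Vp (b (Suc i))) (Vp (b i)) (\<delta> i) = {..<b (Suc i)} \<rightarrow>\<^sub>E W"
    and "\<delta> (Suc i) ` carrier (Vp (b (Suc (Suc i)))) = {..<b (Suc i)} \<rightarrow>\<^sub>E W"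
proof -
  have Wc: "{..<b (Suc i)} \<rightarrow>\<^sub>E W \<subseteq> carrier (Vp (b (Suc i)))"
    by (rule Vp.submodule_carrier[OF V.power_submodule[OF W_submodule]])
  have 1: "{..<b (Suc i)} \<rightarrow>\<^sub>E W \<subseteq> module_kernel (Vp (b (Suc i))) (Vp (b i)) (\<delta> i)"
    using Wc boundary_W unfolding module_kernel_def by blast
  have 2: "module_kernel (Vp (b (Suc i))) (Vp (b i)) (\<delta> i) \<subseteq> \<delta> (Suc i) ` carrier (Vp (b (Suc (Suc i))))"
    using assms unfolding tor_exact_def exact_at_def module_kernel_def by blast
  show "module_kernel (Vp (b (Suc i))) (Vp (b i)) (\<delta> i) = {..<b (Suc i)} \<rightarrow>\<^sub>E W"
    and "\<delta> (Suc i) ` carrier (Vp (b (Suc (Suc i)))) = {..<b (Suc i)} \<rightarrow>\<^sub>E W"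
    using 1 2 boundary_subset[of "Suc i"] by blast+
qed

definition nuV :: nat where "nuV = ilen R V W (carrier V)"

lemma len_V: "len R V (carrier V) = len R V W + nuV"
  unfolding nuV_def by (rule V.len_add[OF V.carrier_is_submodule W_submodule V.mm_subset[OF V.carrier_is_submodule]])

text \<open>Rank and nullity for \<open>\<delta> (Suc i)\<close>: its kernel is a power of W by
  vanishing in degree i + 2, and its image is a power of W by vanishing in degree i + 1.\<close>

lemma betti_ratio:
  assumes "tor_exact i" "tor_exact (Suc i)"
  shows "b (Suc (Suc i)) * nuV = b (Suc i) * len R V W"
proof -
  let ?n = "b (Suc (Suc i))"
  note lp = V.len_power[OF V.carrier_is_submodule V.finite_len] V.len_power[OF W_submodule V.fin[OF W_submodule V.submodule_zero]]
  have K: "carrier (Vp ?n) \<inter> module_kernel (Vp ?n) (Vp (b (Suc i))) (\<delta> (Suc i)) = {..<?n} \<rightarrow>\<^sub>E W"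
    unfolding tor_exact_cycles(1)[OF assms(2)]
    using Vp.submodule_carrier[OF V.power_submodule[OF W_submodule]] by blast
  have f: "finite_ilen R (Vp ?n) {\<zero>\<^bsub>Vp ?n\<^esub>} (carrier (Vp ?n))" using lp(1)[of ?n] unfolding power_module_simps(1) by blast
  have "len R (Vp ?n) (carrier (Vp ?n)) = len R (Vp ?n) ({..<?n} \<rightarrow>\<^sub>E W) + len R (Vp (b (Suc i))) ({..<b (Suc i)} \<rightarrow>\<^sub>E W)"
    using \<delta>.len_image[OF Vp.carrier_is_submodule f] unfolding K tor_exact_cycles(2)[OF assms(1)] .
  then have "?n * len R V (carrier V) = ?n * len R V W + b (Suc i) * len R V W"
    using conjunct2[OF lp(1)[of ?n]] conjunct2[OF lp(2)[of ?n]] conjunct2[OF lp(2)[of "b (Suc i)"]]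
    unfolding power_module_simps(1) by metis
  then show ?thesis unfolding len_V by (simp add: algebra_simps)
qed

lemma power_2_annihilates:
  assumes a: "a \<in> mpow 2" and x: "x \<in> carrier V" shows "a \<odot>\<^bsub>V\<^esub> x = \<zero>\<^bsub>V\<^esub>"
proof -
  have "LA.mm \<mm> \<subseteq> {a \<in> carrier R. a \<odot>\<^bsub>V\<^esub> x = \<zero>\<^bsub>V\<^esub>}"
  proof (rule smult_span_least)
    show "submodule {a \<in> carrier R. a \<odot>\<^bsub>V\<^esub> x = \<zero>\<^bsub>V\<^esub>} R \<L>"
      unfolding L.submodule_iff using x by (auto simp: V.smult_l_distr V.smult_assoc1)
    fix a c assume ac: "a \<in> \<mm>" "c \<in> \<mm>"
    then have cc: "a \<in> carrier R" "c \<in> carrier R" using m_carrier by auto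
    have "a \<odot>\<^bsub>V\<^esub> (c \<odot>\<^bsub>V\<^esub> x) \<in> V.mm W" by (intro smult_spanI ac x)
    then have "(a \<otimes> c) \<odot>\<^bsub>V\<^esub> x = \<zero>\<^bsub>V\<^esub>" using square_zero cc x by (simp add: V.smult_assoc1)
    then show "a \<odot>\<^bsub>\<L>\<^esub> c \<in> {a \<in> carrier R. a \<odot>\<^bsub>V\<^esub> x = \<zero>\<^bsub>V\<^esub>}" using cc by simp
  qed
  then show ?thesis using a unfolding mpow_2 by blast
qed

text \<open>Choose x in V outside \<mm> V. As \<mm>^2 annihilates V, x \<otimes> y is a cycle and so
  has its coordinates in \<mm> V; a unit coordinate of y would then put x itself into \<mm>
  V.\<close>

lemma diff_reflects_radical:
  assumes ex: "tor_exact i" and V0: "nuV > 0" and y: "y \<in> carrier (Fr (Suc i))"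
    and dy: "d i y \<in> {..<b i} \<rightarrow>\<^sub>E mpow 2"
  shows "y \<in> {..<b (Suc i)} \<rightarrow>\<^sub>E \<mm>"
proof -
  have "carrier V \<noteq> W" using V0 unfolding nuV_def using ilen_self[OF V.carrier_is_submodule] by auto
  then obtain x where x: "x \<in> carrier V" "x \<notin> W" using V.submodule_carrier[OF W_submodule] by blast
  have yE: "y \<in> {..<b (Suc i)} \<rightarrow>\<^sub>E carrier R" using y by (simp add: L.free_carrier)
  have "\<delta> i (pure V (b (Suc i)) x y) = pure V (b i) x (d i y)"
    by (rule V.induced_map_pure[OF diff_hom x(1) yE])
  also have "\<dots> = \<zero>\<^bsub>Vp (b i)\<^esub>" using dy power_2_annihilates[OF _ x(1)] by (auto simp: pure_def fun_eq_iff PiE_iff)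
  finally have "pure V (b (Suc i)) x y \<in> module_kernel (Vp (b (Suc i))) (Vp (b i)) (\<delta> i)"
    using V.pure_closed[OF x(1) yE] by (simp add: module_kernel_def)
  then have p: "pure V (b (Suc i)) x y \<in> {..<b (Suc i)} \<rightarrow>\<^sub>E W" unfolding tor_exact_cycles(1)[OF ex] .
  have "y j \<in> \<mm>" if j: "j < b (Suc i)" for j
  proof (rule ccontr)
    assume n: "y j \<notin> \<mm>"
    have yj: "y j \<in> carrier R" using yE j by (auto simp: PiE_iff)
    obtain u where u: "u \<in> carrier R" "u \<otimes> y j = \<one>" using unit_of_notin_m[OF yj n] .
    have "pure V (b (Suc i)) x y j \<in> W" using p j by (auto simp: PiE_iff)
    then have "y j \<odot>\<^bsub>V\<^esub> x \<in> W" using j by (simp add: pure_def)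
    then have "u \<odot>\<^bsub>V\<^esub> (y j \<odot>\<^bsub>V\<^esub> x) \<in> W" using W_submodule u by (simp add: V.submodule_iff)
    moreover have "u \<odot>\<^bsub>V\<^esub> (y j \<odot>\<^bsub>V\<^esub> x) = x" using u yj x(1) by (simp add: V.smult_assoc1[symmetric])
    ultimately show False using x by simp
  qed
  then show ?thesis using yE by (auto simp: PiE_iff)
qed

lemma rad_syz_generators':
  assumes "tor_exact (Suc i)" "nuV > 0"
  shows "ilen R (Fr i) (Ff.mm i (rad_syz i)) (rad_syz i) + b (Suc (Suc i)) = emb_dim * b (Suc i)"
  by (rule rad_syz_generators) (rule diff_reflects_radical[OF assms])

text \<open>If \<open>rad_syz i\<close> vanishes, the residue field is a direct summand of a syzygy of \<open>N\<close>, so a vanishing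
  Tor forces the kernel of a minimal cover of \<open>V\<close> to equal its own radical.\<close>

lemma free_cover_of_rad_syz_zero:
  assumes ex: "tor_exact (Suc i)" and rs: "rad_syz i = {\<zero>\<^bsub>Fr i\<^esub>}" and pos: "b (Suc i) > 0"
    and \<psi>: "\<psi> \<in> module_hom R (free_power R n) V" "\<psi> ` carrier (free_power R n) = carrier V"
      "module_kernel (free_power R n) V \<psi> \<subseteq> {..<n} \<rightarrow>\<^sub>E \<mm>"
  shows "module_kernel (free_power R n) V \<psi> \<subseteq> {\<zero>\<^bsub>free_power R n\<^esub>}"
proof -
  let ?G = "free_power R n"
  let ?K = "module_kernel ?G V \<psi>"
  let ?KM = "?G\<lparr>carrier := ?K\<rparr>"
  interpret h: module_homomorphism R ?G V \<psi>
    by (intro module_homI L.free_module_module V.module_axioms \<psi>(1))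
  have Ks: "submodule ?K R ?G" by (rule h.kernel_submodule)
  have Kmod: "module R ?KM" by (rule submodule.submodule_is_module[OF Ks h.M.module_axioms])
  interpret K: al_module R \<mm> ?KM by (rule al_moduleI[OF Kmod])
  have exF: "exact_at R ?G (b (Suc (Suc i))) (b (Suc i)) (b i) (d (Suc i)) (d i)"
    by (rule L.exact_at_free[OF diff_hom diff_hom diff_eq_zeroD])
  \<comment> \<open>Dimension shifting along 0 -> K -> R^n -> V -> 0: vanishing in degree i + 2 for
    V becomes vanishing in degree i + 1 for K.\<close>
  have exK: "exact_at R ?KM (b (Suc (Suc i))) (b (Suc i)) (b i) (d (Suc i)) (d i)"
    by (rule h.exact_at_kernel[OF diff_hom diff_hom diff_hom diff_diff \<psi>(2) ex[unfolded tor_exact_def] exF])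
  have "carrier ?KM \<subseteq> K.mm (carrier ?KM)"
  proof
    fix z assume "z \<in> carrier ?KM"
    then have z: "z \<in> ?K" by simp
    have zK: "z \<in> carrier ?KM" using z by simp
    have zm: "z \<in> {..<n} \<rightarrow>\<^sub>E \<mm>" using \<psi>(3) z by blast
    let ?e = "unit_vec R (b (Suc i)) 0"
    have ec: "?e \<in> carrier (Fr (Suc i))" by (simp add: L.free_carrier)
    \<comment> \<open>The vector z_t e_0 lies in \<mm> F_(i+1), whose image under \<open>d i\<close>
      is \<open>rad_syz i\<close>, which is zero; so z_t annihilates the column of
      \<open>d i\<close> at e_0.\<close>
    have kill: "d i ?e k \<otimes> z t = \<zero>" if k: "k < b i" and t: "t < n" for k t
    proof -
      have zt: "z t \<in> \<mm>" "z t \<in> carrier R" using zm t m_carrier by (auto simp: PiE_iff)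
      have "z t \<odot>\<^bsub>Fr (Suc i)\<^esub> ?e \<in> {..<b (Suc i)} \<rightarrow>\<^sub>E \<mm>"
        using zt zero_in_power[of 1] power_1 by (auto simp: free_power_eq unit_vec_def)
      then have "d i (z t \<odot>\<^bsub>Fr (Suc i)\<^esub> ?e) = \<zero>\<^bsub>Fr i\<^esub>" using rs unfolding rad_syz_def by blast
      then have "z t \<odot>\<^bsub>Fr i\<^esub> d i ?e = \<zero>\<^bsub>Fr i\<^esub>" using diff.smult[OF zt(2) ec] by simp
      from fun_cong[OF this, of k] have "z t \<otimes> d i ?e k = \<zero>" using k by (simp add: free_power_eq)
      moreover have "d i ?e k \<in> carrier R" using diff_unit_mem[OF k] m_carrier by blast
      ultimately show ?thesis using zt m_comm by simp
    qed
    \<comment> \<open>Hence z \<otimes> e_0 is a cycle with coefficients in K, and it must be a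
      boundary.\<close>
    have "induced_map R ?KM (b (Suc i)) (b i) (d i) (K.emb (b (Suc i)) 0 z) = pure ?KM (b i) z (d i ?e)"
      by (rule K.induced_map_emb[OF diff_hom pos zK])
    also have "\<dots> = \<zero>\<^bsub>power_module ?KM (b i)\<^esub>"
      using kill by (auto simp: pure_def fun_eq_iff free_power_eq)
    finally obtain T where T: "T \<in> carrier (power_module ?KM (b (Suc (Suc i))))"
      "induced_map R ?KM (b (Suc (Suc i))) (b (Suc i)) (d (Suc i)) T = K.emb (b (Suc i)) 0 z"
      using exK K.emb_closed[OF zK, of "b (Suc i)" 0] unfolding exact_at_def power_module_simps(1) by blast
    \<comment> \<open>Coordinate 0 of that boundary is z, a combination of elements of K with
      coefficients among the entries of \<open>d (Suc i)\<close>, which lie in \<mm>.\<close>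
    have "z = K.emb (b (Suc i)) 0 z 0" using pos by (simp add: K.emb_apply)
    also have "\<dots> = K.lsum (\<lambda>j. d (Suc i) (unit_vec R (b (Suc (Suc i))) j) 0 \<odot>\<^bsub>?KM\<^esub> T j) (b (Suc (Suc i)))"
      unfolding T(2)[symmetric] using pos by (simp add: induced_map_def)
    also have "\<dots> \<in> K.mm (carrier ?KM)"
    proof (rule K.lsum_mem[OF K.mm_submodule[OF K.carrier_is_submodule]])
      fix j assume "j < b (Suc (Suc i))"
      then have "T j \<in> carrier ?KM" using T(1) unfolding power_module_simps(1) by (auto simp: PiE_iff)
      then show "d (Suc i) (unit_vec R (b (Suc (Suc i))) j) 0 \<odot>\<^bsub>?KM\<^esub> T j \<in> K.mm (carrier ?KM)"
        by (intro smult_spanI diff_unit_mem[OF pos])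
    qed
    finally show "z \<in> K.mm (carrier ?KM)" .
  qed
  from K.mm_eq_self[OF K.carrier_is_submodule this] show ?thesis by simp
qed

end

section \<open>Arithmetic of the ratio of consecutive Betti numbers\<close>

lemma coprime_ratio:
  fixes v w :: nat
  assumes "v > 0"
  obtains g p q where "v = g * q" "w = g * p" "coprime q p" "g > 0" "q > 0"
proof -
  have "gcd v w \<noteq> 0" using assms by simp
  then obtain q p where "v = q * gcd v w" "w = p * gcd v w" "coprime q p"
    using gcd_coprime_exists[of v w] by blast
  then show thesis using that[of "gcd v w" q p] assms by (metis gcd_pos_nat mult.commute mult_0_right neq0_conv)
qed

text \<open>Write w/v = p/q in lowest terms. Then m proportions give \<beta>(m) q^m = \<beta>(0)
  p^m, so q^m divides \<beta>(0), and \<beta>(0) < 2^m leaves only q = 1.\<close>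

lemma ratio_integral:
  fixes \<beta> :: "nat \<Rightarrow> nat"
  assumes v: "v > 0" and step: "\<And>k. k < m \<Longrightarrow> \<beta> (Suc k) * v = \<beta> k * w" and \<beta>: "0 < \<beta> 0" "\<beta> 0 < 2 ^ m"
  shows "v dvd w"
proof -
  obtain g p q where g: "v = g * q" "w = g * p" "coprime q p" "g > 0" "q > 0" by (rule coprime_ratio[OF v])
  have s: "\<beta> (Suc k) * q = \<beta> k * p" if "k < m" for k using step[OF that] g by simp
  have "\<beta> k * q ^ k = \<beta> 0 * p ^ k" if "k \<le> m" for k
    using that
  proof (induction k)
    case (Suc k)
    have "\<beta> (Suc k) * q ^ Suc k = \<beta> k * q ^ k * p" using s[of k] Suc.prems by (simp add: algebra_simps)
    then show ?case using Suc by simp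
  qed simp
  from this[of m] have "q ^ m dvd \<beta> 0 * p ^ m" by (metis dvd_triv_right order_refl)
  moreover have "coprime (q ^ m) (p ^ m)" using g(3) by simp
  ultimately have "q ^ m dvd \<beta> 0" by (simp add: coprime_dvd_mult_left_iff)
  then have "q ^ m \<le> \<beta> 0" using \<beta>(1) by (rule dvd_imp_le)
  then have "q ^ m < 2 ^ m" using \<beta>(2) by linarith
  then have "q < 2" by (rule power_less_imp_less_base) simp
  then have "q = 1" using g by simp
  then show ?thesis using g by simp
qed

text \<open>The rational root theorem for the monic polynomial x^2 - e x + r at x = w/v.\<close>

lemma quadratic_ratio_integral:
  fixes v w r e :: nat
  assumes v: "v > 0" and eq: "r * v * v + w * w = e * w * v"
  shows "v dvd w"
proof -
  obtain g p q where g: "v = g * q" "w = g * p" "coprime q p" "g > 0" "q > 0" by (rule coprime_ratio[OF v])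
  have "(g * g) * (r * q * q + p * p) = (g * g) * (e * p * q)" using eq g by (simp add: algebra_simps)
  then have "r * q * q + p * p = e * p * q" using g by simp
  then have "q dvd p * p" by (metis dvd_add_right_iff dvd_triv_right)
  then have "q dvd p" using g(3) by (simp add: coprime_dvd_mult_left_iff)
  then have "q = 1" using g(3) by (metis coprime_absorb_left nat_dvd_1_iff_1)
  then show ?thesis using g by simp
qed

text \<open>For 1 \<le> p \<le> e - 1 one has p (e - p) \<ge> e - 1, because (p - 1)(e - p - 1) is
  nonnegative.\<close>

lemma quadratic_extremal:
  fixes e p :: nat
  assumes "p > 0" "p \<le> e" "e * p + 2 \<le> e + p * p"
  shows "p = e"
proof (rule ccontr)
  assume "p \<noteq> e"
  then obtain k where k: "e = p + Suc k" using assms(2) less_iff_Suc_add[of p e] by auto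
  obtain l where l: "p = Suc l" using assms(1) gr0_conv_Suc by blast
  \<comment> \<open>After substitution the inequality reads (k + 1)(l + 1) \<le> k + l.\<close>
  show False using assms(3) unfolding k l by (simp add: algebra_simps)
qed

lemma (in artinian_local_ring) free_cube_zero:
  "mpow 3 = {\<zero>} \<Longrightarrow> ({..<n} \<rightarrow>\<^sub>E mpow 3) = {\<zero>\<^bsub>free_power R n\<^esub>}"
  unfolding free_power_eq by (auto simp: PiE_iff fun_eq_iff extensional_def)

section \<open>Freeness from vanishing Tor in the two cases\<close>

context square_zero_setup
begin

lemma minimal_cover_V:
  obtains \<psi> where "\<psi> \<in> module_hom R (free_power R nuV) V" "\<psi> ` carrier (free_power R nuV) = carrier V"
    "module_kernel (free_power R nuV) V \<psi> \<subseteq> {..<nuV} \<rightarrow>\<^sub>E \<mm>"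
  using V.minimal_cover[OF V.carrier_is_submodule] unfolding nuV_def by metis

lemma free_of_nuV_zero: "nuV = 0 \<Longrightarrow> free_module R V"
proof -
  assume z: "nuV = 0"
  obtain \<psi> where \<psi>: "\<psi> \<in> module_hom R (free_power R nuV) V" "\<psi> ` carrier (free_power R nuV) = carrier V"
    "module_kernel (free_power R nuV) V \<psi> \<subseteq> {..<nuV} \<rightarrow>\<^sub>E \<mm>" by (rule minimal_cover_V)
  have "({..<nuV} \<rightarrow>\<^sub>E \<mm>) = {\<zero>\<^bsub>free_power R nuV\<^esub>}" unfolding free_power_eq z by auto
  then show ?thesis using V.free_of_iso[OF \<psi>(1,2) _ one_neq_zero] \<psi>(3) by simp
qed

lemma rad_syz_zero_of_extremal:
  assumes "tor_exact (Suc i)" "nuV > 0" "b (Suc (Suc i)) = emb_dim * b (Suc i)"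
  shows "rad_syz i = {\<zero>\<^bsub>Fr i\<^esub>}"
  using rad_syz_generators'[OF assms(1,2)] assms(3) by (intro rad_syz_zeroD) simp

lemma betti_Suc_pos: "b (Suc i) > 0 \<Longrightarrow> b (Suc (Suc i)) > 0"
  using betti_zero_back[of i] by auto

lemma betti_step:
  assumes "tor_exact i" "tor_exact (Suc i)" "nuV > 0" "len R V W = nuV * p"
  shows "b (Suc (Suc i)) = b (Suc i) * p"
  using betti_ratio[OF assms(1,2)] assms(3,4) by (simp add: mult.assoc[symmetric])

text \<open>The assumption covers Tor in degrees 1 to m + 1. With 2 \<le> m the three numbers b_1,
  b_2, b_3 are in proportion, and the bound on b_1 makes the proportion an integer p.\<close>

lemma free_of_long_vanishing:
  assumes many: "many_generators R \<mm>"
    and ex: "\<And>i. i \<le> m \<Longrightarrow> tor_exact i" and m: "2 \<le> m" and small: "b 1 < 2 ^ m"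
  shows "free_module R V \<or> free_module R N"
proof -
  interpret many_generators R \<mm> by (rule many)
  consider "nuV = 0" | "b (Suc 0) = 0" | "nuV > 0" "b (Suc 0) > 0" by auto
  then show ?thesis
  proof cases
    case 3
    \<comment> \<open>Vanishing up to index m yields m proportions among b_1, ..., b_(m+1), the
      exponent in the bound on b_1.\<close>
    have "nuV dvd len R V W"
      by (rule ratio_integral[OF 3(1), of m "\<lambda>k. b (Suc k)"]) (use 3 small betti_ratio ex in auto)
    then obtain p where p: "len R V W = nuV * p" by blast
    have e: "tor_exact 0" "tor_exact (Suc 0)" "tor_exact (Suc (Suc 0))" using ex m by simp_all
    have b2: "b 2 = b 1 * p" and b3: "b 3 = b 2 * p"
      using betti_step[OF e(1,2) 3(1) p] betti_step[OF e(2,3) 3(1) p] by (simp_all add: numeral_2_eq_2 numeral_3_eq_3)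
    have b1: "b 1 > 0" and b2p: "b 2 > 0" using 3 betti_Suc_pos[of 0] by (simp_all add: numeral_2_eq_2)
    have p0: "p > 0" using b2 b2p by (cases p) auto
    have g: "ilen R (Fr 1) (Ff.mm 1 (rad_syz 1)) (rad_syz 1) + b 3 = emb_dim * b 2"
      using rad_syz_generators'[OF e(3) 3(1)] by (simp add: numeral_2_eq_2 numeral_3_eq_3)
    have "ilen R (Fr 1) (Ff.mm 1 (rad_syz 1)) (rad_syz 1) + 2 * b 1 \<le> emb_dim * b 1"
      by (rule generators_bound[OF rad_syz_submodule rad_syz_subset])
    then have "emb_dim * b 2 + 2 * b 1 \<le> emb_dim * b 1 + b 3" using g by linarith
    \<comment> \<open>With b_2 = b_1 p and b_3 = b_1 p^2, the exact count e b_2 - b_3 and the upper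
      bound (e - 2) b_1 become p (e - p) \<le> e - 2 after cancelling b_1.\<close>
    then have "b 1 * (emb_dim * p + 2) \<le> b 1 * (emb_dim + p * p)" unfolding b3 b2 by (simp add: algebra_simps)
    then have q: "emb_dim * p + 2 \<le> emb_dim + p * p" using b1 by (rule mult_left_le_imp_le)
    have "b 3 \<le> emb_dim * b 2" using g by linarith
    then have "b 2 * p \<le> b 2 * emb_dim" by (simp only: b3 mult.commute)
    then have "p \<le> emb_dim" using b2p by (rule mult_left_le_imp_le)
    then have pe: "p = emb_dim" by (rule quadratic_extremal[OF p0 _ q])
    \<comment> \<open>Since b_2 = e b_1, no generator is left for the radical of the first
      syzygy.\<close>
    have rs: "rad_syz 0 = {\<zero>\<^bsub>Fr 0\<^esub>}"
      by (rule rad_syz_zero_of_extremal[OF e(2) 3(1)]) (use b2 pe in \<open>simp add: numeral_2_eq_2\<close>)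
    obtain \<psi> where \<psi>: "\<psi> \<in> module_hom R (free_power R nuV) V" "\<psi> ` carrier (free_power R nuV) = carrier V"
      "module_kernel (free_power R nuV) V \<psi> \<subseteq> {..<nuV} \<rightarrow>\<^sub>E \<mm>" by (rule minimal_cover_V)
    have "module_kernel (free_power R nuV) V \<psi> \<subseteq> {\<zero>\<^bsub>free_power R nuV\<^esub>}"
      by (rule free_cover_of_rad_syz_zero[OF e(2) rs 3(2) \<psi>])
    then show ?thesis using V.free_of_iso[OF \<psi>(1,2) _ one_neq_zero] by blast
  qed (auto intro: free_of_nuV_zero free_of_betti_1)
qed

text \<open>The conclusion is shaped for \<open>socle_unit_vec\<close>: in the application V sits
  inside \<mm> G for a free module G, where an injective map from a free module of positive rank is
  impossible.\<close>

lemma injective_cover_of_three_vanishing: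
  assumes many: "many_generators R \<mm>" and cube: "mpow 3 = {\<zero>}"
    and ex: "tor_exact i" "tor_exact (Suc i)" "tor_exact (Suc (Suc i))"
    and V0: "nuV > 0" and bpos: "b (Suc i) > 0"
  obtains \<psi> where "\<psi> \<in> module_hom R (free_power R nuV) V"
    "module_kernel (free_power R nuV) V \<psi> \<subseteq> {\<zero>\<^bsub>free_power R nuV\<^esub>}"
proof -
  interpret many_generators R \<mm> by (rule many)
  let ?i = "Suc i" and ?r = "len R \<L> (mpow 2)"
  note cube0 = free_cube_zero[OF cube]
  \<comment> \<open>An element z of \<mm>^2 F has d z in \<mm>^3 F = 0, so z = d y by exactness of
    the resolution, and y lies in \<mm> F by \<open>diff_reflects_radical\<close>.\<close>
  have rs: "rad_syz ?i = {..<b ?i} \<rightarrow>\<^sub>E mpow 2"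
  proof (rule subset_antisym[OF rad_syz_subset])
    show "({..<b ?i} \<rightarrow>\<^sub>E mpow 2) \<subseteq> rad_syz ?i"
    proof
      fix z assume z: "z \<in> {..<b ?i} \<rightarrow>\<^sub>E mpow 2"
      have zc: "z \<in> carrier (Fr ?i)" using z Fr.submodule_carrier[OF free_power_submodule] by blast
      have "d i z \<in> Ff.mm i (rad_syz i)" unfolding mm_rad_syz using z by blast
      also have "Ff.mm i (rad_syz i) \<subseteq> Ff.mm i ({..<b i} \<rightarrow>\<^sub>E mpow 2)"
        by (rule Ff.mm_mono[OF free_power_submodule rad_syz_subset])
      finally have "d i z = \<zero>\<^bsub>Fr i\<^esub>" unfolding mm_free_m2 cube0 by simp
      then obtain y where y: "y \<in> carrier (Fr (Suc ?i))" "z = d ?i y" using diff_eq_zeroD[OF zc] by blast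
      then have "y \<in> {..<b (Suc ?i)} \<rightarrow>\<^sub>E \<mm>" using diff_reflects_radical[OF ex(2) V0 y(1)] z by simp
      then show "z \<in> rad_syz ?i" unfolding rad_syz_def using y(2) by blast
    qed
  qed
  have zero: "Ff.mm ?i (rad_syz ?i) = {\<zero>\<^bsub>Fr ?i\<^esub>}" unfolding rs mm_free_m2 cube0 ..
  \<comment> \<open>The radical of \<open>rad_syz ?i\<close> is zero, so its number of generators is
    its full length.\<close>
  have "ilen R (Fr ?i) (Ff.mm ?i (rad_syz ?i)) (rad_syz ?i) = b ?i * ?r"
    unfolding zero unfolding rs by (rule len_free[OF power_submodule_ring])
  then have g: "b ?i * ?r + b (Suc (Suc ?i)) = emb_dim * b (Suc ?i)"
    using rad_syz_generators'[OF ex(3) V0] by simp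
  let ?w = "len R V W"
  have r1: "b (Suc ?i) * nuV = b ?i * ?w" and r2: "b (Suc (Suc ?i)) * nuV = b (Suc ?i) * ?w"
    using betti_ratio[OF ex(1,2)] betti_ratio[OF ex(2,3)] by simp_all
  have r3: "b (Suc (Suc ?i)) * nuV * nuV = b ?i * (?w * ?w)"
  proof -
    have "b (Suc (Suc ?i)) * nuV * nuV = (b (Suc ?i) * nuV) * ?w" unfolding r2 by (simp only: mult_ac)
    then show ?thesis unfolding r1 by (simp only: mult.assoc)
  qed
  \<comment> \<open>The count r b_(i+1) + b_(i+3) = e b_(i+2) is multiplied by \<open>nuV\<close>
    twice, so that both later Betti numbers can be expressed through b_(i+1) without
    fractions.\<close>
  have "(b ?i * ?r + b (Suc (Suc ?i))) * nuV * nuV = emb_dim * (b (Suc ?i) * nuV) * nuV"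
    unfolding g by (simp add: algebra_simps)
  then have "b ?i * (?r * nuV * nuV + ?w * ?w) = b ?i * (emb_dim * ?w * nuV)"
    unfolding r1 using r3 by (simp add: algebra_simps)
  then have quad: "?r * nuV * nuV + ?w * ?w = emb_dim * ?w * nuV" using bpos by simp
  then obtain p where p: "?w = nuV * p" using quadratic_ratio_integral[OF V0] by blast
  have "nuV * nuV * (?r + p * p) = nuV * nuV * (emb_dim * p)" using quad unfolding p by (simp add: algebra_simps)
  then have rp: "?r + p * p = emb_dim * p" using V0 by simp
  have b2: "b (Suc ?i) = b ?i * p" by (rule betti_step[OF ex(1,2) V0 p])
  have b3: "b (Suc (Suc ?i)) = b (Suc ?i) * p" by (rule betti_step[OF ex(2,3) V0 p])
  have b2p: "b (Suc ?i) > 0" by (rule betti_Suc_pos[OF bpos])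
  have p0: "p > 0" using b2 b2p by (cases p) auto
  have mm2: "LA.mm (mpow 2) = {\<zero>\<^bsub>\<L>\<^esub>}" using mpow_3 cube by simp
  \<comment> \<open>The bound on generators is applied to \<mm>^2 itself, whose radical \<mm>^3 is
    zero.\<close>
  have re: "?r + 2 \<le> emb_dim" using generators_ideal[OF power_submodule_ring order_refl] unfolding mm2 .
  have "p * p \<le> emb_dim * p" using rp by linarith
  then have "p \<le> emb_dim" using p0 by simp
  moreover have "emb_dim * p + 2 \<le> emb_dim + p * p" using rp re by linarith
  ultimately have pe: "p = emb_dim" by (rule quadratic_extremal[OF p0])
  have rs0: "rad_syz ?i = {\<zero>\<^bsub>Fr ?i\<^esub>}"
    by (rule rad_syz_zero_of_extremal[OF ex(3) V0]) (simp add: b3 pe)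
  obtain \<psi> where \<psi>: "\<psi> \<in> module_hom R (free_power R nuV) V" "\<psi> ` carrier (free_power R nuV) = carrier V"
    "module_kernel (free_power R nuV) V \<psi> \<subseteq> {..<nuV} \<rightarrow>\<^sub>E \<mm>" by (rule minimal_cover_V)
  show thesis by (rule that[OF \<psi>(1) free_cover_of_rad_syz_zero[OF ex(3) rs0 b2p \<psi>]])
qed

end

section \<open>From the notions of the statement to the working ones\<close>

lemma (in plain_module) submodule_restrict_iff:
  assumes I: "submodule I R M"
  shows "submodule H R (M\<lparr>carrier := I\<rparr>) \<longleftrightarrow> submodule H R M \<and> H \<subseteq> I"
proof -
  interpret I: plain_module R "M\<lparr>carrier := I\<rparr>"
    by (simp add: plain_module_def submodule.submodule_is_module[OF I module_axioms])
  show ?thesis unfolding I.submodule_iff submodule_iff using submodule_carrier[OF I] by auto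
qed

lemma module_kernel_restrict: "module_kernel U (V\<lparr>carrier := K\<rparr>) f = module_kernel U V f"
  by (simp add: module_kernel_def)

lemma ideal_module_eq: "ideal_module R I = (ring_module R)\<lparr>carrier := I\<rparr>"
  by (simp add: ideal_module_def)

context artinian_local_ring
begin

lemma al_fl_ring: "al_fl_module R \<mm> \<L>"
  unfolding al_fl_module_def using LA.al_module_axioms LF.finite_length_module_axioms by blast

lemma ideal_module_submodule_iff:
  "submodule I R \<L> \<Longrightarrow> submodule H R (ideal_module R I) \<longleftrightarrow> submodule H R \<L> \<and> H \<subseteq> I"
  unfolding ideal_module_eq[of R I] by (rule L.submodule_restrict_iff)

text \<open>An infimum is bounded above by exhibiting one generating set. Together with
  \<open>module_length_ge\<close> this turns the hypothesis over extended naturals into one over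
  naturals.\<close>

lemma min_gens_le: "min_gens R (ideal_module R \<mm>) \<le> enat emb_dim"
proof -
  obtain S where S: "finite S" "S \<subseteq> \<mm>" "card S \<le> ilen R \<L> (LA.mm \<mm>) \<mm>" "span_module R \<L> S = \<mm>"
    by (rule al_fl_module.small_generating_set[OF al_fl_ring m_submodule])
  have "span_module R (ideal_module R \<mm>) S = \<mm>"
  proof
    have "submodule \<mm> R (ideal_module R \<mm>)" by (simp add: ideal_module_submodule_iff m_submodule)
    then show "span_module R (ideal_module R \<mm>) S \<subseteq> \<mm>" by (rule span_least[OF _ S(2)])
    have "\<mm> \<subseteq> H" if "submodule H R (ideal_module R \<mm>)" "S \<subseteq> H" for H
      using span_least[of H R \<L> S] that S(4) ideal_module_submodule_iff[OF m_submodule] by blast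
    then show "\<mm> \<subseteq> span_module R (ideal_module R \<mm>) S" unfolding span_module_def by blast
  qed
  then have "generates_module R (ideal_module R \<mm>) S" using S(2) by (simp add: generates_module_def ideal_module_def)
  then have "min_gens R (ideal_module R \<mm>) \<le> enat (card S)"
    unfolding min_gens_def using S(1) by (intro INF_lower) simp
  also have "\<dots> \<le> enat emb_dim" using S(3) unfolding emb_dim_def mpow_2 by simp
  finally show ?thesis .
qed

text \<open>A supremum is bounded below by exhibiting one chain, here a longest chain of ideals
  inside \<mm>^2.\<close>

lemma module_length_ge: "enat (len R \<L> (mpow 2)) \<le> module_length R (ideal_module R (mpow 2))"
proof -
  have I: "submodule (mpow 2) R \<L>" by (rule power_submodule_ring)
  have z: "{\<zero>\<^bsub>\<L>\<^esub>} \<subseteq> mpow 2" using zero_in_power by simp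
  have "chain_in R \<L> {\<zero>\<^bsub>\<L>\<^esub>} (mpow 2) (len R \<L> (mpow 2))"
    by (rule ilen_chain[OF LF.fin[OF I L.submodule_zero] I z])
  then obtain C where C: "is_chain R \<L> {\<zero>\<^bsub>\<L>\<^esub>} (mpow 2) (len R \<L> (mpow 2)) C" unfolding chain_in_def by blast
  have "\<forall>i\<le>len R \<L> (mpow 2). submodule (C i) R (ideal_module R (mpow 2))"
    using is_chainD(1)[OF C] ideal_module_submodule_iff[OF I] by blast
  moreover have "\<forall>i<len R \<L> (mpow 2). C i \<subset> C (Suc i)" using is_chainD(2)[OF C] by blast
  ultimately show ?thesis unfolding module_length_def by (intro SUP_upper CollectI exI[of _ C] conjI)
qed

lemma many_generatorsI:
  assumes "module_length R (ideal_module R (ideal_power R \<mm> 2)) + 4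
    \<le> min_gens R (ideal_module R \<mm>) + enat (loewy_length R \<mm>)"
  shows "many_generators R \<mm>"
proof unfold_locales
  have "enat (len R \<L> (mpow 2)) + 4 \<le> module_length R (ideal_module R (mpow 2)) + 4"
    by (rule add_right_mono[OF module_length_ge])
  also have "\<dots> \<le> min_gens R (ideal_module R \<mm>) + enat (loewy_length R \<mm>)" using assms unfolding mpow_def .
  also have "\<dots> \<le> enat emb_dim + enat (loewy_length R \<mm>)" by (rule add_right_mono[OF min_gens_le])
  finally show "len R \<L> (mpow 2) + 4 \<le> emb_dim + loewy_length R \<mm>"
    by (simp add: numeral_eq_enat)
qed

lemma finitely_generated_al_fl:
  assumes "module R V" "finitely_generated R V" shows "al_fl_module R \<mm> V"
  using al_moduleI[OF assms(1)] al_module.finitely_generated_finite_length[OF _ assms(2)]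
  unfolding al_fl_module_def by blast

lemma restrict_al_fl:
  assumes F: "al_fl_module R \<mm> V" and K: "submodule K R V"
  shows "al_fl_module R \<mm> (V\<lparr>carrier := K\<rparr>)"
proof -
  interpret F: al_fl_module R \<mm> V by (rule F)
  have KM: "module R (V\<lparr>carrier := K\<rparr>)" by (rule submodule.submodule_is_module[OF K F.module_axioms])
  have "chain_in R V {\<zero>\<^bsub>V\<^esub>} (carrier V) n" if "chain_in R (V\<lparr>carrier := K\<rparr>) {\<zero>\<^bsub>V\<^esub>} K n" for n
    using that F.submodule_restrict_iff[OF K] F.submodule_carrier
    unfolding chain_in_def is_chain_def by meson
  then have "finite_ilen R (V\<lparr>carrier := K\<rparr>) {\<zero>\<^bsub>V\<^esub>} K"
    using F.finite_len unfolding finite_ilen_def by meson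
  then show ?thesis using al_moduleI[OF KM]
    unfolding al_fl_module_def finite_length_module_def finite_length_module_axioms_def al_module_def by simp
qed

lemma minimal_resI:
  assumes N: "module R N" and mr: "minimal_free_resolution R \<mm> N b d \<epsilon>"
  shows "minimal_res R \<mm> N b d \<epsilon>"
proof -
  have "d i ` carrier (free_power R (b (Suc i))) \<subseteq> {..<b i} \<rightarrow>\<^sub>E \<mm>" for i
    using mr unfolding minimal_free_resolution_def ideal_smult_eq L.free_carrier mm_carrier_free by blast
  moreover have "resolution R N b d \<epsilon>"
    using N mr by (simp add: resolution_def resolution_axioms_def plain_module_def minimal_free_resolution_def)
  ultimately show ?thesis
    by (simp add: minimal_res_def minimal_res_axioms_def artinian_local_ring_axioms)
qed

text \<open>The resolution inside \<open>Tor\<close> is a \<open>SOME\<close> choice and may fail to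
  be minimal. That a resolution exists shows that the chosen pair is one, for some augmentation, and
  exactness is carried over to the minimal one.\<close>

lemma Tor_zero_exact_minimal:
  assumes M: "module R M" and N: "module R N" and mr: "minimal_free_resolution R \<mm> N b d \<epsilon>"
    and zero: "zero_module (Tor R (Suc i) M N)"
  shows "exact_at R M (b (Suc (Suc i))) (b (Suc i)) (b i) (d (Suc i)) (d i)"
proof -
  let ?b = "fst (chosen_resolution R N)" and ?d = "snd (chosen_resolution R N)"
  have fr: "free_resolution R N b d \<epsilon>" using mr by (simp add: minimal_free_resolution_def)
  then have "\<exists>z. case z of (b, d) \<Rightarrow> \<exists>\<epsilon>. free_resolution R N b d \<epsilon>" by auto
  from someI_ex[OF this] have "case chosen_resolution R N of (b, d) \<Rightarrow> \<exists>\<epsilon>. free_resolution R N b d \<epsilon>"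
    unfolding chosen_resolution_def .
  then obtain \<epsilon>' where e: "free_resolution R N ?b ?d \<epsilon>'" by (auto simp: case_prod_beta)
  interpret two_resolutions R N ?b ?d \<epsilon>' b d \<epsilon>
    using N fr e by (simp add: two_resolutions_def resolution_def resolution_axioms_def plain_module_def)
  show ?thesis by (rule exact_at_transfer[OF M Tor_zero_imp_exact[OF M e zero]])
qed

end

theorem theorem3p1:
  fixes R :: "('a, 'r) ring_scheme" and \<mm> :: "'a set"
    and M :: "('a, 'm) module" and N :: "('a, 'n) module"
  assumes "artinian_local_ring R \<mm>"
    and "min_gens R (ideal_module R \<mm>) + enat (loewy_length R \<mm>)
           \<ge> module_length R (ideal_module R (ideal_power R \<mm> 2)) + 4"
    and "module R M" and "finitely_generated R M"
    and "module R N" and "finitely_generated R N"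
  shows "(ideal_smult R (ideal_power R \<mm> 2) M = {\<zero>\<^bsub>M\<^esub>} \<and>
            (\<forall>i::nat. 1 \<le> i \<and> real i \<le> tor_bound R \<mm> N \<longrightarrow> zero_module (Tor R i M N))
          \<longrightarrow> free_module R M \<or> free_module R N) \<and>
         (ideal_power R \<mm> 3 = {\<zero>\<^bsub>R\<^esub>} \<and>
            (\<exists>j\<ge>2. zero_module (Tor R j M N) \<and> zero_module (Tor R (j + 1) M N) \<and>
                    zero_module (Tor R (j + 2) M N))
          \<longrightarrow> free_module R M \<or> free_module R N)"
proof -
  interpret artinian_local_ring R \<mm> by (rule assms(1))
  have many: "many_generators R \<mm>" by (rule many_generatorsI[OF assms(2)])
  interpret MF: al_fl_module R \<mm> M by (rule finitely_generated_al_fl[OF assms(3,4)])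
  interpret NF: al_fl_module R \<mm> N by (rule finitely_generated_al_fl[OF assms(5,6)])
  \<comment> \<open>Taking b to be the very function selected in \<open>betti\<close> makes the
    number in \<open>tor_bound\<close> equal to \<open>b 1\<close> by definition.\<close>
  define b where "b = betti R \<mm> N"
  have "\<exists>d \<epsilon>. minimal_free_resolution R \<mm> N b d \<epsilon>"
    unfolding b_def betti_def
    by (rule someI_ex[of "\<lambda>b. \<exists>d \<epsilon>. minimal_free_resolution R \<mm> N b d \<epsilon>"]) (rule NF.minimal_free_resolution_exists)
  then obtain d \<epsilon> where mr: "minimal_free_resolution R \<mm> N b d \<epsilon>" by blast
  have res: "minimal_res R \<mm> N b d \<epsilon>" by (rule minimal_resI[OF assms(5) mr])
  interpret minimal_res R \<mm> N b d \<epsilon> by (rule res)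
  note Tor_exact = Tor_zero_exact_minimal[OF assms(3,5) mr]
  show ?thesis
  proof (intro conjI impI; elim conjE)
    assume sq: "ideal_smult R (ideal_power R \<mm> 2) M = {\<zero>\<^bsub>M\<^esub>}"
      and van: "\<forall>i::nat. 1 \<le> i \<and> real i \<le> tor_bound R \<mm> N \<longrightarrow> zero_module (Tor R i M N)"
    have "MF.mm (MF.mm (carrier M)) \<subseteq> smult_span R M (mpow 2) (carrier M)"
      unfolding mpow_2 by (rule MF.smult_span_assoc[OF m_carrier m_carrier order_refl])
    also have "\<dots> = {\<zero>\<^bsub>M\<^esub>}" using sq unfolding ideal_smult_eq mpow_def .
    finally have "MF.mm (MF.mm (carrier M)) = {\<zero>\<^bsub>M\<^esub>}"
      using MF.mm_submodule[OF MF.mm_submodule[OF MF.carrier_is_submodule]] by (auto simp: MF.submodule_iff)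
    then interpret square_zero_setup R \<mm> N b d \<epsilon> M
      by (simp add: square_zero_setup_def square_zero_setup_axioms_def res MF.al_fl_module_axioms)
    \<comment> \<open>The largest integer degree in which Tor is assumed to vanish; by the offset of
      \<open>tor_exact\<close> it serves the indices up to c - 1.\<close>
    define c where "c = nat \<lfloor>tor_bound R \<mm> N\<rfloor>"
    have tb4: "4 \<le> tor_bound R \<mm> N" by (simp add: tor_bound_def)
    have c: "real c \<le> tor_bound R \<mm> N" "tor_bound R \<mm> N < real c + 1" "4 \<le> c"
      using tb4 unfolding c_def by (simp_all, linarith+)
    have ex: "tor_exact i" if "i \<le> c - 1" for i
      unfolding tor_exact_def by (rule Tor_exact) (use van that c in auto)
    \<comment> \<open>The summand 2 in \<open>tor_bound\<close> pays for rounding down to c and for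
      the passage from c to c - 1.\<close>
    have "b 1 < 2 ^ (c - 1)"
    proof (cases "b 1 = 0")
      case False
      then have "log 2 (real (b 1)) + 2 \<le> tor_bound R \<mm> N" by (simp add: tor_bound_def b_def)
      then have "log 2 (real (b 1)) < real (c - 1)" using c by (simp add: of_nat_diff)
      then have "real (b 1) < 2 powr real (c - 1)" using False by (subst (asm) log_less_iff) auto
      then have "real (b 1) < real (2 ^ (c - 1))" by (simp add: powr_realpow)
      then show ?thesis using of_nat_less_iff by blast
    qed simp
    then show "free_module R M \<or> free_module R N"
      using c(3) by (intro free_of_long_vanishing[OF many, of "c - 1"] ex) auto
  next
    assume cube: "ideal_power R \<mm> 3 = {\<zero>\<^bsub>R\<^esub>}"
      and "\<exists>j\<ge>2. zero_module (Tor R j M N) \<and> zero_module (Tor R (j + 1) M N) \<and> zero_module (Tor R (j + 2) M N)"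
    then obtain j where "2 \<le> j" and van: "zero_module (Tor R j M N)" "zero_module (Tor R (j + 1) M N)"
      "zero_module (Tor R (j + 2) M N)" by blast
    \<comment> \<open>One degree is lost in passing to the syzygy of M and one in the indexing of
      \<open>tor_exact\<close>; hence degrees from 2 on.\<close>
    then obtain i where j: "j = Suc (Suc i)" by (metis add_2_eq_Suc le_Suc_ex)
    have cube': "mpow 3 = {\<zero>\<^bsub>R\<^esub>}" unfolding mpow_def by (rule cube)
    obtain n \<phi> where \<phi>: "\<phi> \<in> module_hom R (free_power R n) M" "\<phi> ` carrier (free_power R n) = carrier M"
      "module_kernel (free_power R n) M \<phi> \<subseteq> {..<n} \<rightarrow>\<^sub>E \<mm>"
      using MF.minimal_cover[OF MF.carrier_is_submodule] by metis
    interpret G: al_fl_module R \<mm> "free_power R n" by (rule free_al_fl)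
    interpret h: module_homomorphism R "free_power R n" M \<phi>
      by (intro module_homI G.module_axioms assms(3) \<phi>(1))
    let ?K = "module_kernel (free_power R n) M \<phi>"
    let ?KM = "(free_power R n)\<lparr>carrier := ?K\<rparr>"
    have Ks: "submodule ?K R (free_power R n)" by (rule h.kernel_submodule)
    interpret K: al_fl_module R \<mm> ?KM by (rule restrict_al_fl[OF G.al_fl_module_axioms Ks])
    have incl: "module_homomorphism R ?KM (free_power R n) (\<lambda>x. x)"
      by (intro module_homI K.module_axioms G.module_axioms) (auto simp: module_hom_def module_kernel_def)
    interpret incl: module_homomorphism R ?KM "free_power R n" "\<lambda>x. x" by (rule incl)
    have mmK: "K.mm A = G.mm A" if "submodule A R ?KM" for A
      using incl.image_smult_span[OF m_carrier K.submodule_carrier[OF that]] by simp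
    have "K.mm (K.mm (carrier ?KM)) = G.mm (G.mm ?K)"
      using mmK[OF K.carrier_is_submodule] mmK[OF K.mm_submodule[OF K.carrier_is_submodule]] by simp
    \<comment> \<open>The kernel of a minimal cover lies in \<mm> G, so \<mm>^2 K lies in \<mm>^3 G,
      which is zero.\<close>
    also have "\<dots> \<subseteq> G.mm (G.mm ({..<n} \<rightarrow>\<^sub>E \<mm>))"
      by (intro G.mm_mono G.mm_submodule free_m_submodule \<phi>(3))
    also have "\<dots> = {\<zero>\<^bsub>free_power R n\<^esub>}"
      unfolding mm_free_m mm_free_m2 by (rule free_cube_zero[OF cube'])
    finally have "K.mm (K.mm (carrier ?KM)) = {\<zero>\<^bsub>?KM\<^esub>}"
      using K.mm_submodule[OF K.mm_submodule[OF K.carrier_is_submodule]] by (auto simp: K.submodule_iff)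
    then interpret square_zero_setup R \<mm> N b d \<epsilon> ?KM
      by (simp add: square_zero_setup_def square_zero_setup_axioms_def res K.al_fl_module_axioms)
    \<comment> \<open>Dimension shifting along 0 -> K -> R^n -> M -> 0, the middle term being
      acyclic.\<close>
    have shift: "tor_exact k" if "zero_module (Tor R (Suc (Suc k)) M N)" for k
      unfolding tor_exact_def
      by (rule h.exact_at_kernel[OF diff_hom diff_hom diff_hom diff_diff \<phi>(2) Tor_exact[OF that]
            L.exact_at_free[OF diff_hom diff_hom diff_eq_zeroD]])
    have ex: "tor_exact i" "tor_exact (Suc i)" "tor_exact (Suc (Suc i))"
      using shift van by (simp_all add: j)
    show "free_module R M \<or> free_module R N"
    proof (cases "b (Suc i) = 0")
      case True
      show ?thesis by (rule disjI2[OF free_of_betti_1[OF betti_zero_1[OF True]]])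
    next
      case False
      \<comment> \<open>Otherwise \<psi> followed by the inclusion of K in \<mm> R^n would be an
        injective map with entries in \<mm> from a free module of positive rank.\<close>
      have "nuV = 0"
      proof (rule ccontr)
        assume nz: "nuV \<noteq> 0"
        obtain \<psi> where \<psi>: "\<psi> \<in> module_hom R (free_power R nuV) ?KM"
          "module_kernel (free_power R nuV) ?KM \<psi> \<subseteq> {\<zero>\<^bsub>free_power R nuV\<^esub>}"
          by (rule injective_cover_of_three_vanishing[OF many cube' ex]) (use nz False in simp_all)
        have \<psi>': "\<psi> \<in> module_hom R (free_power R nuV) (free_power R n)"
          using module_hom_comp[OF \<psi>(1) incl.hom] by simp
        have im: "\<psi> ` carrier (free_power R nuV) \<subseteq> {..<n} \<rightarrow>\<^sub>E \<mm>"
          using \<psi>(1) \<phi>(3) by (auto simp: module_hom_def)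
        have ker: "module_kernel (free_power R nuV) (free_power R n) \<psi> \<subseteq> {\<zero>\<^bsub>free_power R nuV\<^esub>}"
          using \<psi>(2) unfolding module_kernel_restrict .
        show False
          by (rule socle_unit_vec[OF module_homI[OF L.free_module_module L.free_module_module \<psi>'] im _ ker])
            (use nz in simp)
      qed
      \<comment> \<open>Now K equals its own radical and vanishes, so the cover \<phi> of M is an
        isomorphism.\<close>
      then have "carrier ?KM \<subseteq> K.mm (carrier ?KM)"
        using K.len_eqD[OF K.carrier_is_submodule W_submodule K.mm_subset[OF K.carrier_is_submodule]] len_V by simp
      then have "?K \<subseteq> {\<zero>\<^bsub>free_power R n\<^esub>}" using K.mm_eq_self[OF K.carrier_is_submodule] by simp
      then show ?thesis using MF.free_of_iso[OF \<phi>(1,2) _ one_neq_zero] by blast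
    qed
  qed
qed

end
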